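(* Let $Q=(q_{ij})_{i,j\in\mathcal{S}}$ be a quasi-stochastic matrix with positive left and right eigenvectors $\mathsf{u},\mathsf{v}$, and let $F=(F_{ij})_{i,j\in\mathcal{S}}$ be a matrix of proper distribution functions on $\mathbb{R}$. Suppose that $\sum_{n\ge 1}q_{ii}^{(n)}=\infty$ for some $i\in\mathcal{S}$, that $\mu:=\sum_{i,j\in\mathcal{S}}\mathsf{u}_i q_{ij}\mathsf{v}_j\int x\,F_{ij}(dx)>0$, and that $Q\otimes F$ is nonarithmetic. Let $z:\mathcal{S}\times\mathbb{R}\to\mathbb{R}$ be $\mathsf{u}$-directly Riemann integrable; or, if $Q\otimes F$ is even spread out, let $z$ be measurable such that each $z_i:=z(i,\cdot)$ is bounded with $\lim_{|x|\to\infty}z_i(x)=0$, $\sum_{i\in\mathcal{S}}\mathsf{u}_i\|z_i\|_\infty<\infty$ and $\sum_{i\in\mathcal{S}}\mathsf{u}_i\|z_i\|_1<\infty$. Then $Z^*:=\mathbb{V}*z$ is an element of $\mathcal{L}$ and the unique solution to the Markov renewal equation $Z=z+(Q\otimes F)*Z$ in $\mathcal{L}_0(Z^* )$. It is also the unique solution in the class $\mathcal{L}_0$ if $\mathcal{S}$ is finite or, more generally, $Z^*\in\mathcal{L}_0$.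
   Context: $\mathcal{S}=\{1,\dots,m\}$ for some $m\in\mathbb{N}$, or $\mathcal{S}=\mathbb{N}$. A matrix $Q=(q_{ij})_{i,j\in\mathcal{S}}$ is called quasi-stochastic if it is an irreducible nonnegative matrix with maximal eigenvalue $1$ for which there exist positive left and right eigenvectors $\mathsf{u}=(\mathsf{u}_i)_{i\in\mathcal{S}}$, $\mathsf{v}=(\mathsf{v}_i)_{i\in\mathcal{S}}$ (all entries strictly positive), unique up to scaling, i.e. $\mathsf{u}^\top Q=\mathsf{u}^\top$ and $Q\mathsf{v}=\mathsf{v}$. (For infinite $\mathcal{S}$, "maximal eigenvalue $1$" is understood to mean only that such positive eigenvectors for the eigenvalue $1$ exist and are unique up to scaling, so that e.g. every irreducible recurrent stochastic matrix is included.) Fix such $\mathsf{u},\mathsf{v}$ (if $\sum_i\mathsf{u}_i<\infty$ and $\sum_i \mathsf{u}_i\mathsf{v}_i<\infty$ they may be normalized by $\sum_i\mathsf{u}_i=\sum_i\mathsf{u}_i\mathsf{v}_i=1$). Write $Q^n=(q_{ij}^{(n)})$; all entries are finite. Distribution functions are identified with their probability measures. $Q\otimes F(t):=(q_{ij}F_{ij}(t))_{i,j}$. The convolution powers are $(Q\otimes F)^{*0}(t)=$ identity matrix for $t\ge0$ and zero matrix for $t<0$, and $(Q\otimes F)^{*n}_{ij}(t)=\sum_{k\in\mathcal{S}}\int_{\mathbb{R}}(Q\otimes F)^{*(n-1)}_{kj}(t-x)\,q_{ik}F_{ik}(dx)$ for $n\ge1$. When $q_{ij}^{(n)}>0$,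 $F_{ij}^{*n}$ denotes the distribution function with $(Q\otimes F)^{*n}_{ij}=q_{ij}^{(n)}F_{ij}^{*n}$. The matrix renewal measure associated with $Q\otimes F$ is $\mathbb{V}=(\mathbb{V}_{ij})_{i,j}$, the matrix of measures on $\mathbb{R}$ determined by $\mathbb{V}((t,t+h])=\sum_{n\ge0}\big((Q\otimes F)^{*n}(t+h)-(Q\otimes F)^{*n}(t)\big)$, $t\in\mathbb{R}$, $h>0$. For $z:\mathcal{S}\times\mathbb{R}\to\mathbb{R}$, $(\mathbb{V}*z)_i(t):=\sum_{j\in\mathcal{S}}\int_{\mathbb{R}}z_j(t-x)\,\mathbb{V}_{ij}(dx)$. The equation $Z=z+(Q\otimes F)*Z$ means $Z_i(t)=z_i(t)+\sum_{j\in\mathcal{S}}q_{ij}\int_{\mathbb{R}}Z_j(t-x)\,F_{ij}(dx)$ for all $t\in\mathbb{R}$, $i\in\mathcal{S}$, the sums and integrals being required to exist (absolutely). In the definition of $\mu$ it is understood that the double sum/integral is well-defined (possibly $+\infty$), i.e. $\sum_{i,j}\mathsf{u}_iq_{ij}\mathsf{v}_j\int x^{-}F_{ij}(dx)<\infty$ or the same with $x^+$. $Q\otimes F$ is called $d$-arithmetic if $d$ is the maximal positive number such that, for some function $\gamma:\mathcal{S}\to[0,d)$, $F_{ij}(\gamma(j)-\gamma(i)+d\mathbb{Z})=1$ for all $i,j\in\mathcal{S}$ with $\mathsf{u}_iq_{ij}\mathsf{v}_j>0$. If no such $d$ exists, $Q\otimes F$ is called nonarithmetic. $Q\otimes F$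 is called spread out if $F_{ij}^{*n}$ is nonsingular with respect to Lebesgue measure for some $n\in\mathbb{N}$ and some $i,j\in\mathcal{S}$ with $\mathsf{u}_iq_{ij}^{(n)}\mathsf{v}_j>0$ (this implies nonarithmetic). A measurable $g:\mathcal{S}\times\mathbb{R}\to\mathbb{R}$, with $g_i:=g(i,\cdot)$, is called $\mathsf{u}$-directly Riemann integrable if each $g_i$ is Lebesgue-almost everywhere continuous and $\sum_{i\in\mathcal{S}}\mathsf{u}_i\sum_{n\in\mathbb{Z}}\sup_{n\varepsilon<x\le(n+1)\varepsilon}|g_i(x)|<\infty$ for some $\varepsilon>0$. $\|\cdot\|_\infty$ denotes the sup-norm and $\|\cdot\|_1$ the $L^1$-norm with respect to Lebesgue measure. Function classes: for measurable $Z:\mathcal{S}\times\mathbb{R}\to\mathbb{R}$ put $\widehat{Z}_i:=\mathsf{v}_i^{-1}Z_i$, where $Z_i=Z(i,\cdot)$. Then $\mathcal{L}:=\{Z:\ \|\widehat{Z}_i\|_\infty<\infty\text{ and }\lim_{t\to-\infty}\widehat{Z}_i(t)=0\text{ for all }i\in\mathcal{S}\}$, $\mathcal{L}_0:=\{Z\in\mathcal{L}:\ \sup_{i\in\mathcal{S}}\|\widehat{Z}_i\|_\infty<\infty\}$, and $\mathcal{L}_0(g):=\{Z:\ Z-g\in\mathcal{L}_0\}$. *)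

theory Defs
  imports "HOL-Probability.Probability"
begin

text \<open>
  The index set is the universe of a countable type \<open>'s\<close> (finite and nonempty, or countably
  infinite).  A matrix of distribution functions is a matrix \<open>F\<close> of real measures with
  \<open>real_distribution (F i j)\<close>; the distribution function itself is \<open>cdf (F i j)\<close>.
\<close>

section \<open>Quasi-stochastic matrices\<close>

text \<open>
  For a nonnegative \<open>Q\<close> with a positive right eigenvector \<open>v\<close> for the eigenvalue 1, the series
  below converges (its sum is at most \<open>v i / v j\<close>), so \<^const>\<open>infsum\<close> never takes its default
  value 0 here.
\<close>

primrec mat_pow :: "('s \<Rightarrow> 's \<Rightarrow> real) \<Rightarrow> nat \<Rightarrow> 's \<Rightarrow> 's \<Rightarrow> real" where
  "mat_pow Q 0 i j = (if i = j then 1 else 0)"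
| "mat_pow Q (Suc n) i j = (\<Sum>\<^sub>\<infinity>k\<in>UNIV. Q i k * mat_pow Q n k j)"

definition irreducible_mat :: "('s \<Rightarrow> 's \<Rightarrow> real) \<Rightarrow> bool" where
  "irreducible_mat Q \<longleftrightarrow> (\<forall>i j. \<exists>n\<ge>1. mat_pow Q n i j > 0)"

definition eigenvalue_mat :: "('s \<Rightarrow> 's \<Rightarrow> real) \<Rightarrow> complex \<Rightarrow> bool" where
  "eigenvalue_mat Q l \<longleftrightarrow>
     (\<exists>x. x \<noteq> (\<lambda>_. 0) \<and> (\<forall>i. (\<Sum>j\<in>UNIV. of_real (Q i j) * x j) = l * x i))"

definition positive_left_eigenvector :: "('s \<Rightarrow> 's \<Rightarrow> real) \<Rightarrow> ('s \<Rightarrow> real) \<Rightarrow> bool" where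
  "positive_left_eigenvector Q u \<longleftrightarrow>
     (\<forall>i. u i > 0) \<and> (\<forall>j. ((\<lambda>i. u i * Q i j) has_sum u j) UNIV)"

definition positive_right_eigenvector :: "('s \<Rightarrow> 's \<Rightarrow> real) \<Rightarrow> ('s \<Rightarrow> real) \<Rightarrow> bool" where
  "positive_right_eigenvector Q v \<longleftrightarrow>
     (\<forall>i. v i > 0) \<and> (\<forall>i. ((\<lambda>j. Q i j * v j) has_sum v i) UNIV)"

text \<open>
  For an infinite index set, ``maximal eigenvalue 1'' means no more than the existence and
  uniqueness of the positive eigenvectors; for a finite one it is the usual spectral condition.
\<close>

definition quasi_stochastic :: "('s \<Rightarrow> 's \<Rightarrow> real) \<Rightarrow> bool" where
  "quasi_stochastic Q \<longleftrightarrow>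
     (\<forall>i j. Q i j \<ge> 0) \<and> irreducible_mat Q \<and>
     (finite (UNIV :: 's set) \<longrightarrow>
        eigenvalue_mat Q 1 \<and> (\<forall>l. eigenvalue_mat Q l \<longrightarrow> cmod l \<le> 1)) \<and>
     (\<exists>u. positive_left_eigenvector Q u \<and>
        (\<forall>u'. positive_left_eigenvector Q u' \<longrightarrow> (\<exists>c. u' = (\<lambda>i. c * u i)))) \<and>
     (\<exists>v. positive_right_eigenvector Q v \<and>
        (\<forall>v'. positive_right_eigenvector Q v' \<longrightarrow> (\<exists>c. v' = (\<lambda>i. c * v i))))"


section \<open>Convolution powers and the renewal measure\<close>

primrec conv_pow ::
    "('s \<Rightarrow> 's \<Rightarrow> real) \<Rightarrow> ('s \<Rightarrow> 's \<Rightarrow> real measure) \<Rightarrow> nat \<Rightarrow> 's \<Rightarrow> 's \<Rightarrow> real \<Rightarrow> real" where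
  "conv_pow Q F 0 i j t = (if i = j \<and> t \<ge> 0 then 1 else 0)"
| "conv_pow Q F (Suc n) i j t =
     (\<Sum>\<^sub>\<infinity>k\<in>UNIV. Q i k * (\<integral>x. conv_pow Q F n k j (t - x) \<partial>F i k))"

text \<open>The law \<open>F\<^sub>i\<^sub>j\<^sup>*\<^sup>n\<close>; meaningful only if \<open>mat_pow Q n i j > 0\<close>.\<close>

definition conv_law ::
    "('s \<Rightarrow> 's \<Rightarrow> real) \<Rightarrow> ('s \<Rightarrow> 's \<Rightarrow> real measure) \<Rightarrow> nat \<Rightarrow> 's \<Rightarrow> 's \<Rightarrow> real measure" where
  "conv_law Q F n i j = interval_measure (\<lambda>t. conv_pow Q F n i j t / mat_pow Q n i j)"

text \<open>
  Each \<open>conv_pow Q F n i j\<close> is nondecreasing and right continuous, hence induces a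
  Lebesgue--Stieltjes measure; the renewal measure is the sum of these over \<open>n\<close>.  Its defining
  values on half-open intervals are given by \<open>emeasure_renewal_measure_Ioc\<close> below.
\<close>

definition renewal_measure ::
    "('s \<Rightarrow> 's \<Rightarrow> real) \<Rightarrow> ('s \<Rightarrow> 's \<Rightarrow> real measure) \<Rightarrow> 's \<Rightarrow> 's \<Rightarrow> real measure" where
  "renewal_measure Q F i j =
     measure_of UNIV (sets borel) (\<lambda>A. \<Sum>n. emeasure (interval_measure (conv_pow Q F n i j)) A)"

context
  fixes Q :: "'s::countable \<Rightarrow> 's \<Rightarrow> real" and F :: "'s \<Rightarrow> 's \<Rightarrow> real measure" and v :: "'s \<Rightarrow> real"
  assumes Q_nonneg: "\<And>i j. Q i j \<ge> 0"
    and v: "positive_right_eigenvector Q v"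
    and F: "\<And>i j. real_distribution (F i j)"
begin

lemma mat_pow_facts:
  "mat_pow Q n i j \<ge> 0 \<and> mat_pow Q n i j \<le> v i / v j \<and>
   (\<lambda>k. Q i k * mat_pow Q n k j) summable_on UNIV"
proof (induction n arbitrary: i)
  have vpos: "v i > 0" for i using v by (simp add: positive_right_eigenvector_def)
  have vs: "((\<lambda>k. Q i k * (v k / v j)) has_sum (v i / v j)) UNIV" for i
  proof -
    have "((\<lambda>k. Q i k * v k) has_sum v i) UNIV"
      using v by (simp add: positive_right_eigenvector_def)
    from has_sum_cmult_left[OF this, of "1 / v j"] show ?thesis by (simp add: mult.assoc)
  qed
  have summ: "(\<lambda>k. Q i k * f k) summable_on UNIV"
    if "\<And>k. f k \<ge> 0" "\<And>k. f k \<le> v k / v j" for f i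
    by (rule summable_on_comparison_test[OF has_sum_imp_summable[OF vs[of i]]])
       (auto intro!: mult_left_mono mult_nonneg_nonneg Q_nonneg that simp del: times_divide_eq_right)
  {
    case 0
    have "v j \<noteq> 0" "v k / v j \<ge> 0" for k
      using vpos[of j] vpos[of k] by (auto intro: less_imp_le)
    then show ?case by (auto intro!: summ)
  next
    case (Suc n)
    have a: "mat_pow Q (Suc n) i j \<ge> 0" for i
      using Suc by (auto intro!: infsum_nonneg mult_nonneg_nonneg Q_nonneg)
    have b: "mat_pow Q (Suc n) i j \<le> v i / v j" for i
    proof -
      have "mat_pow Q (Suc n) i j \<le> (\<Sum>\<^sub>\<infinity>k\<in>UNIV. Q i k * (v k / v j))"
        unfolding mat_pow.simps
        by (rule infsum_mono) (use Suc has_sum_imp_summable[OF vs] in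
            \<open>auto intro!: mult_left_mono Q_nonneg simp del: times_divide_eq_right\<close>)
      also have "\<dots> = v i / v j" using vs by (rule infsumI)
      finally show ?thesis .
    qed
    show ?case using a b summ[of "\<lambda>k. mat_pow Q (Suc n) k j"] by blast
  }
qed

lemma conv_pow_facts:
  "(\<forall>t. 0 \<le> conv_pow Q F n i j t \<and> conv_pow Q F n i j t \<le> mat_pow Q n i j) \<and>
   mono (conv_pow Q F n i j) \<and> (\<forall>a. continuous (at_right a) (conv_pow Q F n i j))"
proof (induction n arbitrary: i)
  case 0
  have "((\<lambda>t. if i = j \<and> t \<ge> 0 then 1 else 0 :: real) \<longlongrightarrow> (if i = j \<and> a \<ge> 0 then 1 else 0))
          (at_right a)" for a :: real
  proof (cases "a \<ge> 0")
    case True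
    have "eventually (\<lambda>t. t > a) (at_right a)" by (simp add: eventually_at_right_less)
    then show ?thesis
      by (rule tendsto_eventually[OF eventually_mono]) (use True in auto)
  next
    case False
    then have "eventually (\<lambda>t. t < 0) (at_right a)"
      using eventually_at_right_real[of a 0] by (auto elim: eventually_mono)
    then show ?thesis
      by (rule tendsto_eventually[OF eventually_mono]) (use False in auto)
  qed
  then show ?case
    by (auto simp: mono_def continuous_within)
next
  case (Suc n)
  define c where "c k = conv_pow Q F n k j" for k
  define M where "M k = mat_pow Q n k j" for k
  have c0: "0 \<le> c k t" and cM: "c k t \<le> M k" and cmono: "mono (c k)"
    and crc: "continuous (at_right a) (c k)" for k t a
    using Suc[of k] by (auto simp: c_def M_def)
  have cm[measurable]: "c k \<in> borel_measurable borel" for k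
    by (rule borel_measurable_mono[OF cmono])
  have pm: "prob_space (F i k)" and sF[measurable_cong]: "sets (F i k) = sets borel" for k
    using F[of i k] by (auto simp: real_distribution_def real_distribution_axioms_def)
  have int: "integrable (F i k) (\<lambda>x. c k (t - x))" for k t
  proof -
    interpret prob_space "F i k" by (rule pm)
    show ?thesis
      by (rule integrable_const_bound[where B = "M k"]) (use c0 cM in auto)
  qed
  define g where "g t k = Q i k * (\<integral>x. c k (t - x) \<partial>F i k)" for t k
  have I0: "0 \<le> (\<integral>x. c k (t - x) \<partial>F i k)" for k t by (simp add: c0)
  have IM: "(\<integral>x. c k (t - x) \<partial>F i k) \<le> M k" for k t
  proof -
    interpret prob_space "F i k" by (rule pm)
    show ?thesis using integral_le_const[OF int] cM by auto
  qed
  have g0: "0 \<le> g t k" for t k unfolding g_def by (intro mult_nonneg_nonneg Q_nonneg I0)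
  have gM: "g t k \<le> Q i k * M k" for t k
    unfolding g_def by (intro mult_left_mono Q_nonneg IM)
  have sM: "(\<lambda>k. Q i k * M k) summable_on UNIV"
    using mat_pow_facts[of n i j] by (simp add: M_def)
  have sg: "g t summable_on UNIV" for t
    by (rule summable_on_comparison_test[OF sM gM g0])
  have gmono: "g s k \<le> g t k" if "s \<le> t" for s t k
    unfolding g_def using that
    by (intro mult_left_mono Q_nonneg integral_mono int monoD[OF cmono]) auto
  have eq: "conv_pow Q F (Suc n) i j = (\<lambda>t. infsum (g t) UNIV)"
    by (auto simp: g_def[abs_def] c_def fun_eq_iff)
  have eq_int: "infsum (g t) UNIV = (\<integral>k. g t k \<partial>count_space UNIV)" for t
  proof -
    have "Infinite_Set_Sum.abs_summable_on (g t) UNIV"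
      using sg[of t] g0 by (simp flip: abs_summable_equivalent)
    from infsetsum_infsum[OF this] show ?thesis by (simp add: infsetsum_def)
  qed
  have intM: "integrable (count_space UNIV) (\<lambda>k. Q i k * M k)"
  proof -
    have "\<bar>Q i k * M k\<bar> = Q i k * M k" for k
      using g0[of 0 k] gM[of 0 k] by (intro abs_of_nonneg) linarith
    then have "Infinite_Set_Sum.abs_summable_on (\<lambda>k. Q i k * M k) UNIV"
      using sM by (simp only: real_norm_def flip: abs_summable_equivalent)
    then show ?thesis by (simp add: Infinite_Set_Sum.abs_summable_on_def)
  qed
  have rc: "continuous (at_right a) (\<lambda>t. infsum (g t) UNIV)" for a
    unfolding continuous_within
  proof (rule tendsto_at_right_sequentially[of a "a + 1"])
    fix S :: "nat \<Rightarrow> real"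
    assume S: "\<And>n. a < S n" "S \<longlonglongrightarrow> a"
    have gl: "(\<lambda>n. g (S n) k) \<longlonglongrightarrow> g a k" for k
      unfolding g_def
    proof (intro tendsto_mult tendsto_const)
      interpret prob_space "F i k" by (rule pm)
      show "(\<lambda>n. \<integral>x. c k (S n - x) \<partial>F i k) \<longlonglongrightarrow> (\<integral>x. c k (a - x) \<partial>F i k)"
      proof (rule integral_dominated_convergence[where w = "\<lambda>_. M k"])
        show "AE x in F i k. (\<lambda>n. c k (S n - x)) \<longlonglongrightarrow> c k (a - x)"
        proof (rule AE_I2)
          fix x
          have "filterlim (\<lambda>n. S n - x) (at_right (a - x)) sequentially"
            unfolding filterlim_at using S
            by (auto intro!: tendsto_intros always_eventually simp: less_imp_neq[THEN not_sym])
          moreover have "(c k \<longlongrightarrow> c k (a - x)) (at_right (a - x))"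
            using crc[of "a - x" k] by (simp add: continuous_within)
          ultimately show "(\<lambda>n. c k (S n - x)) \<longlonglongrightarrow> c k (a - x)"
            by (rule filterlim_compose[rotated])
        qed
      qed (use c0 cM in auto)
    qed
    show "(\<lambda>n. infsum (g (S n)) UNIV) \<longlonglongrightarrow> infsum (g a) UNIV"
      unfolding eq_int
      by (rule integral_dominated_convergence[where w = "\<lambda>k. Q i k * M k"])
         (use g0 gM gl intM in auto)
  qed simp
  have "mat_pow Q (Suc n) i j = (\<Sum>\<^sub>\<infinity>k\<in>UNIV. Q i k * M k)" by (simp add: M_def)
  then show ?case
    unfolding eq using rc
    by (auto simp: mono_def intro!: infsum_nonneg infsum_mono sg sM g0 gM gmono)
qed

lemma emeasure_renewal_measure:
  assumes "A \<in> sets borel"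
  shows "emeasure (renewal_measure Q F i j) A =
           (\<Sum>n. emeasure (interval_measure (conv_pow Q F n i j)) A)"
proof (rule emeasure_measure_of[OF renewal_measure_def])
  let ?\<mu> = "\<lambda>n. emeasure (interval_measure (conv_pow Q F n i j))"
  show "countably_additive (sets (renewal_measure Q F i j)) (\<lambda>A. \<Sum>n. ?\<mu> n A)"
  proof (rule countably_additiveI)
    fix B :: "nat \<Rightarrow> real set"
    assume "range B \<subseteq> sets (renewal_measure Q F i j)" and d: "disjoint_family B"
    then have B: "range B \<subseteq> sets borel"
      by (simp add: renewal_measure_def sets.sigma_sets_eq[of borel, simplified])
    have "(\<Sum>m. \<Sum>n. ?\<mu> n (B m)) = (\<Sum>n. \<Sum>m. ?\<mu> n (B m))"
      unfolding nn_integral_count_space_nat[symmetric]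
      by (subst nn_integral_count_space_nat, subst nn_integral_suminf[symmetric])
         (auto simp: nn_integral_count_space_nat)
    also have "\<dots> = (\<Sum>n. ?\<mu> n (\<Union>m. B m))"
      by (intro suminf_cong suminf_emeasure) (use B d in auto)
    finally show "(\<Sum>m. \<Sum>n. ?\<mu> n (B m)) = (\<Sum>n. ?\<mu> n (\<Union>m. B m))" .
  qed
  show "A \<in> sets (renewal_measure Q F i j)"
    using assms by (simp add: renewal_measure_def sets.sigma_sets_eq[of borel, simplified])
qed (auto simp: positive_def)

lemma emeasure_renewal_measure_Ioc:
  assumes "h > 0"
  shows "emeasure (renewal_measure Q F i j) {t<..t + h} =
           (\<Sum>n. ennreal (conv_pow Q F n i j (t + h) - conv_pow Q F n i j t))"
proof -
  have "emeasure (interval_measure (conv_pow Q F n i j)) {t<..t + h} =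
          ennreal (conv_pow Q F n i j (t + h) - conv_pow Q F n i j t)" for n
    by (rule emeasure_interval_measure_Ioc)
       (use conv_pow_facts[of n i j] assms in \<open>auto simp: mono_def\<close>)
  then show ?thesis by (simp add: emeasure_renewal_measure)
qed

end

text \<open>
  Absolute existence of \<open>(\<V> * z)\<^sub>i(t)\<close> for all \<open>i\<close>, \<open>t\<close>; without it the value of
  \<open>renewal_conv\<close> would be a default value.
\<close>

definition renewal_conv_exists ::
    "('s \<Rightarrow> 's \<Rightarrow> real) \<Rightarrow> ('s \<Rightarrow> 's \<Rightarrow> real measure) \<Rightarrow> ('s \<Rightarrow> real \<Rightarrow> real) \<Rightarrow> bool" where
  "renewal_conv_exists Q F z \<longleftrightarrow>
     (\<forall>i t. (\<Sum>\<^sub>\<infinity>j\<in>UNIV. \<integral>\<^sup>+x. ennreal \<bar>z j (t - x)\<bar> \<partial>renewal_measure Q F i j) < \<infinity>)"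

definition renewal_conv ::
    "('s \<Rightarrow> 's \<Rightarrow> real) \<Rightarrow> ('s \<Rightarrow> 's \<Rightarrow> real measure) \<Rightarrow> ('s \<Rightarrow> real \<Rightarrow> real) \<Rightarrow> 's \<Rightarrow> real \<Rightarrow> real"
  where
  "renewal_conv Q F z i t = (\<Sum>\<^sub>\<infinity>j\<in>UNIV. \<integral>x. z j (t - x) \<partial>renewal_measure Q F i j)"

definition solves_renewal_equation ::
    "('s \<Rightarrow> 's \<Rightarrow> real) \<Rightarrow> ('s \<Rightarrow> 's \<Rightarrow> real measure) \<Rightarrow> ('s \<Rightarrow> real \<Rightarrow> real) \<Rightarrow>
     ('s \<Rightarrow> real \<Rightarrow> real) \<Rightarrow> bool" where
  "solves_renewal_equation Q F z Z \<longleftrightarrow>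
     (\<forall>i t. (\<Sum>\<^sub>\<infinity>j\<in>UNIV. ennreal (Q i j) * (\<integral>\<^sup>+x. ennreal \<bar>Z j (t - x)\<bar> \<partial>F i j)) < \<infinity> \<and>
            Z i t = z i t + (\<Sum>\<^sub>\<infinity>j\<in>UNIV. Q i j * (\<integral>x. Z j (t - x) \<partial>F i j)))"


section \<open>Drift, arithmeticity, spread-out property\<close>

definition drift_pos ::
    "('s \<Rightarrow> 's \<Rightarrow> real) \<Rightarrow> ('s \<Rightarrow> 's \<Rightarrow> real measure) \<Rightarrow> ('s \<Rightarrow> real) \<Rightarrow> ('s \<Rightarrow> real) \<Rightarrow> ennreal" where
  "drift_pos Q F u v =
     (\<Sum>\<^sub>\<infinity>(i, j)\<in>UNIV. ennreal (u i * Q i j * v j) * (\<integral>\<^sup>+x. ennreal (max x 0) \<partial>F i j))"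

definition drift_neg ::
    "('s \<Rightarrow> 's \<Rightarrow> real) \<Rightarrow> ('s \<Rightarrow> 's \<Rightarrow> real measure) \<Rightarrow> ('s \<Rightarrow> real) \<Rightarrow> ('s \<Rightarrow> real) \<Rightarrow> ennreal" where
  "drift_neg Q F u v =
     (\<Sum>\<^sub>\<infinity>(i, j)\<in>UNIV. ennreal (u i * Q i j * v j) * (\<integral>\<^sup>+x. ennreal (max (- x) 0) \<partial>F i j))"

definition drift_well_defined ::
    "('s \<Rightarrow> 's \<Rightarrow> real) \<Rightarrow> ('s \<Rightarrow> 's \<Rightarrow> real measure) \<Rightarrow> ('s \<Rightarrow> real) \<Rightarrow> ('s \<Rightarrow> real) \<Rightarrow> bool" where
  "drift_well_defined Q F u v \<longleftrightarrow> drift_neg Q F u v < \<infinity> \<or> drift_pos Q F u v < \<infinity>"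

definition drift ::
    "('s \<Rightarrow> 's \<Rightarrow> real) \<Rightarrow> ('s \<Rightarrow> 's \<Rightarrow> real measure) \<Rightarrow> ('s \<Rightarrow> real) \<Rightarrow> ('s \<Rightarrow> real) \<Rightarrow> ereal" where
  "drift Q F u v = enn2ereal (drift_pos Q F u v) - enn2ereal (drift_neg Q F u v)"

definition lattice_span ::
    "('s \<Rightarrow> 's \<Rightarrow> real) \<Rightarrow> ('s \<Rightarrow> 's \<Rightarrow> real measure) \<Rightarrow> ('s \<Rightarrow> real) \<Rightarrow> ('s \<Rightarrow> real) \<Rightarrow> real \<Rightarrow> bool"
  where
  "lattice_span Q F u v d \<longleftrightarrow>
     d > 0 \<and>
     (\<exists>\<gamma>. range \<gamma> \<subseteq> {0..<d} \<and>
        (\<forall>i j. u i * Q i j * v j > 0 \<longrightarrow>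
           measure (F i j) (range (\<lambda>k::int. \<gamma> j - \<gamma> i + d * of_int k)) = 1))"

definition d_arithmetic ::
    "('s \<Rightarrow> 's \<Rightarrow> real) \<Rightarrow> ('s \<Rightarrow> 's \<Rightarrow> real measure) \<Rightarrow> ('s \<Rightarrow> real) \<Rightarrow> ('s \<Rightarrow> real) \<Rightarrow> real \<Rightarrow> bool"
  where
  "d_arithmetic Q F u v d \<longleftrightarrow>
     lattice_span Q F u v d \<and> (\<forall>d'. lattice_span Q F u v d' \<longrightarrow> d' \<le> d)"

definition nonarithmetic ::
    "('s \<Rightarrow> 's \<Rightarrow> real) \<Rightarrow> ('s \<Rightarrow> 's \<Rightarrow> real measure) \<Rightarrow> ('s \<Rightarrow> real) \<Rightarrow> ('s \<Rightarrow> real) \<Rightarrow> bool" where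
  "nonarithmetic Q F u v \<longleftrightarrow> \<not> (\<exists>d. d_arithmetic Q F u v d)"

definition lebesgue_singular :: "real measure \<Rightarrow> bool" where
  "lebesgue_singular M \<longleftrightarrow>
     (\<exists>A\<in>sets borel. emeasure lborel A = 0 \<and> emeasure M (UNIV - A) = 0)"

definition spread_out ::
    "('s \<Rightarrow> 's \<Rightarrow> real) \<Rightarrow> ('s \<Rightarrow> 's \<Rightarrow> real measure) \<Rightarrow> ('s \<Rightarrow> real) \<Rightarrow> ('s \<Rightarrow> real) \<Rightarrow> bool" where
  "spread_out Q F u v \<longleftrightarrow>
     (\<exists>n\<ge>1. \<exists>i j. u i * mat_pow Q n i j * v j > 0 \<and> \<not> lebesgue_singular (conv_law Q F n i j))"


section \<open>Function classes\<close>

definition sup_norm :: "(real \<Rightarrow> real) \<Rightarrow> ennreal" where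
  "sup_norm f = (SUP t. ennreal \<bar>f t\<bar>)"

definition L1_norm :: "(real \<Rightarrow> real) \<Rightarrow> ennreal" where
  "L1_norm f = (\<integral>\<^sup>+t. ennreal \<bar>f t\<bar> \<partial>lborel)"

text \<open>
  As \<open>'s\<close> is countable, joint measurability on \<open>'s \<times> \<real>\<close> is Borel measurability of all sections.
\<close>

definition measurable_family :: "('s \<Rightarrow> real \<Rightarrow> real) \<Rightarrow> bool" where
  "measurable_family g \<longleftrightarrow> (\<forall>i. g i \<in> borel_measurable borel)"

definition directly_Riemann_integrable :: "('s \<Rightarrow> real) \<Rightarrow> ('s \<Rightarrow> real \<Rightarrow> real) \<Rightarrow> bool" where
  "directly_Riemann_integrable u g \<longleftrightarrow>
     measurable_family g \<and>
     (\<forall>i. AE x in lborel. isCont (g i) x) \<and>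
     (\<exists>\<epsilon>>0. (\<Sum>\<^sub>\<infinity>i\<in>UNIV. ennreal (u i) *
        (\<Sum>\<^sub>\<infinity>n\<in>(UNIV :: int set).
           SUP x\<in>{of_int n * \<epsilon><..(of_int n + 1) * \<epsilon>}. ennreal \<bar>g i x\<bar>)) < \<infinity>)"

definition class_L :: "('s \<Rightarrow> real) \<Rightarrow> ('s \<Rightarrow> real \<Rightarrow> real) set" where
  "class_L v = {Z. measurable_family Z \<and>
     (\<forall>i. sup_norm (\<lambda>t. Z i t / v i) < \<infinity> \<and> ((\<lambda>t. Z i t / v i) \<longlongrightarrow> 0) at_bot)}"

definition class_L0 :: "('s \<Rightarrow> real) \<Rightarrow> ('s \<Rightarrow> real \<Rightarrow> real) set" where
  "class_L0 v = {Z \<in> class_L v. (SUP i. sup_norm (\<lambda>t. Z i t / v i)) < \<infinity>}"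

definition class_L0_at :: "('s \<Rightarrow> real) \<Rightarrow> ('s \<Rightarrow> real \<Rightarrow> real) \<Rightarrow> ('s \<Rightarrow> real \<Rightarrow> real) set" where
  "class_L0_at v g = {Z. measurable_family Z \<and> (\<lambda>i t. Z i t - g i t) \<in> class_L0 v}"

definition unique_solution_in ::
    "('s \<Rightarrow> real \<Rightarrow> real) set \<Rightarrow> ('s \<Rightarrow> 's \<Rightarrow> real) \<Rightarrow> ('s \<Rightarrow> 's \<Rightarrow> real measure) \<Rightarrow>
     ('s \<Rightarrow> real \<Rightarrow> real) \<Rightarrow> ('s \<Rightarrow> real \<Rightarrow> real) \<Rightarrow> bool" where
  "unique_solution_in C Q F z Z \<longleftrightarrow>
     Z \<in> C \<and> solves_renewal_equation Q F z Z \<and>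
     (\<forall>Y\<in>C. solves_renewal_equation Q F z Y \<longrightarrow> Y = Z)"

end

theory Submission
  imports Defs
begin

text \<open>
  For a family \<open>f\<close> of nonnegative functions put \<open>(T f)\<^sub>i(t) = \<Sum>\<^sub>j q\<^sub>i\<^sub>j \<integral> f\<^sub>j(t - x) F\<^sub>i\<^sub>j(dx)\<close>, so that
  \<open>V * f = \<Sum>\<^sub>n T\<^sup>n f\<close>.  Fix a state \<open>r\<close>.  Cutting at the visits to \<open>r\<close>, where \<open>N\<close> sums over the
  time before the first return and \<open>G\<close> is the law of the increment over one cycle, gives
  \<open>(V * f)\<^sub>r \<le> U * (N f)\<^sub>r = (N (U * f))\<^sub>r\<close> with \<open>U = \<Sum>\<^sub>k G\<^sup>*\<^sup>k\<close>.  Recurrence makes \<open>G\<close> a probability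
  measure, \<open>u\<close> is up to scaling the occupation measure of a cycle, and \<open>G\<close> inherits the positive
  drift.  By Garsia's maximal inequality the random walk with increment law \<open>G\<close> stays, with positive
  probability, above a line of positive slope; hence \<open>U\<close> is uniformly bounded on intervals of fixed
  length, \<open>U((t, t + h])\<close> tends to 0 as \<open>t \<rightarrow> -\<infinity>\<close>, and \<open>G\<^sup>*\<^sup>n\<close> escapes to infinity.  The first two
  facts give \<open>V * z \<in> L\<close> for directly Riemann integrable \<open>z\<close>; in the spread-out case Stone's
  decomposition of \<open>U\<close> is used instead.  For uniqueness, the modulus \<open>D\<close> of the difference of two
  solutions satisfies \<open>D \<le> T D\<close>, hence \<open>D\<^sub>r \<le> G\<^sup>*\<^sup>n * D\<^sub>r \<rightarrow> 0\<close>.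
\<close>

text \<open>\<open>Q\<close> is not turned into a stochastic matrix and \<open>u\<close> need not be
  summable, so no stationary law is at hand. Domination over the states rests instead on finiteness
  of sums \<open>\<Sum> u j * c j\<close> for bounds \<open>c j\<close>, which survives the passage
  to one cycle. Membership in \<open>L\<close> is asked for each state separately and concerns
  boundedness and the limit at -\<infinity>; for it, upper bounds of \<open>V * |z|\<close> suffice,
  each taken with the state in question as the root \<open>r\<close>. Nonnegative families live in
  \<open>ennreal\<close>, where sums and integrals may be interchanged freely; signs return only at
  the end. Increments may be negative and their positive parts may have infinite mean, so the drift
  of \<open>G\<close> comes from a stopped form of Wald's identity in which positive and negative
  parts are kept apart. In the uniqueness part the bound by a multiple of \<open>v\<close> controls
  the paths that have not yet met \<open>r\<close>. The order of \<open>U\<close> and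
  \<open>N\<close> is chosen by the class of \<open>z\<close>: \<open>U\<close> first for directly
  Riemann integrable \<open>z\<close>, \<open>N\<close> first in the spread-out case, so that
  Stone's decomposition has to treat a single integrable function.\<close>

lemma ennreal_max0: "ennreal x = ennreal (max x 0)"
  by (simp add: max_def ennreal_neg)

text \<open>The cycle law and the entries of the matrix powers arise as values of operators, not as
  explicit measures; this turns such values back into a measure without any finiteness assumption.
  Monotone continuity of \<Lambda> supplies both countable additivity and the last step of the
  monotone class induction.\<close>

lemma functional_measure:
  fixes \<Lambda> :: "(real \<Rightarrow> ennreal) \<Rightarrow> ennreal"
  assumes add: "\<And>f g. f \<in> borel_measurable borel \<Longrightarrow> g \<in> borel_measurable borel \<Longrightarrow>
      \<Lambda> (\<lambda>x. f x + g x) = \<Lambda> f + \<Lambda> g"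
    and mult: "\<And>c f. f \<in> borel_measurable borel \<Longrightarrow> \<Lambda> (\<lambda>x. c * f x) = c * \<Lambda> f"
    and sup: "\<And>f. (\<And>n::nat. f n \<in> borel_measurable borel) \<Longrightarrow> incseq f \<Longrightarrow>
      \<Lambda> (\<lambda>x. SUP n. f n x) = (SUP n. \<Lambda> (f n))"
  obtains M where "sets M = sets borel"
    "\<And>f. f \<in> borel_measurable borel \<Longrightarrow> (\<integral>\<^sup>+x. f x \<partial>M) = \<Lambda> f"
proof
  define M where "M = measure_of UNIV (sets borel) (\<lambda>A. \<Lambda> (indicator A))"
  have zero: "\<Lambda> (\<lambda>x. 0) = 0" using mult[of "\<lambda>x. 0" 0] by simp
  have sum: "\<Lambda> (\<lambda>x. \<Sum>i<n. f i x) = (\<Sum>i<n. \<Lambda> (f i))"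
    if "\<And>n. f n \<in> borel_measurable borel" for f and n :: nat
    by (induction n) (use that in \<open>auto simp: zero add\<close>)
  show sM: "sets M = sets borel"
    by (simp add: M_def sets.sigma_sets_eq[of borel, simplified])
  have em: "emeasure M A = \<Lambda> (indicator A)" if "A \<in> sets borel" for A
  proof (rule emeasure_measure_of[OF M_def])
    show "positive (sets M) (\<lambda>A. \<Lambda> (indicator A))"
    proof -
      have "indicator {} = (\<lambda>x::real. 0::ennreal)" by auto
      then show ?thesis using zero by (simp add: positive_def)
    qed
    show "countably_additive (sets M) (\<lambda>A. \<Lambda> (indicator A))"
    proof (rule countably_additiveI)
      fix B :: "nat \<Rightarrow> real set"
      assume B: "range B \<subseteq> sets M" and d: "disjoint_family B"
      then have [measurable]: "B n \<in> sets borel" for n by (auto simp: sM)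
      have "(\<Sum>n. \<Lambda> (indicator (B n))) = (SUP n. \<Sum>i<n. \<Lambda> (indicator (B i)))"
        by (rule suminf_eq_SUP)
      also have "\<dots> = (SUP n. \<Lambda> (\<lambda>x. \<Sum>i<n. indicator (B i) x))"
        by (subst sum) auto
      also have "\<dots> = \<Lambda> (\<lambda>x. SUP n. \<Sum>i<n. indicator (B i) x)"
        by (rule sup[symmetric]) (auto intro!: incseq_SucI le_funI)
      also have "(\<lambda>x. SUP n. \<Sum>i<n. indicator (B i) x) = (indicator (\<Union>n. B n) :: _ \<Rightarrow> ennreal)"
        using suminf_indicator[OF d] by (auto simp: suminf_eq_SUP fun_eq_iff)
      finally show "(\<Sum>n. \<Lambda> (indicator (B n))) = \<Lambda> (indicator (\<Union>n. B n))" .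
    qed
  qed (use that in \<open>auto simp: sM\<close>)
  fix f :: "real \<Rightarrow> ennreal" assume "f \<in> borel_measurable borel"
  then show "(\<integral>\<^sup>+x. f x \<partial>M) = \<Lambda> f"
  proof (induction f rule: borel_measurable_induct)
    case (set A) then show ?case using sM em by (simp add: nn_integral_indicator)
  next
    case (mult u c)
    then show ?case using sM assms(2) by (subst nn_integral_cmult) (auto cong: measurable_cong_sets)
  next
    case (add u v)
    then show ?case using sM assms(1)
      by (subst nn_integral_add) (auto cong: measurable_cong_sets simp: add.commute)
  next
    case (seq U)
    then have "(\<integral>\<^sup>+x. (SUP n. U n x) \<partial>M) = (SUP n. \<Lambda> (U n))"
      using sM by (subst nn_integral_monotone_convergence_SUP) (auto cong: measurable_cong_sets)
    also have "\<dots> = \<Lambda> (\<lambda>x. SUP n. U n x)" using seq by (intro sup[symmetric]) auto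
    finally show ?case by (simp add: image_comp SUP_apply[abs_def])
  qed (simp add: ext)
qed

lemma tendsto_0_mult_right_cancel:
  fixes f :: "'a \<Rightarrow> ennreal"
  assumes "((\<lambda>x. f x * c) \<longlongrightarrow> 0) F" "0 < c" "c < \<top>"
  shows "(f \<longlongrightarrow> 0) F"
proof -
  have "((\<lambda>x. inverse c * (f x * c)) \<longlongrightarrow> inverse c * 0) F"
    using assms by (intro ennreal_tendsto_cmult) (auto simp: less_top[symmetric])
  moreover have "inverse c * (f x * c) = f x" for x
    using assms mult_divide_eq_ennreal[of c "f x"]
    by (simp add: divide_ennreal_def mult.assoc mult.commute[of "inverse c"])
  ultimately show ?thesis by simp
qed

text \<open>Measures act on functions, so that convolution powers become iterates
  \<open>conv_fun M ^^ n\<close> and convolutions of two measures never have to be formed.\<close>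

definition conv_fun :: "real measure \<Rightarrow> (real \<Rightarrow> ennreal) \<Rightarrow> real \<Rightarrow> ennreal" where
  "conv_fun M h t = (\<integral>\<^sup>+x. h (t - x) \<partial>M)"

lemma measurable_conv_fun[measurable]:
  assumes [measurable_cong]: "sets M = sets borel" and "sigma_finite_measure M"
    and [measurable]: "h \<in> borel_measurable borel"
  shows "conv_fun M h \<in> borel_measurable borel"
proof -
  interpret sigma_finite_measure M by fact
  show ?thesis unfolding conv_fun_def by measurable
qed

lemma conv_fun_mono: "(\<And>x. f x \<le> g x) \<Longrightarrow> conv_fun M f t \<le> conv_fun M g t"
  unfolding conv_fun_def by (intro nn_integral_mono) auto

lemma conv_fun_pow_mono: "(\<And>x. f x \<le> g x) \<Longrightarrow> (conv_fun M ^^ n) f t \<le> (conv_fun M ^^ n) g t"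
  by (induction n arbitrary: t) (auto intro: conv_fun_mono)

lemma measurable_conv_fun_pow:
  assumes "sets M = sets borel" "sigma_finite_measure M" "h \<in> borel_measurable borel"
  shows "(conv_fun M ^^ n) h \<in> borel_measurable borel"
  by (induction n) (use assms in \<open>auto intro: measurable_conv_fun\<close>)

lemma conv_fun_commute:
  assumes [measurable_cong]: "sets M = sets borel" "sets N = sets borel"
    and "sigma_finite_measure M" "sigma_finite_measure N"
    and [measurable]: "h \<in> borel_measurable borel"
  shows "conv_fun M (conv_fun N h) = conv_fun N (conv_fun M h)"
proof
  fix t
  interpret M: sigma_finite_measure M by fact
  interpret N: sigma_finite_measure N by fact
  interpret pair_sigma_finite M N ..
  have "conv_fun M (conv_fun N h) t = (\<integral>\<^sup>+x. \<integral>\<^sup>+y. h (t - x - y) \<partial>N \<partial>M)"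
    by (simp add: conv_fun_def)
  also have "\<dots> = (\<integral>\<^sup>+y. \<integral>\<^sup>+x. h (t - x - y) \<partial>M \<partial>N)"
    by (rule Fubini'[symmetric]) measurable
  also have "\<dots> = conv_fun N (conv_fun M h) t"
    by (simp add: conv_fun_def algebra_simps)
  finally show "conv_fun M (conv_fun N h) t = conv_fun N (conv_fun M h) t" .
qed

section \<open>Random walks with positive drift\<close>

definition walk :: "real stream \<Rightarrow> nat \<Rightarrow> real" where
  "walk \<omega> n = (\<Sum>k<n. \<omega> !! k)"

lemma walk_0[simp]: "walk \<omega> 0 = 0" by (simp add: walk_def)

lemma walk_Suc: "walk \<omega> (Suc n) = shd \<omega> + walk (stl \<omega>) n"
  unfolding walk_def by (subst sum.lessThan_Suc_shift) simp

lemma walk_add: "walk \<omega> (m + n) = walk \<omega> m + walk (sdrop m \<omega>) n"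
  by (induction m arbitrary: \<omega>) (auto simp: walk_Suc)

text \<open>The minimum of the partial sums of \<open>f\<close> along \<omega> up to index
  \<open>n\<close>, the empty sum included. The recursion works at the front of the stream so that
  the shift \<open>stl\<close> appears in it, as Garsia's argument requires.\<close>

primrec running_min :: "(real \<Rightarrow> real) \<Rightarrow> nat \<Rightarrow> real stream \<Rightarrow> real" where
  "running_min f 0 \<omega> = 0"
| "running_min f (Suc n) \<omega> = min 0 (f (shd \<omega>) + running_min f n (stl \<omega>))"

lemma running_min_nonpos: "running_min f n \<omega> \<le> 0" by (cases n) auto

lemma running_min_decreasing: "running_min f (Suc n) \<omega> \<le> running_min f n \<omega>"
proof (induction n arbitrary: \<omega>)
  case (Suc n)
  show ?case using Suc[of "stl \<omega>"] by (auto simp: min_def)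
qed simp

lemma running_min_le:
  "m \<le> n \<Longrightarrow> running_min f n \<omega> \<le> (\<Sum>k<m. f (\<omega> !! k))"
proof (induction n arbitrary: m \<omega>)
  case (Suc n)
  show ?case
  proof (cases m)
    case 0 then show ?thesis by simp
  next
    case (Suc l)
    then have "running_min f n (stl \<omega>) \<le> (\<Sum>k<l. f (stl \<omega> !! k))" using Suc.IH Suc.prems by auto
    moreover have "(\<Sum>k<m. f (\<omega> !! k)) = f (shd \<omega>) + (\<Sum>k<l. f (stl \<omega> !! k))"
      unfolding Suc by (subst sum.lessThan_Suc_shift) simp
    ultimately show ?thesis by simp
  qed
qed simp

lemma measurable_running_min[measurable]:
  assumes [measurable]: "f \<in> borel_measurable M"
  shows "running_min f n \<in> borel_measurable (stream_space M)"
proof (induction n)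
  case (Suc n)
  note [measurable] = Suc
  show ?case unfolding running_min.simps by measurable
qed simp

text \<open>Since \<open>ennreal\<close> sends negative numbers to 0, the two integrals are the
  means of the negative and of the positive part. The strict inequality makes the former finite and
  allows the latter to be infinite.\<close>

locale positive_drift_walk = real_distribution G for G +
  assumes drift: "(\<integral>\<^sup>+x. ennreal (- x) \<partial>G) < (\<integral>\<^sup>+x. ennreal x \<partial>G)"
begin

abbreviation "paths \<equiv> stream_space G"

lemma sets_G[measurable_cong]: "sets G = sets borel" by simp

sublocale P: prob_space paths by (rule prob_space_stream_space)

lemma conv_fun_G_measurable[measurable]:
  "h \<in> borel_measurable borel \<Longrightarrow> conv_fun G h \<in> borel_measurable borel"
  by (intro measurable_conv_fun) (auto intro: sigma_finite_measure_axioms)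

lemma conv_fun_pow_measurable[measurable]:
  "h \<in> borel_measurable borel \<Longrightarrow> (conv_fun G ^^ n) h \<in> borel_measurable borel"
  by (induction n) auto

lemma measurable_walk[measurable]: "(\<lambda>\<omega>. walk \<omega> n) \<in> borel_measurable paths"
  unfolding walk_def by measurable

text \<open>Independence of the walk up to time \<open>n\<close> from the increments after it,
  obtained by splitting off one increment at a time.\<close>

lemma nn_integral_walk_future:
  assumes h[measurable]: "h \<in> borel_measurable borel" and A[measurable]: "A \<in> sets paths"
  shows "(\<integral>\<^sup>+\<omega>. h (t - walk \<omega> n) * indicator A (sdrop n \<omega>) \<partial>paths)
    = (conv_fun G ^^ n) h t * emeasure paths A"
proof (induction n arbitrary: t)
  case 0
  show ?case by (simp add: nn_integral_cmult)
next
  case (Suc n)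
  have "(\<integral>\<^sup>+\<omega>. h (t - walk \<omega> (Suc n)) * indicator A (sdrop (Suc n) \<omega>) \<partial>paths)
     = (\<integral>\<^sup>+x. \<integral>\<^sup>+\<omega>. h (t - x - walk \<omega> n) * indicator A (sdrop n \<omega>) \<partial>paths \<partial>G)"
    by (subst nn_integral_stream_space) (auto simp: walk_Suc diff_diff_eq)
  also have "\<dots> = (\<integral>\<^sup>+x. (conv_fun G ^^ n) h (t - x) * emeasure paths A \<partial>G)"
    by (simp add: Suc)
  also have "\<dots> = (conv_fun G ^^ Suc n) h t * emeasure paths A"
    by (subst nn_integral_multc) (auto simp: conv_fun_def)
  finally show ?case .
qed

text \<open>Garsia's argument needs integrable increments. Cutting the increments at a large
  \<open>K\<close> makes them integrable, and by monotone convergence keeps the mean positive;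
  subtracting \<delta> prepares the slope of the line.\<close>

lemma truncated_drift:
  obtains K \<delta> :: real where "\<delta> > 0" "integrable G (\<lambda>x. min x K - \<delta>)" "(\<integral>x. min x K - \<delta> \<partial>G) > 0"
proof -
  have inc: "incseq (\<lambda>n x. ennreal (min x (real n)))"
    by (auto intro!: incseq_SucI le_funI ennreal_leI)
  have "(SUP n. ennreal (min x (real n))) = ennreal x" for x
  proof (rule antisym)
    obtain N where N: "x \<le> real N" using real_arch_simple by blast
    show "(SUP n. ennreal (min x (real n))) \<le> ennreal x" by (auto intro!: SUP_least ennreal_leI)
    have "ennreal x = ennreal (min x (real N))" using N by (simp add: min_def)
    also have "\<dots> \<le> (SUP n. ennreal (min x (real n)))" by (rule SUP_upper) simp
    finally show "ennreal x \<le> (SUP n. ennreal (min x (real n)))" .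
  qed
  then have "(\<integral>\<^sup>+x. ennreal x \<partial>G) = (SUP n. \<integral>\<^sup>+x. ennreal (min x (real n)) \<partial>G)"
    using inc by (subst nn_integral_monotone_convergence_SUP[symmetric]) auto
  with drift obtain n where n: "(\<integral>\<^sup>+x. ennreal (- x) \<partial>G) < (\<integral>\<^sup>+x. ennreal (min x (real n)) \<partial>G)"
    by (auto simp: less_SUP_iff)
  have "(\<integral>\<^sup>+x. ennreal (min x (real n)) \<partial>G) \<le> (\<integral>\<^sup>+x. ennreal (real n) \<partial>G)"
    by (intro nn_integral_mono ennreal_leI) auto
  also have "\<dots> < \<infinity>" by (simp add: emeasure_space_1 space_eq_univ[symmetric] del: space_eq_univ)
  finally have fin: "(\<integral>\<^sup>+x. ennreal (min x (real n)) \<partial>G) < \<infinity>" .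
  have neg: "ennreal (- min x (real n)) = ennreal (- x)" for x
    by (auto simp: min_def ennreal_neg)
  have int: "integrable G (\<lambda>x. min x (real n))"
  proof (rule integrableI_bounded)
    have "ennreal (norm (min x (real n))) = ennreal (min x (real n)) + ennreal (- x)" for x
      by (cases "x \<ge> 0") (auto simp: min_def ennreal_neg)
    then have "(\<integral>\<^sup>+x. ennreal (norm (min x (real n))) \<partial>G)
        = (\<integral>\<^sup>+x. ennreal (min x (real n)) \<partial>G) + (\<integral>\<^sup>+x. ennreal (- x) \<partial>G)"
      by (simp add: nn_integral_add)
    also have "\<dots> < \<infinity>" using fin n by (auto simp: less_top[symmetric] dest: less_trans)
    finally show "(\<integral>\<^sup>+x. ennreal (norm (min x (real n))) \<partial>G) < \<infinity>" .
  qed simp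
  have "(\<integral>x. min x (real n) \<partial>G) = enn2real (\<integral>\<^sup>+x. ennreal (min x (real n)) \<partial>G) - enn2real (\<integral>\<^sup>+x. ennreal (- x) \<partial>G)"
    using real_lebesgue_integral_def[OF int] by (simp add: neg)
  also have "\<dots> > 0" using n fin by (simp add: enn2real_less_iff ennreal_enn2real_if less_top enn2real_mono)
  finally have pos: "(\<integral>x. min x (real n) \<partial>G) > 0" .
  show thesis
    \<comment> \<open>Half of the truncated mean serves as the slope, which leaves the other half as
      a positive mean.\<close>
    by (rule that[of "(\<integral>x. min x (real n) \<partial>G) / 2" "real n"])
      (use pos int in \<open>auto simp: prob_space[simplified]\<close>)
qed


lemma distr_shd: "distr paths G shd = G"
proof (rule measure_eqI)
  fix A assume "A \<in> sets (distr paths G shd)"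
  then have [measurable]: "A \<in> sets borel" by simp
  have "emeasure (distr paths G shd) A = (\<integral>\<^sup>+\<omega>. indicator A (shd \<omega>) \<partial>paths)"
    by (subst nn_integral_distr[of shd paths G "indicator A", symmetric]) auto
  also have "\<dots> = emeasure G A"
    by (subst nn_integral_stream_space) (auto simp: P.emeasure_space_1)
  finally show "emeasure (distr paths G shd) A = emeasure G A" .
qed simp

lemma distr_stl: "distr paths paths stl = paths"
proof (rule measure_eqI)
  fix A assume "A \<in> sets (distr paths paths stl)"
  then have [measurable]: "A \<in> sets paths" by simp
  have "emeasure (distr paths paths stl) A = (\<integral>\<^sup>+\<omega>. indicator A (stl \<omega>) \<partial>paths)"
    by (subst nn_integral_distr[of stl paths paths "indicator A", symmetric]) auto
  also have "\<dots> = emeasure paths A"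
    by (subst nn_integral_stream_space) (auto simp: emeasure_space_1[simplified])
  finally show "emeasure (distr paths paths stl) A = emeasure paths A" .
qed simp

text \<open>
  Garsia's argument: the running minima \<open>W\<^sub>n\<close> of the walk with increments \<open>Y\<close> are decreasing and
  satisfy \<open>W\<^sub>n\<^sub>+\<^sub>1 = min 0 (Y + W\<^sub>n \<circ> stl)\<close>; comparing expectations gives
  \<open>E [Y; W\<^sub>n\<^sub>+\<^sub>1 < 0] \<le> 0\<close>, so \<open>E Y > 0\<close> prevents \<open>W\<^sub>n\<^sub>+\<^sub>1 < 0\<close> from having probability tending to 1.
\<close>

lemma linear_growth_event:
  obtains \<delta> :: real and A where "\<delta> > 0" "A \<in> sets paths" "emeasure paths A > 0"
    "\<And>\<omega> k. \<omega> \<in> A \<Longrightarrow> real k * \<delta> \<le> walk \<omega> k"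
proof -
  obtain K \<delta> :: real where \<delta>: "\<delta> > 0" and int: "integrable G (\<lambda>x. min x K - \<delta>)"
    and pos: "(\<integral>x. min x K - \<delta> \<partial>G) > 0"
    by (rule truncated_drift)
  define f where "f x = min x K - \<delta>" for x
  have [measurable]: "f \<in> borel_measurable borel" unfolding f_def[abs_def] by measurable
  define W where "W = running_min f"
  define A where "A = {\<omega>\<in>space paths. \<forall>n. 0 \<le> W n \<omega>}"
  define B where "B n = {\<omega>\<in>space paths. f (shd \<omega>) + W n (stl \<omega>) < 0}" for n
  have [measurable]: "W n \<in> borel_measurable paths" for n unfolding W_def by measurable
  have [measurable]: "A \<in> sets paths" unfolding A_def by measurable
  have [measurable]: "B n \<in> sets paths" for n unfolding B_def by measurable
  have intf: "integrable paths (\<lambda>\<omega>. f (shd \<omega>))"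
    using int distr_shd by (intro integrable_distr[of shd paths G f]) (auto simp: f_def[abs_def])
  have f_pos: "(\<integral>\<omega>. f (shd \<omega>) \<partial>paths) > 0"
    using pos distr_shd integral_distr[of shd paths G f] by (simp add: f_def[abs_def])
  have intW: "integrable paths (W n)" and intW': "integrable paths (\<lambda>\<omega>. W n (stl \<omega>))" for n
  proof (induction n)
    case 0
    { case 1 then show ?case by (simp add: W_def) next case 2 then show ?case by (simp add: W_def) }
  next
    case (Suc n)
    { case 1
      then show ?case
        using integrable_min[OF integrable_zero Bochner_Integration.integrable_add[OF intf Suc(2)]]
        by (simp add: W_def) }
    then have "integrable (distr paths paths stl) (W (Suc n))" by (simp only: distr_stl)
    { case 2
      then show ?case
        using integrable_distr[of stl paths paths "W (Suc n)"] \<open>integrable (distr paths paths stl) (W (Suc n))\<close>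
        by simp }
  qed
  have W_stl: "(\<integral>\<omega>. W n (stl \<omega>) \<partial>paths) = (\<integral>\<omega>. W n \<omega> \<partial>paths)" for n
    using integral_distr[of stl paths paths "W n"] by (simp add: distr_stl)
  have B_nonpos: "(\<integral>\<omega>. f (shd \<omega>) * indicator (B n) \<omega> \<partial>paths) \<le> 0" for n
  proof -
    have "(\<integral>\<omega>. f (shd \<omega>) * indicator (B n) \<omega> \<partial>paths)
        \<le> (\<integral>\<omega>. W (Suc n) \<omega> - W n (stl \<omega>) \<partial>paths)"
    proof (rule integral_mono)
      show "integrable paths (\<lambda>\<omega>. f (shd \<omega>) * indicator (B n) \<omega>)"
        by (rule integrable_real_mult_indicator) (use intf in auto)
      fix \<omega> assume "\<omega> \<in> space paths"
      \<comment> \<open>On \<open>B n\<close> both sides are equal; off it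
        \<open>W (Suc n) \<omega> = 0\<close>, so the right side is
        \<open>- W n (stl \<omega>)\<close>, which is nonnegative.\<close>
      then show "f (shd \<omega>) * indicator (B n) \<omega> \<le> W (Suc n) \<omega> - W n (stl \<omega>)"
        using running_min_nonpos[of f n "stl \<omega>"] by (auto simp: B_def W_def indicator_def)
    qed (use intW intW' in auto)
    also have "\<dots> = (\<integral>\<omega>. W (Suc n) \<omega> \<partial>paths) - (\<integral>\<omega>. W n \<omega> \<partial>paths)"
      using intW[of "Suc n"] intW'[of n] by (simp add: W_stl)
    also have "\<dots> \<le> 0"
      using integral_mono[OF intW[of "Suc n"] intW[of n]] running_min_decreasing[of f n]
      by (simp add: W_def del: running_min.simps)
    finally show ?thesis .
  qed
  have "emeasure paths A > 0"
  proof (rule ccontr)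
    assume "\<not> emeasure paths A > 0"
    then have "AE \<omega> in paths. \<omega> \<notin> A" by (intro AE_not_in) (auto simp: null_sets_def)
    then have lim: "AE \<omega> in paths. (\<lambda>n. f (shd \<omega>) * indicator (B n) \<omega>) \<longlonglongrightarrow> f (shd \<omega>)"
    proof (rule AE_mp, intro AE_I2 impI)
      fix \<omega> assume w: "\<omega> \<in> space paths" "\<omega> \<notin> A"
      then obtain m where m: "W m \<omega> < 0" by (auto simp: A_def not_le)
      have "W n \<omega> < 0" if "n \<ge> m" for n
        using that
      proof (induction rule: dec_induct)
        case (step n)
        then show ?case using running_min_decreasing[of f n \<omega>] unfolding W_def by linarith
      qed (rule m)
      then have "\<omega> \<in> B n" if "n \<ge> m" for n
        using w(1) that \<open>\<And>n. m \<le> n \<Longrightarrow> W n \<omega> < 0\<close>[of "Suc n"] by (simp add: B_def W_def)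
      then show "(\<lambda>n. f (shd \<omega>) * indicator (B n) \<omega>) \<longlonglongrightarrow> f (shd \<omega>)"
        by (intro tendsto_eventually eventually_sequentiallyI[of m]) auto
    qed
    have "(\<lambda>n. \<integral>\<omega>. f (shd \<omega>) * indicator (B n) \<omega> \<partial>paths) \<longlonglongrightarrow> (\<integral>\<omega>. f (shd \<omega>) \<partial>paths)"
      by (rule integral_dominated_convergence[where w = "\<lambda>\<omega>. \<bar>f (shd \<omega>)\<bar>"])
         (use intf lim in \<open>auto simp: indicator_def\<close>)
    then have "(\<integral>\<omega>. f (shd \<omega>) \<partial>paths) \<le> 0"
      by (rule LIMSEQ_le_const2) (use B_nonpos in auto)
    with f_pos show False by simp
  qed
  moreover have "real k * \<delta> \<le> walk \<omega> k" if "\<omega> \<in> A" for \<omega> k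
  proof -
    have "0 \<le> (\<Sum>i<k. f (\<omega> !! i))"
      using that running_min_le[of k k f \<omega>] by (auto simp: A_def W_def intro: order_trans)
    also have "\<dots> \<le> (\<Sum>i<k. \<omega> !! i - \<delta>)" by (intro sum_mono) (auto simp: f_def)
    finally show ?thesis by (simp add: walk_def sum_subtractf)
  qed
  ultimately show thesis using \<delta> by (intro that[of \<delta> A]) auto
qed

section \<open>The renewal measure of the walk: uniform bounds and behaviour at -\<infinity>\<close>

definition renewal_sum :: "(real \<Rightarrow> ennreal) \<Rightarrow> real \<Rightarrow> ennreal" where
  "renewal_sum h t = (\<Sum>n. (conv_fun G ^^ n) h t)"

lemma renewal_sum_measurable[measurable]:
  "h \<in> borel_measurable borel \<Longrightarrow> renewal_sum h \<in> borel_measurable borel"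
  unfolding renewal_sum_def[abs_def] by measurable

lemma renewal_sum_mono: "(\<And>x. f x \<le> g x) \<Longrightarrow> renewal_sum f t \<le> renewal_sum g t"
  unfolding renewal_sum_def by (intro suminf_le conv_fun_pow_mono) auto

text \<open>By independence the probability of \<open>A\<close> can be traded for the requirement
  that the future of each counted visit lies in \<open>A\<close>. This restricted count is bounded
  on every path, whereas the full count is not.\<close>

lemma renewal_sum_path:
  assumes [measurable]: "h \<in> borel_measurable borel" "A \<in> sets paths"
  shows "renewal_sum h t * emeasure paths A =
    (\<integral>\<^sup>+\<omega>. (\<Sum>n. h (t - walk \<omega> n) * indicator A (sdrop n \<omega>)) \<partial>paths)"
  unfolding renewal_sum_def
  by (subst nn_integral_suminf) (auto simp: nn_integral_walk_future)

lemma ennreal_mult_right_le_divide: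
  fixes a b c :: ennreal
  assumes "a * c \<le> b" "0 < c" "c < \<top>" shows "a \<le> b / c"
proof -
  have "a = a * c / c" using assms by (subst mult_divide_eq_ennreal) auto
  also have "\<dots> \<le> b / c" by (rule divide_right_mono_ennreal) fact
  finally show ?thesis .
qed

text \<open>
  If the walk grows linearly after time \<open>n\<close>, it leaves every interval of length \<open>\<ell>\<close> within \<open>\<ell> / \<delta>\<close>
  steps; by independence, a fixed positive proportion of the visits is of this kind.
\<close>

lemma visits_card:
  assumes "\<delta> > 0" "\<And>\<omega> k. \<omega> \<in> A \<Longrightarrow> real k * \<delta> \<le> walk \<omega> k"
  shows "(\<Sum>n. indicator {a<..a + l} (t - walk \<omega> n) * indicator A (sdrop n \<omega>)) \<le>
     (of_nat (nat \<lfloor>l / \<delta>\<rfloor> + 1) :: ennreal)"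
proof -
  define S where "S = {n. t - walk \<omega> n \<in> {a<..a + l} \<and> sdrop n \<omega> \<in> A}"
  have sub: "\<exists>n0. S \<subseteq> {n0..n0 + nat \<lfloor>l / \<delta>\<rfloor>}"
  proof (cases "S = {}")
    case False
    define n0 where "n0 = (LEAST n. n \<in> S)"
    have n0: "n0 \<in> S" unfolding n0_def using False by (auto intro: LeastI)
    have "n \<in> {n0..n0 + nat \<lfloor>l / \<delta>\<rfloor>}" if "n \<in> S" for n
    proof -
      have le: "n0 \<le> n" unfolding n0_def using that by (rule Least_le)
      then obtain k where k: "n = n0 + k" using le_iff_add by blast
      have "real k * \<delta> \<le> walk (sdrop n0 \<omega>) k" using n0 assms(2) by (auto simp: S_def)
      also have "\<dots> = walk \<omega> n - walk \<omega> n0" by (simp add: k walk_add)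
      also have "\<dots> \<le> l" using n0 that by (auto simp: S_def)
      finally have "real k \<le> l / \<delta>" using assms(1) by (simp add: pos_le_divide_eq)
      then have "int k \<le> \<lfloor>l / \<delta>\<rfloor>" by (simp add: le_floor_iff)
      then show ?thesis using k by auto
    qed
    then show ?thesis by blast
  qed auto
  then obtain n0 where "S \<subseteq> {n0..n0 + nat \<lfloor>l / \<delta>\<rfloor>}" by blast
  then have fin: "finite S" and card: "card S \<le> nat \<lfloor>l / \<delta>\<rfloor> + 1"
    using card_mono[of "{n0..n0 + nat \<lfloor>l / \<delta>\<rfloor>}" S] by (auto intro: finite_subset)
  have "(\<Sum>n. indicator {a<..a + l} (t - walk \<omega> n) * indicator A (sdrop n \<omega>) :: ennreal) = (\<Sum>n. indicator S n)"
    by (intro suminf_cong) (auto simp: S_def indicator_def)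
  also have "\<dots> = of_nat (card S)"
    using fin by (simp add: nn_integral_count_space_nat[symmetric])
  also have "\<dots> \<le> of_nat (nat \<lfloor>l / \<delta>\<rfloor> + 1)" using card by (rule of_nat_mono)
  finally show ?thesis .
qed

text \<open>The bound of \<open>visits_card\<close> depends on the length of the window only, not on
  its position; division by the probability of \<open>A\<close> gives the constant.\<close>

lemma renewal_sum_bounded:
  "\<exists>C<\<infinity>. \<forall>a t. renewal_sum (indicator {a<..a + l}) t \<le> C"
proof -
  obtain \<delta> A where A: "\<delta> > 0" "A \<in> sets paths" "emeasure paths A > 0"
    "\<And>\<omega> k. \<omega> \<in> A \<Longrightarrow> real k * \<delta> \<le> walk \<omega> k" using linear_growth_event by metis
  have fin: "emeasure paths A < \<infinity>" by (simp add: less_top[symmetric])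
  let ?m = "of_nat (nat \<lfloor>l / \<delta>\<rfloor> + 1) :: ennreal"
  have "renewal_sum (indicator {a<..a + l}) t \<le> ?m / emeasure paths A" for a t
  proof (rule ennreal_mult_right_le_divide)
    have "renewal_sum (indicator {a<..a + l}) t * emeasure paths A \<le> (\<integral>\<^sup>+\<omega>. ?m \<partial>paths)"
      unfolding renewal_sum_path[OF borel_measurable_indicator[OF greaterThanAtMost_borel] A(2)]
      by (rule nn_integral_mono, rule visits_card[OF A(1,4)])
    then show "renewal_sum (indicator {a<..a + l}) t * emeasure paths A \<le> ?m"
      by (simp add: P.emeasure_space_1)
  qed (use A fin in auto)
  moreover have "?m / emeasure paths A < \<infinity>"
    using A fin by (auto simp: less_top[symmetric] ennreal_divide_eq_top_iff)
  ultimately show ?thesis by blast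
qed

lemma walk_eventually_large:
  assumes "\<delta> > 0" "\<And>\<omega> k. \<omega> \<in> A \<Longrightarrow> real k * \<delta> \<le> walk \<omega> k" "sdrop m \<omega> \<in> A"
  shows "filterlim (walk \<omega>) at_top sequentially"
proof (rule filterlim_at_top_mono)
  have "filterlim (\<lambda>n. \<delta> * real n) at_top sequentially"
    by (rule filterlim_tendsto_pos_mult_at_top[OF tendsto_const assms(1) filterlim_real_sequentially])
  then have "filterlim (\<lambda>n. (walk \<omega> m - real m * \<delta>) + \<delta> * real n) at_top sequentially"
    by (rule filterlim_tendsto_add_at_top[OF tendsto_const])
  then show "filterlim (\<lambda>n. walk \<omega> m + (real n - real m) * \<delta>) at_top sequentially"
    by (simp add: algebra_simps)
  show "eventually (\<lambda>n. walk \<omega> m + (real n - real m) * \<delta> \<le> walk \<omega> n) sequentially"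
  proof (rule eventually_sequentiallyI[of m])
    fix n assume "m \<le> n"
    then obtain k where k: "n = m + k" using le_iff_add by blast
    show "walk \<omega> m + (real n - real m) * \<delta> \<le> walk \<omega> n"
      using assms(2)[OF assms(3), of k] by (simp add: k walk_add)
  qed
qed

text \<open>Dominated convergence over the paths. A path whose futures never lie in \<open>A\<close>
  contributes nothing, and any other path tends to infinity; so almost sure divergence of the walk
  need not be proved.\<close>

lemma renewal_sum_tendsto_0:
  "(renewal_sum (indicator {a<..a + l}) \<longlongrightarrow> 0) at_bot"
proof -
  obtain \<delta> A where A: "\<delta> > 0" "A \<in> sets paths" "emeasure paths A > 0"
    "\<And>\<omega> k. \<omega> \<in> A \<Longrightarrow> real k * \<delta> \<le> walk \<omega> k" using linear_growth_event by metis
  note [measurable] = A(2)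
  have fin: "emeasure paths A < \<infinity>" by (simp add: less_top[symmetric])
  let ?m = "of_nat (nat \<lfloor>l / \<delta>\<rfloor> + 1) :: ennreal"
  let ?I = "\<lambda>t \<omega>. \<Sum>n. indicator {a<..a + l} (t - walk \<omega> n) * indicator A (sdrop n \<omega>) :: ennreal"
  have "(\<lambda>k. renewal_sum (indicator {a<..a + l}) (X k)) \<longlonglongrightarrow> 0"
    if X: "filterlim X at_bot sequentially" for X :: "nat \<Rightarrow> real"
  proof -
    have ptw: "(\<lambda>k. ?I (X k) \<omega>) \<longlonglongrightarrow> 0" for \<omega>
    proof (cases "\<exists>m. sdrop m \<omega> \<in> A")
      case True
      then have "filterlim (walk \<omega>) at_top sequentially"
        using walk_eventually_large[OF A(1,4)] by blast
      then have "eventually (\<lambda>n. walk \<omega> n \<ge> 0) sequentially"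
        by (simp add: filterlim_at_top)
      then obtain N where N: "\<And>n. n \<ge> N \<Longrightarrow> walk \<omega> n \<ge> 0" by (auto simp: eventually_sequentially)
      \<comment> \<open>A lower bound of the whole path: finitely many values precede
        \<open>N\<close>, and all later ones are nonnegative.\<close>
      define b where "b = Min (insert 0 (walk \<omega> ` {..<N}))"
      have b: "b \<le> walk \<omega> n" for n
      proof (cases "n < N")
        case True then show ?thesis unfolding b_def by (intro Min_le) auto
      next
        case False
        have "b \<le> 0" unfolding b_def by (intro Min_le) auto
        with N[of n] False show ?thesis by simp
      qed
      have "eventually (\<lambda>k. X k \<le> a + b) sequentially"
        using X by (simp add: filterlim_at_bot)
      then have "eventually (\<lambda>k. ?I (X k) \<omega> = 0) sequentially"
      proof eventually_elim
        case (elim k)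
        have "X k - walk \<omega> n \<le> a" for n using b[of n] elim by simp
        then have "indicator {a<..a + l} (X k - walk \<omega> n) = (0::ennreal)" for n
          by (simp add: indicator_def not_less)
        then show ?case by simp
      qed
      then show ?thesis by (rule tendsto_eventually)
    qed auto
    have "(\<lambda>k. \<integral>\<^sup>+\<omega>. ?I (X k) \<omega> \<partial>paths) \<longlonglongrightarrow> (\<integral>\<^sup>+\<omega>. 0 \<partial>paths)"
      by (rule nn_integral_dominated_convergence[where w = "\<lambda>_. ?m"])
         (use ptw visits_card[OF A(1,4)] in \<open>auto simp: P.emeasure_space_1 of_nat_less_top intro!: AE_I2\<close>)
    then have "(\<lambda>k. renewal_sum (indicator {a<..a + l}) (X k) * emeasure paths A) \<longlonglongrightarrow> 0"
      by (subst renewal_sum_path) auto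
    then show ?thesis by (rule tendsto_0_mult_right_cancel) (use A fin in auto)
  qed
  then show ?thesis by (rule tendsto_at_botI_sequentially)
qed

text \<open>The walk escapes to the right, so the position \<open>t - walk \<omega> n\<close> leaves
  every right half-line. As before, inserting the event \<open>A\<close> for the future restricts
  attention to paths on which this is certain.\<close>

lemma conv_fun_pow_ray_tendsto_0:
  "(\<lambda>n. (conv_fun G ^^ n) (indicator {a..}) t) \<longlonglongrightarrow> 0"
proof -
  obtain \<delta> A where A: "\<delta> > 0" "A \<in> sets paths" "emeasure paths A > 0"
    "\<And>\<omega> k. \<omega> \<in> A \<Longrightarrow> real k * \<delta> \<le> walk \<omega> k" using linear_growth_event by metis
  note [measurable] = A(2)
  have fin: "emeasure paths A < \<infinity>" by (simp add: less_top[symmetric])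
  have ptw: "(\<lambda>n. indicator {a..} (t - walk \<omega> n) * indicator A (sdrop n \<omega>) :: ennreal) \<longlonglongrightarrow> 0" for \<omega>
  proof (cases "\<exists>m. sdrop m \<omega> \<in> A")
    case True
    then have "filterlim (walk \<omega>) at_top sequentially"
      using walk_eventually_large[OF A(1,4)] by blast
    then have "eventually (\<lambda>n. walk \<omega> n > t - a) sequentially"
      by (simp add: filterlim_at_top_dense)
    then show ?thesis
      by (intro tendsto_eventually) (auto elim!: eventually_mono simp: indicator_def)
  qed auto
  have "(\<lambda>n. \<integral>\<^sup>+\<omega>. indicator {a..} (t - walk \<omega> n) * indicator A (sdrop n \<omega>) \<partial>paths) \<longlonglongrightarrow> (\<integral>\<^sup>+\<omega>. 0 \<partial>paths)"
    by (rule nn_integral_dominated_convergence[where w = "\<lambda>_. 1"])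
       (use ptw in \<open>auto simp: P.emeasure_space_1 indicator_def\<close>)
  then have "(\<lambda>n. (conv_fun G ^^ n) (indicator {a..}) t * emeasure paths A) \<longlonglongrightarrow> 0"
    by (subst (asm) nn_integral_walk_future) auto
  then show ?thesis by (rule tendsto_0_mult_right_cancel) (use A fin in auto)
qed

end

section \<open>Matrix convolution operators\<close>

definition mat_act :: "('s \<Rightarrow> 's \<Rightarrow> ennreal) \<Rightarrow> ('s \<Rightarrow> ennreal) \<Rightarrow> 's \<Rightarrow> ennreal" where
  "mat_act q c i = (\<integral>\<^sup>+j. q i j * c j \<partial>count_space UNIV)"

definition meas_fam :: "('s \<Rightarrow> real \<Rightarrow> ennreal) \<Rightarrow> bool" where
  "meas_fam f \<longleftrightarrow> (\<forall>j. f j \<in> borel_measurable borel)"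

lemma measurable_nn_integral_count_space:
  fixes g :: "'k::countable \<Rightarrow> 'a \<Rightarrow> ennreal"
  assumes [measurable]: "\<And>k. g k \<in> borel_measurable M"
  shows "(\<lambda>t. \<integral>\<^sup>+k. g k t \<partial>count_space UNIV) \<in> borel_measurable M"
proof -
  interpret sigma_finite_measure "count_space (UNIV :: 'k set)"
    by (intro sigma_finite_measure_count_space_countable) auto
  have "(\<lambda>x. g (snd x) (fst x)) \<in> borel_measurable (M \<Otimes>\<^sub>M count_space UNIV)"
    by (rule measurable_compose_countable[where f = "\<lambda>k x. g k (fst x)" and g = snd]) measurable
  then show ?thesis
    by (intro borel_measurable_nn_integral) (simp add: split_beta')
qed

lemma nn_integral_count_space_swap:
  fixes g :: "'a::countable \<Rightarrow> 'b \<Rightarrow> ennreal"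
  shows "(\<integral>\<^sup>+x. \<integral>\<^sup>+y. g x y \<partial>count_space UNIV \<partial>count_space UNIV) =
    (\<integral>\<^sup>+y. \<integral>\<^sup>+x. g x y \<partial>count_space UNIV \<partial>count_space UNIV)"
  by (rule nn_integral_count_space_nn_integral[symmetric]) auto

lemma nn_integral_count_space_upper:
  fixes f :: "'a \<Rightarrow> ennreal" shows "f x \<le> (\<integral>\<^sup>+x. f x \<partial>count_space UNIV)"
proof -
  have "f x = (\<integral>\<^sup>+y. f y * indicator {x} y \<partial>count_space UNIV)"
    by (subst nn_integral_indicator_singleton) auto
  also have "\<dots> \<le> (\<integral>\<^sup>+x. f x \<partial>count_space UNIV)"
    by (intro nn_integral_mono) (auto simp: indicator_def)
  finally show ?thesis .
qed

lemma nn_integral_count_space_single: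
  fixes f :: "'a \<Rightarrow> ennreal"
  assumes "\<And>y. y \<noteq> x \<Longrightarrow> f y = 0"
  shows "(\<integral>\<^sup>+y. f y \<partial>count_space UNIV) = f x"
proof -
  have "(\<integral>\<^sup>+y. f y \<partial>count_space UNIV) = (\<integral>\<^sup>+y. f x * indicator {x} y \<partial>count_space UNIV)"
    by (intro nn_integral_cong) (use assms in \<open>auto simp: indicator_def\<close>)
  also have "\<dots> = f x" by (subst nn_integral_cmult_indicator) auto
  finally show ?thesis .
qed

lemma mat_act_mono: "(\<And>j. c j \<le> d j) \<Longrightarrow> mat_act q c i \<le> mat_act q d i"
  unfolding mat_act_def by (intro nn_integral_mono mult_left_mono) auto

lemma mat_act_upper: "q i j * c j \<le> mat_act q c i"
  unfolding mat_act_def by (rule nn_integral_count_space_upper)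

text \<open>This is the content of the class \<open>L\<close> for a single state, apart from
  measurability; no uniformity over the states is involved.\<close>

definition bounded_vanishing :: "(real \<Rightarrow> ennreal) \<Rightarrow> bool" where
  "bounded_vanishing h \<longleftrightarrow> (\<exists>C<\<infinity>. \<forall>t. h t \<le> C) \<and> (h \<longlongrightarrow> 0) at_bot"

lemma nn_integral_tendsto_at_bot:
  fixes g :: "real \<Rightarrow> 'a \<Rightarrow> ennreal"
  assumes [measurable]: "\<And>t. g t \<in> borel_measurable M" "w \<in> borel_measurable M"
    and "\<And>t x. g t x \<le> w x" "(\<integral>\<^sup>+x. w x \<partial>M) < \<infinity>" "\<And>x. ((\<lambda>t. g t x) \<longlongrightarrow> 0) at_bot"
  shows "((\<lambda>t. \<integral>\<^sup>+x. g t x \<partial>M) \<longlongrightarrow> 0) at_bot"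
proof (rule tendsto_at_botI_sequentially)
  fix X :: "nat \<Rightarrow> real" assume X: "filterlim X at_bot sequentially"
  have "(\<lambda>n. \<integral>\<^sup>+x. g (X n) x \<partial>M) \<longlonglongrightarrow> (\<integral>\<^sup>+x. 0 \<partial>M)"
    by (rule nn_integral_dominated_convergence[where w = w])
       (use assms filterlim_compose[OF assms(5) X] in auto)
  then show "(\<lambda>n. \<integral>\<^sup>+x. g (X n) x \<partial>M) \<longlonglongrightarrow> 0" by simp
qed

lemma conv_fun_vanishing:
  assumes "sets M = sets borel" "emeasure M UNIV < \<infinity>" "h \<in> borel_measurable borel"
    "\<And>t. h t \<le> C" "C < \<infinity>" "(h \<longlongrightarrow> 0) at_bot"
  shows "conv_fun M h t \<le> C * emeasure M UNIV" "(conv_fun M h \<longlongrightarrow> 0) at_bot"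
proof -
  note [measurable_cong] = assms(1) and [measurable] = assms(3)
  have sp: "space M = UNIV" using sets_eq_imp_space_eq[OF assms(1)] by simp
  have "conv_fun M h t \<le> (\<integral>\<^sup>+x. C \<partial>M)"
    unfolding conv_fun_def by (intro nn_integral_mono assms)
  then show "conv_fun M h t \<le> C * emeasure M UNIV" by (simp add: sp)
  have "((\<lambda>t. \<integral>\<^sup>+x. h (t - x) \<partial>M) \<longlongrightarrow> 0) at_bot"
  proof (rule nn_integral_tendsto_at_bot[where w = "\<lambda>_. C"])
    show "((\<lambda>t. h (t - x)) \<longlongrightarrow> 0) at_bot" for x
    proof (rule filterlim_compose[OF assms(6)])
      show "filterlim (\<lambda>t. t - x) at_bot at_bot"
        unfolding filterlim_at_bot
      proof
        fix Z
        show "eventually (\<lambda>t. t - x \<le> Z) at_bot"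
          using eventually_le_at_bot[of "Z + x"] by eventually_elim simp
      qed
    qed
  qed (use assms in \<open>auto simp: sp ennreal_mult_less_top\<close>)
  then show "(conv_fun M h \<longlongrightarrow> 0) at_bot" by (simp add: conv_fun_def[abs_def])
qed

lemma conv_fun_const: "sets M = sets borel \<Longrightarrow> conv_fun M (\<lambda>_. c) t = c * emeasure M UNIV"
  using sets_eq_imp_space_eq[of M borel] by (simp add: conv_fun_def)

lemma conv_fun_cmult:
  assumes [measurable_cong]: "sets M = sets borel" and [measurable]: "f \<in> borel_measurable borel"
  shows "conv_fun M (\<lambda>t. c * f t) t = c * conv_fun M f t"
  unfolding conv_fun_def by (rule nn_integral_cmult) measurable

lemma conv_fun_count_sum:
  fixes f :: "'k::countable \<Rightarrow> real \<Rightarrow> ennreal"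
  assumes [measurable_cong]: "sets M = sets borel" and [measurable]: "\<And>k. f k \<in> borel_measurable borel"
  shows "conv_fun M (\<lambda>t. \<integral>\<^sup>+k. f k t \<partial>count_space UNIV) t = (\<integral>\<^sup>+k. conv_fun M (f k) t \<partial>count_space UNIV)"
  unfolding conv_fun_def by (rule nn_integral_count_space_nn_integral) auto

locale conv_matrix =
  fixes F :: "'s::countable \<Rightarrow> 's \<Rightarrow> real measure"
  assumes real_distribution_F: "\<And>i j. real_distribution (F i j)"
begin

lemma sets_F[measurable_cong, simp]: "sets (F i j) = sets borel"
  using real_distribution_F[of i j] by (simp add: real_distribution_def real_distribution_axioms_def)

lemma prob_F: "prob_space (F i j)"
  using real_distribution_F[of i j] by (simp add: real_distribution_def)

lemma sigma_finite_F: "sigma_finite_measure (F i j)"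
  using prob_F[of i j] by (meson finite_measure.axioms(1) prob_space.axioms(1))

lemma emeasure_F[simp]: "emeasure (F i j) UNIV = 1"
  using prob_space.emeasure_space_1[OF prob_F, of i j] sets_eq_imp_space_eq[OF sets_F, of i j] by simp

lemma space_F[simp]: "space (F i j) = UNIV"
  using sets_eq_imp_space_eq[OF sets_F, of i j] by simp

lemma conv_fun_F_measurable[measurable]:
  "h \<in> borel_measurable borel \<Longrightarrow> conv_fun (F i j) h \<in> borel_measurable borel"
  by (intro measurable_conv_fun sigma_finite_F) auto

text \<open>The weights are a parameter because the same laws \<open>F\<close> are later used with
  the full matrix, with the matrix killed at a root, and with its column at the root.\<close>

definition mop :: "('s \<Rightarrow> 's \<Rightarrow> ennreal) \<Rightarrow> ('s \<Rightarrow> real \<Rightarrow> ennreal) \<Rightarrow> 's \<Rightarrow> real \<Rightarrow> ennreal" where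
  "mop q f i t = (\<integral>\<^sup>+j. q i j * conv_fun (F i j) (f j) t \<partial>count_space UNIV)"

lemma meas_fam_mop: "meas_fam f \<Longrightarrow> meas_fam (mop q f)"
proof -
  assume "meas_fam f"
  note [measurable] = this[unfolded meas_fam_def, rule_format]
  show ?thesis
    unfolding meas_fam_def mop_def[abs_def]
    by (intro allI measurable_nn_integral_count_space) measurable
qed

lemma meas_fam_mop_pow: "meas_fam f \<Longrightarrow> meas_fam ((mop q ^^ n) f)"
  by (induction n) (auto intro: meas_fam_mop)

lemma mop_mono: "(\<And>j t. f j t \<le> g j t) \<Longrightarrow> mop q f i t \<le> mop q g i t"
  unfolding mop_def by (intro nn_integral_mono mult_left_mono conv_fun_mono) auto

lemma mop_pow_mono: "(\<And>j t. f j t \<le> g j t) \<Longrightarrow> (mop q ^^ n) f i t \<le> (mop q ^^ n) g i t"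
  by (induction n arbitrary: i t) (auto intro: mop_mono)

lemma mop_add_matrix: "mop (\<lambda>i j. q i j + q' i j) f i t = mop q f i t + mop q' f i t"
  unfolding mop_def by (subst nn_integral_add[symmetric]) (auto simp: distrib_right)

lemma mop_add:
  assumes "meas_fam f" "meas_fam g"
  shows "mop q (\<lambda>j t. f j t + g j t) i t = mop q f i t + mop q g i t"
proof -
  note [measurable] = assms[unfolded meas_fam_def, rule_format]
  show ?thesis
    unfolding mop_def
    by (subst nn_integral_add[symmetric])
       (auto simp: conv_fun_def nn_integral_add distrib_left)
qed

lemma mop_cmult:
  assumes "meas_fam f"
  shows "mop q (\<lambda>j t. c * f j t) i t = c * mop q f i t"
proof -
  note [measurable] = assms[unfolded meas_fam_def, rule_format]
  show ?thesis
    unfolding mop_def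
    by (subst nn_integral_cmult[symmetric])
       (auto simp: conv_fun_def nn_integral_cmult ac_simps)
qed

lemma mop_count_sum:
  fixes f :: "'k::countable \<Rightarrow> 's \<Rightarrow> real \<Rightarrow> ennreal"
  assumes "\<And>k. meas_fam (f k)"
  shows "mop q (\<lambda>j t. \<integral>\<^sup>+k. f k j t \<partial>count_space UNIV) i t = (\<integral>\<^sup>+k. mop q (f k) i t \<partial>count_space UNIV)"
proof -
  note [measurable] = assms[unfolded meas_fam_def, rule_format]
  have "conv_fun (F i j) (\<lambda>t. \<integral>\<^sup>+k. f k j t \<partial>count_space UNIV) t
      = (\<integral>\<^sup>+k. conv_fun (F i j) (f k j) t \<partial>count_space UNIV)" for j
    unfolding conv_fun_def by (rule nn_integral_count_space_nn_integral) auto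
  then show ?thesis
    unfolding mop_def
    by (subst nn_integral_count_space_swap) (simp add: nn_integral_cmult)
qed

lemma mop_suminf:
  assumes "\<And>k. meas_fam (f k)"
  shows "mop q (\<lambda>j t. \<Sum>k::nat. f k j t) i t = (\<Sum>k. mop q (f k) i t)"
  using mop_count_sum[of f q i t] assms by (simp add: nn_integral_count_space_nat)

lemma meas_famD: "meas_fam f \<Longrightarrow> f j \<in> borel_measurable borel"
  by (simp add: meas_fam_def)

lemma meas_fam_add: "meas_fam f \<Longrightarrow> meas_fam g \<Longrightarrow> meas_fam (\<lambda>j t. f j t + g j t)"
  unfolding meas_fam_def by (safe, drule spec, drule spec, measurable)

lemma meas_fam_cmult: "meas_fam f \<Longrightarrow> meas_fam (\<lambda>j t. c * f j t)"
  unfolding meas_fam_def by (safe, drule spec, measurable)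

lemma meas_fam_count_sum:
  fixes f :: "'k::countable \<Rightarrow> 's \<Rightarrow> real \<Rightarrow> ennreal"
  shows "(\<And>k. meas_fam (f k)) \<Longrightarrow> meas_fam (\<lambda>j t. \<integral>\<^sup>+k. f k j t \<partial>count_space UNIV)"
  by (auto simp: meas_fam_def intro!: measurable_nn_integral_count_space)

lemma meas_fam_suminf:
  assumes "\<And>k. meas_fam (f k)" shows "meas_fam (\<lambda>j t. \<Sum>k::nat. f k j t)"
proof -
  note [measurable] = assms[THEN meas_famD]
  show ?thesis unfolding meas_fam_def by measurable
qed

lemma meas_fam_sum:
  assumes "\<And>k. meas_fam (f k)" shows "meas_fam (\<lambda>j t. \<Sum>k\<in>A. f k j t)"
proof -
  note [measurable] = assms[THEN meas_famD]
  show ?thesis unfolding meas_fam_def by measurable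
qed

lemma meas_fam_const: "meas_fam (\<lambda>j t. c j)"
  by (auto simp: meas_fam_def)

lemmas meas_fam_intros = meas_fam_mop meas_fam_mop_pow meas_fam_add meas_fam_cmult
  meas_fam_count_sum meas_fam_suminf meas_fam_sum meas_fam_const

lemma mop_pow_add:
  assumes "meas_fam f" "meas_fam g"
  shows "(mop q ^^ n) (\<lambda>j t. f j t + g j t) = (\<lambda>i t. (mop q ^^ n) f i t + (mop q ^^ n) g i t)"
  by (induction n) (use assms in \<open>auto simp: mop_add meas_fam_intros\<close>)

lemma mop_pow_cmult:
  assumes "meas_fam f"
  shows "(mop q ^^ n) (\<lambda>j t. c * f j t) = (\<lambda>i t. c * (mop q ^^ n) f i t)"
  by (induction n) (use assms in \<open>auto simp: mop_cmult meas_fam_intros\<close>)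

lemma mop_pow_count_sum:
  fixes f :: "'k::countable \<Rightarrow> 's \<Rightarrow> real \<Rightarrow> ennreal"
  assumes "\<And>k. meas_fam (f k)"
  shows "(mop q ^^ n) (\<lambda>j t. \<integral>\<^sup>+k. f k j t \<partial>count_space UNIV)
    = (\<lambda>i t. \<integral>\<^sup>+k. (mop q ^^ n) (f k) i t \<partial>count_space UNIV)"
  by (induction n) (use assms in \<open>auto simp: mop_count_sum meas_fam_intros\<close>)

lemma mop_pow_suminf:
  assumes "\<And>k::nat. meas_fam (f k)"
  shows "(mop q ^^ n) (\<lambda>j t. \<Sum>k. f k j t) = (\<lambda>i t. \<Sum>k. (mop q ^^ n) (f k) i t)"
  by (induction n) (use assms in \<open>auto simp: mop_suminf meas_fam_intros\<close>)

lemma mop_SUP: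
  assumes "\<And>n::nat. meas_fam (f n)" "\<And>j t. incseq (\<lambda>n. f n j t)"
  shows "mop q (\<lambda>j t. SUP n. f n j t) i t = (SUP n. mop q (f n) i t)"
proof -
  note [measurable] = assms(1)[unfolded meas_fam_def, rule_format]
  have inc: "incseq (\<lambda>n x. f n j (t - x))" for j
    using assms(2) by (auto simp: incseq_def le_fun_def)
  have "conv_fun (F i j) (\<lambda>t. SUP n. f n j t) t = (SUP n. conv_fun (F i j) (f n j) t)" for j
    unfolding conv_fun_def using inc by (intro nn_integral_monotone_convergence_SUP) auto
  moreover have "incseq (\<lambda>n. conv_fun (F i j) (f n j) t)" for j
    unfolding conv_fun_def incseq_def using inc[of j]
    by (auto intro!: nn_integral_mono simp: incseq_def le_fun_def)
  ultimately show ?thesis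
    unfolding mop_def
    by (subst nn_integral_monotone_convergence_SUP[symmetric])
       (auto simp: SUP_mult_left_ennreal incseq_def le_fun_def intro!: mult_left_mono)
qed

lemma mop_pow_SUP:
  assumes "\<And>n::nat. meas_fam (f n)" "\<And>j t. incseq (\<lambda>n. f n j t)"
  shows "(mop q ^^ m) (\<lambda>j t. SUP n. f n j t) = (\<lambda>i t. SUP n. (mop q ^^ m) (f n) i t)"
proof (induction m)
  case (Suc m)
  have "incseq (\<lambda>n. (mop q ^^ m) (f n) j t)" for j t
    using assms(2) by (auto simp: incseq_def intro!: mop_pow_mono)
  then show ?case using assms(1) by (auto simp: Suc mop_SUP meas_fam_intros)
qed simp

lemma mop_const: "mop q (\<lambda>j t. c j) = (\<lambda>i t. mat_act q c i)"
  by (auto simp: mop_def mat_act_def conv_fun_const fun_eq_iff)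

lemma mop_pow_const: "(mop q ^^ n) (\<lambda>j t. c j) = (\<lambda>i t. (mat_act q ^^ n) c i)"
  by (induction n) (auto simp: mop_const)

lemma mop_shift: "mop q (\<lambda>j t. f j (t + s)) = (\<lambda>i t. mop q f i (t + s))"
  by (auto simp: mop_def conv_fun_def fun_eq_iff algebra_simps)

lemma mop_pow_shift: "(mop q ^^ n) (\<lambda>j t. f j (t + s)) = (\<lambda>i t. (mop q ^^ n) f i (t + s))"
  by (induction n) (auto simp: mop_shift)

text \<open>Convolutions on the line commute, and the matrix operator is a weighted sum of
  convolutions. This is what allows \<open>U\<close> and \<open>N\<close> to be
  interchanged.\<close>

lemma mop_conv_fun:
  assumes M[measurable_cong]: "sets M = sets borel" and "sigma_finite_measure M" and f: "meas_fam f"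
  shows "mop q (\<lambda>j. conv_fun M (f j)) i = conv_fun M (mop q f i)"
proof
  fix t
  note [measurable] = f[unfolded meas_fam_def, rule_format]
  have "conv_fun M (mop q f i) t = (\<integral>\<^sup>+j. conv_fun M (\<lambda>t. q i j * conv_fun (F i j) (f j) t) t \<partial>count_space UNIV)"
    unfolding mop_def[abs_def]
    by (rule conv_fun_count_sum[OF M]) (intro borel_measurable_times_ennreal borel_measurable_const conv_fun_F_measurable meas_famD f)
  also have "\<dots> = (\<integral>\<^sup>+j. q i j * conv_fun (F i j) (conv_fun M (f j)) t \<partial>count_space UNIV)"
  proof (rule nn_integral_cong)
    fix j
    have "conv_fun M (\<lambda>t. q i j * conv_fun (F i j) (f j) t) t = q i j * conv_fun M (conv_fun (F i j) (f j)) t"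
      by (rule conv_fun_cmult[OF M conv_fun_F_measurable[OF meas_famD[OF f]]])
    also have "conv_fun M (conv_fun (F i j) (f j)) = conv_fun (F i j) (conv_fun M (f j))"
      by (rule conv_fun_commute[OF M sets_F assms(2) sigma_finite_F meas_famD[OF f]])
    finally show "conv_fun M (\<lambda>t. q i j * conv_fun (F i j) (f j) t) t = q i j * conv_fun (F i j) (conv_fun M (f j)) t" .
  qed
  finally show "mop q (\<lambda>j. conv_fun M (f j)) i t = conv_fun M (mop q f i) t"
    by (simp add: mop_def)
qed

lemma mop_conv_fun_pow:
  assumes M: "sets M = sets borel" "sigma_finite_measure M" and f: "meas_fam f"
  shows "mop q (\<lambda>j. (conv_fun M ^^ n) (f j)) i = (conv_fun M ^^ n) (mop q f i)"
proof (induction n arbitrary: i)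
  case (Suc n)
  have "meas_fam (\<lambda>j. (conv_fun M ^^ n) (f j))"
    using f M by (auto simp: meas_fam_def intro!: measurable_conv_fun_pow)
  then show ?case using mop_conv_fun[OF M, of "\<lambda>j. (conv_fun M ^^ n) (f j)" q i] Suc by simp
qed simp

lemma mop_pow_conv_fun_pow:
  assumes M: "sets M = sets borel" "sigma_finite_measure M" and f: "meas_fam f"
  shows "(mop q ^^ m) (\<lambda>j. (conv_fun M ^^ n) (f j)) i = (conv_fun M ^^ n) ((mop q ^^ m) f i)"
proof (induction m arbitrary: i)
  case (Suc m)
  have "(mop q ^^ m) (\<lambda>j. (conv_fun M ^^ n) (f j)) = (\<lambda>j. (conv_fun M ^^ n) ((mop q ^^ m) f j))"
    using Suc by auto
  then show ?case using mop_conv_fun_pow[OF M, of "(mop q ^^ m) f" q n i] f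
    by (simp add: meas_fam_intros)
qed simp

lemma nn_integral_conv_fun_lborel:
  assumes [measurable]: "h \<in> borel_measurable borel"
  shows "(\<integral>\<^sup>+t. conv_fun (F i j) h t \<partial>lborel) = (\<integral>\<^sup>+t. h t \<partial>lborel)"
proof -
  interpret P: sigma_finite_measure "F i j" by (rule sigma_finite_F)
  interpret pair_sigma_finite lborel "F i j" ..
  have "(\<integral>\<^sup>+t. conv_fun (F i j) h t \<partial>lborel) = (\<integral>\<^sup>+x. \<integral>\<^sup>+t. h (t - x) \<partial>lborel \<partial>F i j)"
    unfolding conv_fun_def by (rule Fubini'[symmetric]) measurable
  also have "\<dots> = (\<integral>\<^sup>+x. (\<integral>\<^sup>+t. h t \<partial>lborel) \<partial>F i j)"
  proof (rule nn_integral_cong)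
    fix x
    have "(\<integral>\<^sup>+t. h t \<partial>lborel) = (\<integral>\<^sup>+t. h t \<partial>distr lborel borel ((+) (- x)))"
      by (simp add: lborel_distr_plus)
    also have "\<dots> = (\<integral>\<^sup>+t. h (t - x) \<partial>lborel)" by (subst nn_integral_distr) auto
    finally show "(\<integral>\<^sup>+t. h (t - x) \<partial>lborel) = (\<integral>\<^sup>+t. h t \<partial>lborel)" ..
  qed
  finally show ?thesis by simp
qed

text \<open>Convolution with a probability law preserves the Lebesgue integral, so integrating out
  \<open>t\<close> leaves only the weights.\<close>

lemma mop_lborel:
  assumes "meas_fam f"
  shows "(\<integral>\<^sup>+t. mop q f i t \<partial>lborel) = mat_act q (\<lambda>j. \<integral>\<^sup>+t. f j t \<partial>lborel) i"
proof -
  note [measurable] = assms[unfolded meas_fam_def, rule_format]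
  show ?thesis
    unfolding mop_def mat_act_def
    by (subst nn_integral_count_space_nn_integral)
       (auto simp: nn_integral_cmult nn_integral_conv_fun_lborel)
qed

lemma mop_pow_lborel:
  assumes "meas_fam f"
  shows "(\<integral>\<^sup>+t. (mop q ^^ n) f i t \<partial>lborel) = (mat_act q ^^ n) (\<lambda>j. \<integral>\<^sup>+t. f j t \<partial>lborel) i"
  using assms by (induction n arbitrary: i) (auto simp: mop_lborel meas_fam_intros)

lemma mop_tendsto_0:
  assumes "meas_fam f" "\<And>j t. f j t \<le> c j" "mat_act q c i < \<infinity>" "\<And>j. (f j \<longlongrightarrow> 0) at_bot"
  shows "(mop q f i \<longlongrightarrow> 0) at_bot"
proof -
  note [measurable] = assms(1)[unfolded meas_fam_def, rule_format]
  have "conv_fun (F i j) (f j) t \<le> c j" for j t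
  proof -
    have "conv_fun (F i j) (f j) t \<le> conv_fun (F i j) (\<lambda>_. c j) t" by (intro conv_fun_mono assms)
    then show ?thesis by (simp add: conv_fun_const)
  qed
  then have bd: "q i j * conv_fun (F i j) (f j) t \<le> q i j * c j" for j t
    by (intro mult_left_mono) auto
  have fin: "q i j * c j < \<infinity>" for j
    by (rule le_less_trans[OF mat_act_upper assms(3)])
  have "((\<lambda>t. \<integral>\<^sup>+j. q i j * conv_fun (F i j) (f j) t \<partial>count_space UNIV) \<longlongrightarrow> 0) at_bot"
  proof (rule nn_integral_tendsto_at_bot[where w = "\<lambda>j. q i j * c j"])
    fix j
    \<comment> \<open>A finite product does not make both factors finite, since 0 times \<infinity>
      is 0 in \<open>ennreal\<close>; the two degenerate cases have to be treated apart.\<close>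
    consider "q i j = 0" | "c j = 0" | "q i j < \<top>" "c j < \<top>"
      using fin[of j] by (auto simp: ennreal_mult_eq_top_iff less_top[symmetric])
    then show "((\<lambda>t. q i j * conv_fun (F i j) (f j) t) \<longlongrightarrow> 0) at_bot"
    proof cases
      case 2
      then have "(\<lambda>t. q i j * conv_fun (F i j) (f j) t) = (\<lambda>_. 0)"
        using bd[of j] by (intro ext) simp
      then show ?thesis by (simp only: tendsto_const)
    next
      case 3
      have "(conv_fun (F i j) (f j) \<longlongrightarrow> 0) at_bot"
        by (rule conv_fun_vanishing(2)[where C = "c j", OF _ _ _ assms(2) _ assms(4)]) (simp_all add: 3)
      from ennreal_tendsto_cmult[OF 3(1) this] show ?thesis by simp
    qed simp
  next
    show "(\<integral>\<^sup>+j. q i j * c j \<partial>count_space UNIV) < \<infinity>" using assms(3) by (simp only: mat_act_def)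
  qed (simp_all add: bd)
  then show ?thesis by (simp add: mop_def[abs_def])
qed

text \<open>The potential operator of the weights: for the full matrix it is \<open>V\<close>, for
  the matrix killed at the root it is \<open>N\<close>.\<close>

definition Vsum :: "('s \<Rightarrow> 's \<Rightarrow> ennreal) \<Rightarrow> ('s \<Rightarrow> real \<Rightarrow> ennreal) \<Rightarrow> 's \<Rightarrow> real \<Rightarrow> ennreal" where
  "Vsum q f i t = (\<Sum>n. (mop q ^^ n) f i t)"

lemma meas_fam_Vsum: "meas_fam f \<Longrightarrow> meas_fam (Vsum q f)"
  unfolding Vsum_def[abs_def] by (intro meas_fam_intros)

lemma Vsum_mono: "(\<And>j t. f j t \<le> g j t) \<Longrightarrow> Vsum q f i t \<le> Vsum q g i t"
  unfolding Vsum_def by (intro suminf_le mop_pow_mono) auto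

lemma Vsum_add: "meas_fam f \<Longrightarrow> meas_fam g \<Longrightarrow> Vsum q (\<lambda>j t. f j t + g j t) i t = Vsum q f i t + Vsum q g i t"
  unfolding Vsum_def by (simp add: mop_pow_add suminf_add)

lemma Vsum_cmult: "meas_fam f \<Longrightarrow> Vsum q (\<lambda>j t. c * f j t) i t = c * Vsum q f i t"
  unfolding Vsum_def by (simp add: mop_pow_cmult)

lemma Vsum_zero: "Vsum q (\<lambda>_ _. 0) i t = 0"
  using Vsum_cmult[of "\<lambda>_ _. 0" q 0 i t] by (simp add: meas_fam_const)

lemma Vsum_shift: "Vsum q (\<lambda>j t. f j (t + s)) i t = Vsum q f i (t + s)"
  unfolding Vsum_def by (simp add: mop_pow_shift)

lemma Vsum_SUP:
  assumes "\<And>n::nat. meas_fam (f n)" "\<And>j t. incseq (\<lambda>n. f n j t)"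
  shows "Vsum q (\<lambda>j t. SUP n. f n j t) i t = (SUP n. Vsum q (f n) i t)"
proof -
  have "incseq (\<lambda>n. (mop q ^^ m) (f n) i t)" for m
    using assms(2) by (auto simp: incseq_def intro!: mop_pow_mono)
  then have "(\<Sum>m. SUP n. (mop q ^^ m) (f n) i t) = (SUP n. \<Sum>m. (mop q ^^ m) (f n) i t)"
    by (intro ennreal_suminf_SUP_eq)
  then show ?thesis unfolding Vsum_def using assms by (simp add: mop_pow_SUP)
qed

lemma mop_pow_Vsum:
  assumes "meas_fam f"
  shows "(mop q ^^ n) (Vsum q f) i t = (\<Sum>k. (mop q ^^ (k + n)) f i t)"
  unfolding Vsum_def[abs_def] using assms
  by (simp add: mop_pow_suminf meas_fam_intros funpow_add[symmetric] funpow_swap1 flip: comp_apply[of "mop q ^^ _" "mop q ^^ _"])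
     (simp add: add.commute)

lemma Vsum_unfold:
  assumes "meas_fam f"
  shows "Vsum q f i t = f i t + mop q (Vsum q f) i t"
proof -
  have "Vsum q f i t = (\<Sum>k. (mop q ^^ (k + 1)) f i t) + (\<Sum>k<1. (mop q ^^ k) f i t)"
    unfolding Vsum_def by (rule suminf_offset) simp
  also have "(\<Sum>k. (mop q ^^ (k + 1)) f i t) = mop q (Vsum q f) i t"
    using mop_pow_Vsum[OF assms, where n = 1 and i = i and t = t] by simp
  finally show ?thesis by (simp add: add.commute)
qed

lemma Vsum_unfold_right: "Vsum q f i t = f i t + Vsum q (mop q f) i t"
proof -
  have "Vsum q f i t = (\<Sum>k. (mop q ^^ (k + 1)) f i t) + (\<Sum>k<1. (mop q ^^ k) f i t)"
    unfolding Vsum_def by (rule suminf_offset) simp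
  then show ?thesis by (simp add: Vsum_def funpow_swap1 add.commute)
qed

end

section \<open>Weights that control sums over the states\<close>

definition subinvariant :: "('s \<Rightarrow> ennreal) \<Rightarrow> ('s \<Rightarrow> 's \<Rightarrow> ennreal) \<Rightarrow> bool" where
  "subinvariant u q \<longleftrightarrow> (\<forall>j. (\<integral>\<^sup>+i. u i * q i j \<partial>count_space UNIV) \<le> u j)"

lemma weighted_mat_act:
  fixes q :: "'s::countable \<Rightarrow> 's \<Rightarrow> ennreal"
  shows "(\<integral>\<^sup>+i. u i * mat_act q c i \<partial>count_space UNIV) =
    (\<integral>\<^sup>+j. (\<integral>\<^sup>+i. u i * q i j \<partial>count_space UNIV) * c j \<partial>count_space UNIV)"
proof -
  have "(\<integral>\<^sup>+i. u i * mat_act q c i \<partial>count_space UNIV) =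
     (\<integral>\<^sup>+i. \<integral>\<^sup>+j. u i * (q i j * c j) \<partial>count_space UNIV \<partial>count_space UNIV)"
    by (simp add: mat_act_def nn_integral_cmult)
  also have "\<dots> = (\<integral>\<^sup>+j. \<integral>\<^sup>+i. u i * q i j * c j \<partial>count_space UNIV \<partial>count_space UNIV)"
    by (subst nn_integral_count_space_swap) (simp add: mult.assoc)
  finally show ?thesis by (simp add: nn_integral_multc)
qed

lemma subinvariant_mat_act:
  fixes q :: "'s::countable \<Rightarrow> 's \<Rightarrow> ennreal"
  assumes "subinvariant u q"
  shows "(\<integral>\<^sup>+i. u i * mat_act q c i \<partial>count_space UNIV) \<le> (\<integral>\<^sup>+j. u j * c j \<partial>count_space UNIV)"
  unfolding weighted_mat_act
  using assms by (intro nn_integral_mono mult_right_mono) (auto simp: subinvariant_def)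

lemma subinvariant_mat_act_pow:
  fixes q :: "'s::countable \<Rightarrow> 's \<Rightarrow> ennreal"
  assumes "subinvariant u q"
  shows "(\<integral>\<^sup>+i. u i * (mat_act q ^^ n) c i \<partial>count_space UNIV) \<le> (\<integral>\<^sup>+j. u j * c j \<partial>count_space UNIV)"
  by (induction n) (use subinvariant_mat_act[OF assms] in \<open>auto intro: order_trans\<close>)

lemma (in conv_matrix) mop_pow_bound:
  assumes "\<And>j t. f j t \<le> c j"
  shows "(mop q ^^ n) f i t \<le> (mat_act q ^^ n) c i"
  using mop_pow_mono[of f "\<lambda>j _. c j" n q i t] assms by (simp add: mop_pow_const)

lemma weighted_finite_imp_finite:
  fixes u c :: "'s \<Rightarrow> ennreal"
  assumes "(\<integral>\<^sup>+j. u j * c j \<partial>count_space UNIV) < \<infinity>" "u i > 0"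
  shows "c i < \<infinity>"
proof (rule ccontr)
  assume "\<not> c i < \<infinity>"
  then have "u i * c i = \<infinity>" using assms(2) by (simp add: less_top[symmetric] ennreal_mult_eq_top_iff)
  moreover have "u i * c i < \<infinity>"
    by (rule le_less_trans[OF nn_integral_count_space_upper assms(1)])
  ultimately show False by simp
qed

text \<open>Subinvariance keeps the weighted sum of the bound finite under every power, so
  \<open>(mat_act q ^^ n) c\<close> is at each stage a finite majorant for the next dominated
  convergence.\<close>

lemma (in conv_matrix) mop_pow_tendsto_0:
  assumes sub: "subinvariant u q" "\<And>j. u j > 0"
    and f: "meas_fam f" "\<And>j t. f j t \<le> c j" "(\<integral>\<^sup>+j. u j * c j \<partial>count_space UNIV) < \<infinity>"
      "\<And>j. (f j \<longlongrightarrow> 0) at_bot"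
  shows "((mop q ^^ n) f i \<longlongrightarrow> 0) at_bot"
proof (induction n arbitrary: i)
  case (Suc n)
  have "(\<integral>\<^sup>+j. u j * (mat_act q ^^ Suc n) c j \<partial>count_space UNIV) < \<infinity>"
    using le_less_trans[OF subinvariant_mat_act_pow[OF sub(1)] f(3)] .
  then have "(mat_act q ^^ Suc n) c i < \<infinity>" by (rule weighted_finite_imp_finite[where u = u and c = "(mat_act q ^^ Suc n) c" and i = i]) (rule sub(2))
  then show ?case
    using mop_tendsto_0[of "(mop q ^^ n) f" "(mat_act q ^^ n) c" q i, OF meas_fam_mop_pow[OF f(1)] mop_pow_bound[OF f(2)] _ Suc]
    by simp
qed (simp add: f(4))

section \<open>Cycle decomposition at a recurrent state\<close>

lemma ennreal_suminf_tail_tendsto_0: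
  fixes f :: "nat \<Rightarrow> ennreal"
  assumes "(\<Sum>k. f k) < \<infinity>"
  shows "(\<lambda>n. \<Sum>k. f (k + n)) \<longlonglongrightarrow> 0"
proof -
  have fin: "(\<Sum>k<n. f k) < \<infinity>" for n
    by (rule le_less_trans[OF sum_le_suminf assms]) auto
  have eq: "(\<Sum>k. f (k + n)) = (\<Sum>k. f k) - (\<Sum>k<n. f k)" for n
  proof -
    have "(\<Sum>k. f k) = (\<Sum>k. f (k + n)) + (\<Sum>k<n. f k)" by (rule suminf_offset) simp
    moreover have "(\<Sum>k<n. f k) \<noteq> \<top>" using fin[of n] unfolding infinity_ennreal_def less_top .
    ultimately show ?thesis by (metis ennreal_add_diff_cancel_right)
  qed
  have "(\<lambda>n. (\<Sum>k. f k) - (\<Sum>k<n. f k)) \<longlonglongrightarrow> (\<Sum>k. f k) - (\<Sum>k. f k)"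
    using assms by (intro tendsto_diff_ennreal tendsto_const summable_LIMSEQ) (auto simp: less_top[symmetric])
  then show ?thesis using assms by (simp add: eq)
qed

lemma conv_fun_suminf:
  assumes [measurable_cong]: "sets M = sets borel" and [measurable]: "\<And>n. f n \<in> borel_measurable borel"
  shows "conv_fun M (\<lambda>t. \<Sum>n::nat. f n t) t = (\<Sum>n. conv_fun M (f n) t)"
  unfolding conv_fun_def by (rule nn_integral_suminf) measurable

locale markov_renewal = conv_matrix F
  for F :: "'s::countable \<Rightarrow> 's \<Rightarrow> real measure" +
  fixes q :: "'s \<Rightarrow> 's \<Rightarrow> ennreal" and u v :: "'s \<Rightarrow> ennreal" and r :: 's
  assumes u_pos: "0 < u i" and u_fin: "u i < \<infinity>"
    and v_pos: "0 < v i" and v_fin: "v i < \<infinity>"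
    and u_left: "(\<integral>\<^sup>+i. u i * q i j \<partial>count_space UNIV) = u j"
    and v_right: "mat_act q v i = v i"
    and irreducible: "\<exists>n. 0 < (mat_act q ^^ n) (indicator {j}) i"
    and recurrent: "(\<Sum>n. (mat_act q ^^ n) (indicator {r}) r) = \<infinity>"
begin

text \<open>
  \<open>qR\<close> is \<open>q\<close> killed on entering \<open>r\<close> and \<open>qH\<close> is the part of \<open>q\<close> entering \<open>r\<close>, so that
  \<open>Nop\<close> sums over the time before the first visit to \<open>r\<close>.
\<close>

definition qR :: "'s \<Rightarrow> 's \<Rightarrow> ennreal" where "qR i j = (if j = r then 0 else q i j)"
definition qH :: "'s \<Rightarrow> 's \<Rightarrow> ennreal" where "qH i j = (if j = r then q i j else 0)"

abbreviation "T \<equiv> mop q"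
abbreviation "R \<equiv> mop qR"
abbreviation "H \<equiv> mop qH"
abbreviation "Nop \<equiv> Vsum qR"

lemma T_split: "T f i t = H f i t + R f i t"
proof -
  have "q = (\<lambda>i j. qH i j + qR i j)" by (auto simp: qR_def qH_def fun_eq_iff)
  then show ?thesis using mop_add_matrix[of qH qR f i t] by simp
qed

lemma H_eq: "H f i t = q i r * conv_fun (F i r) (f r) t"
  unfolding mop_def by (subst nn_integral_count_space_single[of r]) (auto simp: qH_def)

lemma R_eq_0: "(\<And>j t. j \<noteq> r \<Longrightarrow> f j t = 0) \<Longrightarrow> R f i t = 0"
  by (auto simp: mop_def qR_def conv_fun_def nn_integral_0_iff_AE intro!: AE_I2)

text \<open>\<open>H f\<close> depends on \<open>f r\<close> only, so the kernel of a cycle acts on single functions.\<close>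

lemma ex_cycle_law:
  "\<exists>G. sets G = sets borel \<and> (\<forall>h\<in>borel_measurable borel. \<forall>t. conv_fun G h t = Nop (H (\<lambda>_. h)) r t)"
proof -
  \<comment> \<open>Convolution evaluates at \<open>t - x\<close>; with the reflected function and
    \<open>t = 0\<close> it becomes the plain integral of \<open>f\<close>.\<close>
  define \<Lambda> where "\<Lambda> f = Nop (H (\<lambda>_ s. f (- s))) r 0" for f
  have m: "meas_fam (\<lambda>_ s. f (- s))" if [measurable]: "f \<in> borel_measurable borel"
    for f :: "real \<Rightarrow> ennreal"
    by (simp add: meas_fam_def)
  obtain G where G: "sets G = sets borel"
    "\<And>f. f \<in> borel_measurable borel \<Longrightarrow> (\<integral>\<^sup>+x. f x \<partial>G) = \<Lambda> f"
  proof (rule functional_measure)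
    show "\<Lambda> (\<lambda>x. f x + g x) = \<Lambda> f + \<Lambda> g"
      if "f \<in> borel_measurable borel" "g \<in> borel_measurable borel" for f g
    proof -
      have "H (\<lambda>_ s. f (- s) + g (- s)) = (\<lambda>i t. H (\<lambda>_ s. f (- s)) i t + H (\<lambda>_ s. g (- s)) i t)"
        by (intro ext mop_add m that)
      then show ?thesis unfolding \<Lambda>_def by (simp only:) (intro Vsum_add meas_fam_mop m that)
    qed
    show "\<Lambda> (\<lambda>x. c * f x) = c * \<Lambda> f" if "f \<in> borel_measurable borel" for f c
    proof -
      have "H (\<lambda>_ s. c * f (- s)) = (\<lambda>i t. c * H (\<lambda>_ s. f (- s)) i t)"
        by (intro ext mop_cmult m that)
      then show ?thesis unfolding \<Lambda>_def by (simp only:) (intro Vsum_cmult meas_fam_mop m that)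
    qed
    show "\<Lambda> (\<lambda>x. SUP n. f n x) = (SUP n. \<Lambda> (f n))"
      if "\<And>n::nat. f n \<in> borel_measurable borel" "incseq f" for f
    proof -
      have inc: "incseq (\<lambda>n. f n (- t))" for t using that(2) by (auto simp: incseq_def le_fun_def)
      have "incseq (\<lambda>n. H (\<lambda>_ s. f n (- s)) j t)" for j t
        using inc by (auto simp: incseq_def intro!: mop_mono)
      moreover have "H (\<lambda>_ s. SUP n. f n (- s)) = (\<lambda>i t. SUP n. H (\<lambda>_ s. f n (- s)) i t)"
        by (intro ext mop_SUP m that inc)
      ultimately show ?thesis unfolding \<Lambda>_def
        by (simp only:) (intro Vsum_SUP meas_fam_mop m that)
    qed
  qed blast
  have "conv_fun G h t = Nop (H (\<lambda>_. h)) r t" if [measurable]: "h \<in> borel_measurable borel" for h t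
  proof -
    have "conv_fun G h t = \<Lambda> (\<lambda>x. h (t - x))" unfolding conv_fun_def by (rule G) simp
    also have "\<dots> = Nop (H (\<lambda>_ s. h (s + t))) r 0" by (simp add: \<Lambda>_def add.commute)
    also have "\<dots> = Nop (\<lambda>i s. H (\<lambda>_. h) i (s + t)) r 0" by (subst mop_shift[of qH "\<lambda>_. h"]) simp
    also have "\<dots> = Nop (H (\<lambda>_. h)) r t" by (subst Vsum_shift) simp
    finally show ?thesis .
  qed
  with G show ?thesis by blast
qed

definition G :: "real measure" where
  "G = (SOME G. sets G = sets borel \<and>
     (\<forall>h\<in>borel_measurable borel. \<forall>t. conv_fun G h t = Nop (H (\<lambda>_. h)) r t))"

lemma sets_G[measurable_cong, simp]: "sets G = sets borel"
  and conv_fun_G: "h \<in> borel_measurable borel \<Longrightarrow> conv_fun G h t = Nop (H (\<lambda>_. h)) r t"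
  using someI_ex[OF ex_cycle_law] unfolding G_def[symmetric] by auto

lemma space_G[simp]: "space G = UNIV"
  using sets_eq_imp_space_eq[OF sets_G] by simp

lemma Nop_H: "meas_fam f \<Longrightarrow> Nop (H f) r t = conv_fun G (f r) t"
  by (subst conv_fun_G) (auto simp: meas_famD H_eq[abs_def])

text \<open>Induction along the first-entrance decomposition \<open>T = H + R\<close>.\<close>

lemma partial_sums_le:
  assumes f: "meas_fam f"
  shows "(\<Sum>n\<le>m. (T ^^ n) f i t) \<le> Nop (\<lambda>j s. f j s + H (\<lambda>j s. \<Sum>n<m. (T ^^ n) f j s) j s) i t"
proof (induction m arbitrary: i t)
  case 0
  show ?case using f by (simp add: Vsum_unfold meas_fam_intros add_increasing2)
next
  case (Suc m)
  define A where "A k = (\<lambda>j s. \<Sum>n<k. (T ^^ n) f j s)" for k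
  have mA: "meas_fam (A k)" for k unfolding A_def using f by (intro meas_fam_intros)
  let ?g = "\<lambda>k j s. f j s + H (A k) j s"
  have mg: "meas_fam (?g k)" for k using f mA by (intro meas_fam_intros)
  have A_Suc: "A (Suc k) j s = f j s + T (A k) j s" for k j s
  proof -
    have "T (A k) j s = (\<Sum>n<k. (T ^^ Suc n) f j s)" for k
    proof (induction k)
      case 0 show ?case by (simp add: A_def mop_def conv_fun_def)
    next
      case (Suc k)
      have "A (Suc k) = (\<lambda>j s. A k j s + (T ^^ k) f j s)" by (simp add: A_def)
      then show ?case using Suc f mA by (simp add: mop_add meas_fam_intros)
    qed
    then show ?thesis unfolding A_def by (simp only: sum.lessThan_Suc_shift) simp
  qed
  have IH: "A (Suc m) j s \<le> Nop (?g m) j s" for j s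
    using Suc by (simp add: A_def lessThan_Suc_atMost)
  have "A (Suc (Suc m)) i t = ?g (Suc m) i t + R (A (Suc m)) i t"
    by (simp only: A_Suc[of "Suc m"] T_split add.assoc)
  also have "\<dots> \<le> ?g (Suc m) i t + R (Nop (?g (Suc m))) i t"
  proof (intro add_left_mono mop_mono)
    fix j s
    have "Nop (?g m) j s \<le> Nop (?g (Suc m)) j s"
      by (intro Vsum_mono add_left_mono mop_mono) (simp add: A_def)
    with IH show "A (Suc m) j s \<le> Nop (?g (Suc m)) j s" by (rule order_trans)
  qed
  also have "\<dots> = Nop (?g (Suc m)) i t" using mg by (rule Vsum_unfold[symmetric])
  finally show ?case by (simp add: A_def lessThan_Suc_atMost[symmetric])
qed

text \<open>
  Iteration: \<open>w\<^sub>m\<^sub>+\<^sub>1 \<le> b + G * w\<^sub>m\<close> gives \<open>w \<le> \<Sum>\<^sub>k G\<^sup>*\<^sup>k * b\<close>.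
\<close>

lemma partial_sums_le_cycles:
  assumes f: "meas_fam f" and G: "sigma_finite_measure G"
  shows "(\<Sum>n<m. (T ^^ n) f r t) \<le> (\<Sum>k<m. (conv_fun G ^^ k) (Nop f r) t)"
proof (induction m arbitrary: t)
  case (Suc m)
  define w where "w t = (\<Sum>n<m. (T ^^ n) f r t)" for t
  define b where "b = Nop f r"
  have b[measurable]: "b \<in> borel_measurable borel" unfolding b_def by (intro meas_famD meas_fam_Vsum f)
  have mf: "meas_fam (\<lambda>j s. \<Sum>n<m. (T ^^ n) f j s)" using f by (intro meas_fam_intros)
  have cb: "(conv_fun G ^^ k) b \<in> borel_measurable borel" for k
    by (rule measurable_conv_fun_pow[OF sets_G G b])
  have sum_conv: "conv_fun G (\<lambda>t. \<Sum>k<n. (conv_fun G ^^ k) b t) t = (\<Sum>k<n. (conv_fun G ^^ Suc k) b t)" for n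
    using cb unfolding conv_fun_def by (subst nn_integral_sum) (auto simp: conv_fun_def)
  have "(\<Sum>n<Suc m. (T ^^ n) f r t) \<le> Nop (\<lambda>j s. f j s + H (\<lambda>j s. \<Sum>n<m. (T ^^ n) f j s) j s) r t"
    using partial_sums_le[OF f] by (simp only: lessThan_Suc_atMost)
  also have "\<dots> = b t + conv_fun G w t"
    using f mf by (subst Vsum_add) (auto simp: b_def w_def[abs_def] Nop_H meas_fam_intros)
  also have "\<dots> \<le> b t + conv_fun G (\<lambda>t. \<Sum>k<m. (conv_fun G ^^ k) b t) t"
    using Suc by (intro add_left_mono conv_fun_mono) (simp add: w_def b_def)
  also have "\<dots> = (\<Sum>k<Suc m. (conv_fun G ^^ k) b t)"
    unfolding sum_conv by (simp only: sum.lessThan_Suc_shift) simp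
  finally show ?case by (simp add: b_def)
qed simp

lemma Vsum_le_cycles:
  assumes "meas_fam f" "sigma_finite_measure G"
  shows "Vsum q f r t \<le> (\<Sum>k. (conv_fun G ^^ k) (Nop f r) t)"
  unfolding Vsum_def[of q]
proof (rule suminf_le_const)
  fix n
  have "(\<Sum>k<n. (conv_fun G ^^ k) (Nop f r) t) \<le> (\<Sum>k. (conv_fun G ^^ k) (Nop f r) t)"
    by (rule sum_le_suminf) auto
  with partial_sums_le_cycles[OF assms] show "(\<Sum>i<n. (T ^^ i) f r t) \<le> (\<Sum>k. (conv_fun G ^^ k) (Nop f r) t)"
    by (rule order_trans)
qed simp

text \<open>Lets \<open>U\<close> act on each \<open>f j\<close> before \<open>N\<close> sums over
  the cycle. Bounds on \<open>U\<close> that are linear in the size of \<open>f j\<close>, with a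
  constant common to all states, then only cost the weights \<open>u\<close>.\<close>

lemma Nop_conv_fun_sum:
  assumes f: "meas_fam f" and G: "sigma_finite_measure G"
  shows "Nop (\<lambda>j t. \<Sum>k. (conv_fun G ^^ k) (f j) t) i t = (\<Sum>k. (conv_fun G ^^ k) (Nop f i) t)"
proof -
  have m: "meas_fam (\<lambda>j. (conv_fun G ^^ k) (f j))" for k
    using f G by (auto simp: meas_fam_def intro!: measurable_conv_fun_pow)
  have c: "(conv_fun G ^^ k) (Nop f i) t = (\<Sum>n. (conv_fun G ^^ k) ((R ^^ n) f i) t)" for k t
  proof (induction k arbitrary: t)
    case (Suc k)
    have "(conv_fun G ^^ k) ((R ^^ n) f i) \<in> borel_measurable borel" for n
      using f G by (intro measurable_conv_fun_pow meas_famD meas_fam_intros) auto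
    moreover have "(conv_fun G ^^ k) (Nop f i) = (\<lambda>t. \<Sum>n. (conv_fun G ^^ k) ((R ^^ n) f i) t)"
      by (intro ext Suc)
    ultimately show ?case by (simp add: conv_fun_suminf)
  qed (simp add: Vsum_def)
  have "Nop (\<lambda>j t. \<Sum>k. (conv_fun G ^^ k) (f j) t) i t
      = (\<Sum>n. \<Sum>k. (R ^^ n) (\<lambda>j. (conv_fun G ^^ k) (f j)) i t)"
    unfolding Vsum_def using m by (simp add: mop_pow_suminf)
  also have "\<dots> = (\<Sum>n. \<Sum>k. (conv_fun G ^^ k) ((R ^^ n) f i) t)"
    by (simp add: mop_pow_conv_fun_pow[OF sets_G G f])
  also have "\<dots> = (\<Sum>k. \<Sum>n. (conv_fun G ^^ k) ((R ^^ n) f i) t)"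
    using nn_integral_count_space_swap[of "\<lambda>n k. (conv_fun G ^^ k) ((R ^^ n) f i) t"]
    by (simp add: nn_integral_count_space_nat)
  finally show ?thesis by (simp add: c)
qed

subsection \<open>Invariance of \<open>u\<close> and mass of the cycle law\<close>

lemma subinvariant_qR: "subinvariant u qR"
  unfolding subinvariant_def
proof
  fix j
  have "(\<integral>\<^sup>+i. u i * qR i j \<partial>count_space UNIV) \<le> (\<integral>\<^sup>+i. u i * q i j \<partial>count_space UNIV)"
    by (intro nn_integral_mono mult_left_mono) (auto simp: qR_def)
  then show "(\<integral>\<^sup>+i. u i * qR i j \<partial>count_space UNIV) \<le> u j" by (simp add: u_left)
qed

text \<open>By invariance, \<open>u\<close> multiplied by the killed matrix is \<open>u\<close>
  again except at \<open>r\<close>, where it becomes 0.\<close>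

lemma weighted_split:
  "(\<integral>\<^sup>+i. u i * c i \<partial>count_space UNIV) = u r * c r + (\<integral>\<^sup>+i. u i * mat_act qR c i \<partial>count_space UNIV)"
proof -
  have "(\<integral>\<^sup>+i. u i * qR i j \<partial>count_space UNIV) = (if j = r then 0 else u j)" for j
    using u_left[of j] by (simp add: qR_def)
  then have "(\<integral>\<^sup>+i. u i * mat_act qR c i \<partial>count_space UNIV)
      = (\<integral>\<^sup>+j. (if j = r then 0 else u j) * c j \<partial>count_space UNIV)"
    by (simp add: weighted_mat_act)
  moreover have "(\<integral>\<^sup>+i. u i * c i \<partial>count_space UNIV)
     = (\<integral>\<^sup>+i. u r * c r * indicator {r} i + (if i = r then 0 else u i) * c i \<partial>count_space UNIV)"
    by (intro nn_integral_cong) auto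
  moreover have "\<dots> = (\<integral>\<^sup>+i. u r * c r * indicator {r} i \<partial>count_space UNIV)
      + (\<integral>\<^sup>+i. (if i = r then 0 else u i) * c i \<partial>count_space UNIV)"
    by (intro nn_integral_add) auto
  moreover have "(\<integral>\<^sup>+i. u r * c r * indicator {r} i \<partial>count_space UNIV) = u r * c r"
    by (subst nn_integral_cmult_indicator) auto
  ultimately show ?thesis by simp
qed

definition Nc :: "('s \<Rightarrow> ennreal) \<Rightarrow> 's \<Rightarrow> ennreal" where
  "Nc c i = (\<Sum>n. (mat_act qR ^^ n) c i)"

lemma Nop_const: "Nop (\<lambda>j t. c j) i t = Nc c i"
  by (simp add: Vsum_def Nc_def mop_pow_const)

text \<open>Repeated use of \<open>weighted_split\<close> leaves a nonnegative remainder, which is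
  dropped here. That nothing is lost needs the full mass of the cycle law and is shown in
  \<open>u_Nc_eq\<close>.\<close>

lemma u_Nc_le: "u r * Nc c r \<le> (\<integral>\<^sup>+i. u i * c i \<partial>count_space UNIV)"
proof -
  have eq: "(\<Sum>n<m. u r * (mat_act qR ^^ n) c r) + (\<integral>\<^sup>+i. u i * (mat_act qR ^^ m) c i \<partial>count_space UNIV)
      = (\<integral>\<^sup>+i. u i * c i \<partial>count_space UNIV)" for m
  proof (induction m)
    case (Suc m)
    show ?case
      unfolding Suc[symmetric] weighted_split[of "(mat_act qR ^^ m) c"] by (simp add: add.assoc)
  qed simp
  have "(\<Sum>n<m. u r * (mat_act qR ^^ n) c r) \<le> (\<integral>\<^sup>+i. u i * c i \<partial>count_space UNIV)" for m
    unfolding eq[of m, symmetric] by simp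
  then show ?thesis
    unfolding Nc_def ennreal_suminf_cmult[symmetric] by (intro suminf_le_const summableI)
qed

lemma u_Nop_lborel_le:
  assumes "meas_fam f"
  shows "u r * (\<integral>\<^sup>+t. Nop f r t \<partial>lborel) \<le> (\<integral>\<^sup>+i. u i * (\<integral>\<^sup>+t. f i t \<partial>lborel) \<partial>count_space UNIV)"
proof -
  have "(\<integral>\<^sup>+t. Nop f r t \<partial>lborel) = Nc (\<lambda>j. \<integral>\<^sup>+t. f j t \<partial>lborel) r"
    unfolding Vsum_def Nc_def
    by (subst nn_integral_suminf)
       (simp_all add: mop_pow_lborel[OF assms] meas_famD[OF meas_fam_mop_pow[OF assms]])
  then show ?thesis using u_Nc_le by simp
qed

lemma Nc_finite: "(\<integral>\<^sup>+i. u i * c i \<partial>count_space UNIV) < \<infinity> \<Longrightarrow> Nc c r < \<infinity>"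
proof (rule ccontr)
  assume fin: "(\<integral>\<^sup>+i. u i * c i \<partial>count_space UNIV) < \<infinity>" and "\<not> Nc c r < \<infinity>"
  then have "u r * Nc c r = \<infinity>"
    using u_pos[of r] by (simp add: less_top[symmetric] ennreal_mult_eq_top_iff)
  moreover have "u r * Nc c r < \<infinity>" by (rule le_less_trans[OF u_Nc_le fin])
  ultimately show False by simp
qed

text \<open>Dominated convergence over the time within a cycle, with majorant
  \<open>(mat_act qR ^^ n) c r\<close>; its sum over \<open>n\<close> is \<open>Nc c r\<close>,
  which is finite by the hypothesis on the weighted sum of \<open>c\<close>.\<close>

lemma Nop_bounded_vanishing:
  assumes f: "meas_fam f" "\<And>j t. f j t \<le> c j" "(\<integral>\<^sup>+i. u i * c i \<partial>count_space UNIV) < \<infinity>"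
    "\<And>j. (f j \<longlongrightarrow> 0) at_bot"
  shows "bounded_vanishing (Nop f r)"
  unfolding bounded_vanishing_def
proof
  have "Nop f r t \<le> Nc c r" for t
    using Vsum_mono[of f "\<lambda>j _. c j" qR r t] f(2) by (simp add: Nop_const)
  then show "\<exists>C<\<infinity>. \<forall>t. Nop f r t \<le> C" using Nc_finite[OF f(3)] by blast
  have "((\<lambda>t. \<integral>\<^sup>+n. (R ^^ n) f r t \<partial>count_space UNIV) \<longlongrightarrow> 0) at_bot"
  proof (rule nn_integral_tendsto_at_bot[where w = "\<lambda>n. (mat_act qR ^^ n) c r"])
    show "(\<integral>\<^sup>+n. (mat_act qR ^^ n) c r \<partial>count_space UNIV) < \<infinity>"
      using Nc_finite[OF f(3)] by (simp add: nn_integral_count_space_nat Nc_def)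
    show "((\<lambda>t. (R ^^ n) f r t) \<longlongrightarrow> 0) at_bot" for n
      using mop_pow_tendsto_0[OF subinvariant_qR u_pos f] .
  qed (simp_all add: mop_pow_bound[OF f(2)])
  then show "(Nop f r \<longlongrightarrow> 0) at_bot"
    by (simp add: nn_integral_count_space_nat Vsum_def[abs_def])
qed

text \<open>A cycle meets \<open>r\<close> only at its start; the return already belongs to the next
  cycle.\<close>

lemma Nc_indicator_root: "Nc (indicator {r}) r = 1"
proof -
  have "R (\<lambda>j t. indicator {r} j) = (\<lambda>i t. 0)"
    by (intro ext R_eq_0) auto
  then have "Nop (\<lambda>j t. indicator {r} j) r 0 = 1 + Nop (\<lambda>i t. 0) r 0"
    by (subst Vsum_unfold_right) simp
  also have "Nop (\<lambda>i t. 0) r 0 = 0" by (rule Vsum_zero)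
  finally show ?thesis by (simp add: Nop_const)
qed

text \<open>Telescoping of \<open>v = H v + R v\<close>: the part that has entered \<open>r\<close>
  within \<open>n\<close> steps, plus the part that still avoids it.\<close>

lemma R_pow_v: "(\<Sum>k<n. (R ^^ k) (H (\<lambda>j _. v j)) i t) + (mat_act qR ^^ n) v i = v i"
proof (induction n)
  case (Suc n)
  have "v i = H (\<lambda>j _. v j) i t + R (\<lambda>j _. v j) i t" for i t
    unfolding T_split[symmetric] by (simp add: mop_const v_right)
  then have "(\<lambda>i t. v i) = (\<lambda>i t. H (\<lambda>j _. v j) i t + R (\<lambda>j _. v j) i t)"
    by (intro ext)
  then have "(R ^^ n) (\<lambda>i t. v i) i t = (R ^^ n) (H (\<lambda>j _. v j)) i t + (R ^^ n) (R (\<lambda>j _. v j)) i t"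
    using mop_pow_add[of "H (\<lambda>j _. v j)" "R (\<lambda>j _. v j)" n qR] by (simp add: meas_fam_intros)
  then have "(mat_act qR ^^ n) v i = (R ^^ n) (H (\<lambda>j _. v j)) i t + (mat_act qR ^^ Suc n) v i"
    by (simp add: mop_pow_const mop_const funpow_swap1)
  with Suc show ?case by (simp add: add.assoc)
qed simp

lemma cycle_mass_v: "Nop (H (\<lambda>j _. v j)) r t = v r * emeasure G UNIV"
proof -
  have "Nop (H (\<lambda>j _. v j)) r t = conv_fun G (\<lambda>_. v r) t" by (rule Nop_H) (rule meas_fam_const)
  then show ?thesis by (simp add: conv_fun_const)
qed

lemma emeasure_G_le: "emeasure G UNIV \<le> 1"
proof -
  have "(\<Sum>k<n. (R ^^ k) (H (\<lambda>j _. v j)) r 0) \<le> v r" for n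
    unfolding R_pow_v[where n = n and i = r and t = 0, symmetric] by simp
  then have "v r * emeasure G UNIV \<le> v r * 1"
    unfolding cycle_mass_v[of 0, symmetric] Vsum_def by (simp add: suminf_le_const)
  then show ?thesis
    using v_pos[of r] v_fin[of r] by (subst (asm) ennreal_mult_le_mult_iff) auto
qed

lemma finite_measure_G: "finite_measure G"
proof
  show "emeasure G (space G) \<noteq> \<infinity>" using emeasure_G_le by (auto simp: top_unique)
qed

lemma sigma_finite_G: "sigma_finite_measure G"
  using finite_measure_G by (rule finite_measure.axioms)

text \<open>With mass \<open>g < 1\<close> the total weight of all returns to \<open>r\<close> would
  be at most a geometric series, which contradicts \<open>recurrent\<close>.\<close>

lemma emeasure_G: "emeasure G UNIV = 1"
proof (rule antisym[OF emeasure_G_le], rule ccontr)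
  assume "\<not> 1 \<le> emeasure G UNIV"
  then obtain g where g: "emeasure G UNIV = ennreal g" "0 \<le> g" "g < 1"
    by (cases "emeasure G UNIV") (auto simp: not_le)
  have "(conv_fun G ^^ k) (\<lambda>_. 1) = (\<lambda>_. ennreal (g ^ k))" for k
  proof (induction k)
    case (Suc k)
    then have "(conv_fun G ^^ Suc k) (\<lambda>_. 1) = conv_fun G (\<lambda>_. ennreal (g ^ k))" by simp
    also have "\<dots> = (\<lambda>_. ennreal (g ^ Suc k))"
      using g by (intro ext) (simp add: conv_fun_const ennreal_mult[symmetric] mult.commute)
    finally show ?case .
  qed simp
  moreover have "Nop (\<lambda>j t. indicator {r} j) r = (\<lambda>_. 1)"
    by (simp add: fun_eq_iff Nop_const Nc_indicator_root)
  ultimately have "Vsum q (\<lambda>j t. indicator {r} j) r 0 \<le> (\<Sum>k. ennreal (g ^ k))"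
    using Vsum_le_cycles[of "\<lambda>j t. indicator {r} j" 0] by (simp add: sigma_finite_G meas_fam_const)
  also have "\<dots> = ennreal (\<Sum>k. g ^ k)" using g by (intro suminf_ennreal2) (auto intro: summable_geometric)
  also have "\<dots> < \<infinity>" by simp
  finally show False using recurrent by (simp add: Vsum_def mop_pow_const)
qed

lemma real_distribution_G: "real_distribution G"
proof -
  interpret prob_space G by standard (simp add: emeasure_G)
  show ?thesis by standard simp
qed

end

section \<open>Certain return to the root and uniqueness of the invariant row vector\<close>

lemma ennreal_add_left_imp_eq:
  fixes a b x :: ennreal
  assumes "x + a = x + b" "x < \<infinity>" shows "a = b"
  using assms by (simp add: ennreal_add_left_cancel less_top[symmetric])

lemma ennreal_add_right_imp_eq:
  fixes a b x :: ennreal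
  assumes "a + x = b + x" "x < \<infinity>" shows "a = b"
  using ennreal_add_left_imp_eq[of x a b] assms by (simp add: add.commute)

lemma mat_act_cmult: "mat_act q (\<lambda>j. c * f j) i = c * mat_act q f i"
  by (simp add: mat_act_def nn_integral_cmult mult.left_commute)

lemma mat_act_pow_cmult: "(mat_act q ^^ n) (\<lambda>j. c * f j) i = c * (mat_act q ^^ n) f i"
proof (induction n arbitrary: i)
  case (Suc n)
  then have "(mat_act q ^^ n) (\<lambda>j. c * f j) = (\<lambda>i. c * (mat_act q ^^ n) f i)" by (intro ext)
  then show ?case by (simp add: mat_act_cmult)
qed simp

lemma mat_act_pow_mono: "(\<And>j. f j \<le> g j) \<Longrightarrow> (mat_act q ^^ n) f i \<le> (mat_act q ^^ n) g i"
  by (induction n arbitrary: i) (auto intro: mat_act_mono)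

lemma mat_act_pow_kernel:
  fixes q :: "'s::countable \<Rightarrow> 's \<Rightarrow> ennreal"
  shows "(mat_act q ^^ n) c i = (\<integral>\<^sup>+j. (mat_act q ^^ n) (indicator {j}) i * c j \<partial>count_space UNIV)"
proof (induction n arbitrary: i)
  case 0
  have "(\<integral>\<^sup>+j. indicator {j} i * c j \<partial>count_space UNIV) = indicator {i} i * c i"
    by (rule nn_integral_count_space_single) simp
  then show ?case by simp
next
  case (Suc n)
  then have "(mat_act q ^^ n) c = (\<lambda>i. \<integral>\<^sup>+j. (mat_act q ^^ n) (indicator {j}) i * c j \<partial>count_space UNIV)"
    by (intro ext)
  then have "(mat_act q ^^ Suc n) c i =
     (\<integral>\<^sup>+k. \<integral>\<^sup>+j. q i k * ((mat_act q ^^ n) (indicator {j}) k * c j) \<partial>count_space UNIV \<partial>count_space UNIV)"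
    by (simp add: mat_act_def nn_integral_cmult)
  also have "\<dots> = (\<integral>\<^sup>+j. (mat_act q ^^ Suc n) (indicator {j}) i * c j \<partial>count_space UNIV)"
    by (subst nn_integral_count_space_swap) (simp add: mat_act_def nn_integral_multc mult.assoc[symmetric])
  finally show ?case .
qed

context markov_renewal
begin

lemma q_fin: "q i j < \<infinity>"
proof (rule ccontr)
  assume "\<not> q i j < \<infinity>"
  then have "q i j * v j = \<infinity>" using v_pos[of j] by (simp add: less_top[symmetric] ennreal_mult_eq_top_iff)
  moreover have "q i j * v j \<le> v i" using mat_act_upper[of q i j v] by (simp add: v_right)
  ultimately show False using v_fin[of i] by (simp add: top_unique)
qed

lemma qR_le: "qR i j \<le> q i j" by (simp add: qR_def)

text \<open>Positive weight leads from \<open>r\<close> to \<open>j\<close> in some number of steps,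
  so a nonzero value at \<open>j\<close> would make the harmonic value at \<open>r\<close>
  positive.\<close>

lemma harmonic_zero:
  assumes "\<And>i. mat_act q h i = h i" "h r = 0" shows "h j = 0"
proof -
  have h: "(mat_act q ^^ n) h = h" for n
    by (induction n) (simp_all add: fun_eq_iff[of "mat_act q h"] assms(1))
  obtain n where n: "0 < (mat_act q ^^ n) (indicator {j}) r" using irreducible by blast
  have "h j * (mat_act q ^^ n) (indicator {j}) r \<le> (mat_act q ^^ n) h r"
    unfolding mat_act_pow_cmult[symmetric] by (rule mat_act_pow_mono) (auto simp: indicator_def)
  also have "\<dots> = 0" by (simp add: h assms(2))
  finally have "h j = 0 \<or> (mat_act q ^^ n) (indicator {j}) r = 0" by simp
  then show ?thesis using less_imp_neq[OF n] by (elim disjE) (assumption, metis)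
qed

text \<open>The chain hits \<open>r\<close> almost surely from every state: the limit below is harmonic and vanishes at \<open>r\<close>.\<close>

lemma R_pow_v_tendsto_0: "(\<lambda>n. (mat_act qR ^^ n) v i) \<longlonglongrightarrow> 0"
proof -
  define a where "a n = (mat_act qR ^^ n) v" for n
  have a0: "a 0 = v" and aS: "a (Suc n) = mat_act qR (a n)" for n by (simp_all add: a_def)
  have dec: "a (Suc n) i \<le> a n i" for n i
  proof (induction n arbitrary: i)
    case 0
    have "mat_act qR v i \<le> mat_act q v i"
      unfolding mat_act_def by (intro nn_integral_mono mult_right_mono qR_le) simp
    then show ?case by (simp add: a0 aS v_right)
  next
    case (Suc n) then show ?case by (simp only: aS[of "Suc n"] aS[of n]) (rule mat_act_mono)
  qed
  have le_v: "a n i \<le> v i" for n i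
  proof (induction n)
    case (Suc n) show ?case by (rule order_trans[OF dec Suc])
  qed (simp add: a0)
  define h where "h i = (INF n. a n i)" for i
  have lim: "(\<lambda>n. a n i) \<longlonglongrightarrow> h i" for i
    unfolding h_def using dec by (intro LIMSEQ_INF) (auto intro: decseq_SucI)
  have Rh: "mat_act qR h i = h i" for i
  proof -
    have "(\<lambda>n. mat_act qR (a n) i) \<longlonglongrightarrow> mat_act qR h i"
      unfolding mat_act_def
    proof (rule nn_integral_dominated_convergence[where w = "\<lambda>j. q i j * v j"])
      show "(\<integral>\<^sup>+j. q i j * v j \<partial>count_space UNIV) < \<infinity>"
        using v_right[of i] v_fin[of i] by (simp add: mat_act_def)
      show "AE j in count_space UNIV. (\<lambda>n. qR i j * a n j) \<longlonglongrightarrow> qR i j * h j"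
        using lim q_fin by (intro AE_I2 ennreal_tendsto_cmult le_less_trans[OF qR_le]) auto
    qed (auto intro!: AE_I2 mult_mono qR_le le_v)
    moreover have "(\<lambda>n. mat_act qR (a n) i) \<longlonglongrightarrow> h i"
      using LIMSEQ_Suc[OF lim[of i]] by (simp add: aS)
    ultimately show ?thesis by (rule LIMSEQ_unique)
  qed
  \<comment> \<open>At the root the remaining part after \<open>n\<close> steps is the tail of a
    series with sum \<open>v r\<close>; the sum has this value because the cycle law has mass
    1.\<close>
  have "h r = 0"
  proof -
    let ?f = "\<lambda>k. (R ^^ k) (H (\<lambda>j _. v j)) r 0"
    have tot: "(\<Sum>k. ?f k) = v r"
      using cycle_mass_v[of 0] emeasure_G by (simp add: Vsum_def)
    have "a n r = (\<Sum>k. ?f (k + n))" for n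
    proof -
      have fin: "(\<Sum>k<n. ?f k) < \<infinity>"
      proof (rule le_less_trans[OF _ v_fin[of r]])
        show "(\<Sum>k<n. ?f k) \<le> v r"
          unfolding R_pow_v[where n = n and i = r and t = 0, symmetric] by (rule add_increasing2[OF zero_le order_refl])
      qed
      have off: "(\<Sum>k. ?f k) = (\<Sum>k. ?f (k + n)) + (\<Sum>k<n. ?f k)"
        by (rule suminf_offset) (rule summableI)
      have "(\<Sum>k<n. ?f k) + a n r = v r" unfolding a_def by (rule R_pow_v)
      also have "\<dots> = (\<Sum>k<n. ?f k) + (\<Sum>k. ?f (k + n))"
        using tot off by (simp only: add.commute)
      finally show ?thesis by (rule ennreal_add_left_imp_eq) (rule fin)
    qed
    moreover have "(\<lambda>n. \<Sum>k. ?f (k + n)) \<longlonglongrightarrow> 0"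
      by (rule ennreal_suminf_tail_tendsto_0) (use tot v_fin in simp)
    ultimately have "(\<lambda>n. a n r) \<longlonglongrightarrow> 0" by simp
    with lim[of r] show ?thesis by (rule LIMSEQ_unique)
  qed
  \<comment> \<open>Killing removes only the value at \<open>r\<close>, which is 0; hence
    \<open>h\<close> is harmonic for the full matrix too.\<close>
  have "mat_act q h i = mat_act qR h i" for i
    unfolding mat_act_def by (intro nn_integral_cong) (auto simp: qR_def \<open>h r = 0\<close>)
  then have "mat_act q h i = h i" for i by (simp add: Rh)
  then have "h i = 0" by (rule harmonic_zero[of h, OF _ \<open>h r = 0\<close>])
  with lim[of i] show ?thesis by (simp add: a_def)
qed

lemma Nc_kernel: "Nc c i = (\<integral>\<^sup>+j. Nc (indicator {j}) i * c j \<partial>count_space UNIV)"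
proof -
  have "Nc c i = (\<Sum>n. \<integral>\<^sup>+j. (mat_act qR ^^ n) (indicator {j}) i * c j \<partial>count_space UNIV)"
    unfolding Nc_def by (subst mat_act_pow_kernel) simp
  also have "\<dots> = (\<integral>\<^sup>+j. Nc (indicator {j}) i * c j \<partial>count_space UNIV)"
    unfolding Nc_def by (subst nn_integral_suminf[symmetric]) auto
  finally show ?thesis .
qed

text \<open>Invariance of the occupation measure of a cycle. Moving one step ahead exchanges the
  start at \<open>r\<close> for the return to \<open>r\<close>, and both have weight 1; other states
  are unaffected because the cycle does not start there.\<close>

lemma Nc_q_indicator: "Nc (mat_act q (indicator {k})) r = Nc (indicator {k}) r"
proof (cases "k = r")
  case True
  have "mat_act q (indicator {r}) = mat_act qH (indicator {r})"
    unfolding mat_act_def by (intro ext nn_integral_cong) (auto simp: qH_def)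
  then have "Nc (mat_act q (indicator {k})) r = Nop (H (\<lambda>j _. indicator {r} j)) r 0"
    by (simp only: True mop_const Nop_const)
  also have "\<dots> = 1" by (subst Nop_H) (simp_all add: meas_fam_const conv_fun_const emeasure_G)
  finally show ?thesis by (simp add: True Nc_indicator_root)
next
  case False
  have "mat_act q (indicator {k}) = mat_act qR (indicator {k})"
    unfolding mat_act_def using False by (intro ext nn_integral_cong) (auto simp: qR_def indicator_def)
  then show ?thesis
    using Vsum_unfold_right[of qR "\<lambda>j _. indicator {k} j" r 0] False by (simp add: mop_const Nop_const)
qed

text \<open>
  \<open>u r * Nc (indicator {j}) r\<close> is another \<open>q\<close>-invariant row vector, dominated by \<open>u\<close> and equal to it at
  \<open>r\<close>; the difference is invariant as well, hence zero by irreducibility.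
\<close>

lemma u_Nc_eq: "u r * Nc c r = (\<integral>\<^sup>+i. u i * c i \<partial>count_space UNIV)"
proof -
  define l where "l j = u r * Nc (indicator {j}) r" for j
  define w where "w j = u j - l j" for j
  have lu: "l j \<le> u j" for j
  proof -
    have "(\<integral>\<^sup>+i. u i * indicator {j} i \<partial>count_space UNIV) = u j"
      by (subst nn_integral_count_space_single[of j]) auto
    then show ?thesis using u_Nc_le[of "indicator {j}"] by (simp add: l_def)
  qed
  have lw: "u j = l j + w j" for j
    unfolding w_def using lu[of j] by (simp add: add_diff_inverse_ennreal)
  have lfin: "l j < \<infinity>" for j using lu[of j] u_fin[of j] by (rule le_less_trans)
  have u_Nc: "u r * Nc c r = (\<integral>\<^sup>+j. l j * c j \<partial>count_space UNIV)" for c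
    unfolding l_def by (subst Nc_kernel) (simp add: nn_integral_cmult[symmetric] mult.assoc)
  have linv: "(\<integral>\<^sup>+j. l j * q j k \<partial>count_space UNIV) = l k" for k
  proof -
    have "(\<lambda>j. q j k) = mat_act q (indicator {k})"
    proof
      fix j
      show "q j k = mat_act q (indicator {k}) j"
        unfolding mat_act_def by (subst nn_integral_count_space_single[of k]) auto
    qed
    then show ?thesis using u_Nc[of "\<lambda>j. q j k"] Nc_q_indicator[of k] by (simp add: l_def)
  qed
  have winv: "(\<integral>\<^sup>+j. w j * q j k \<partial>count_space UNIV) = w k" for k
  proof -
    have "l k + w k = (\<integral>\<^sup>+j. (l j + w j) * q j k \<partial>count_space UNIV)"
      using u_left[of k] by (simp add: lw[symmetric])
    also have "\<dots> = l k + (\<integral>\<^sup>+j. w j * q j k \<partial>count_space UNIV)"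
      by (simp add: distrib_right nn_integral_add linv)
    finally show ?thesis using lfin[of k] by (simp add: less_top[symmetric])
  qed
  have wpow: "(\<integral>\<^sup>+i. w i * (mat_act q ^^ n) c i \<partial>count_space UNIV) = (\<integral>\<^sup>+i. w i * c i \<partial>count_space UNIV)" for n c
    by (induction n) (simp_all add: weighted_mat_act winv)
  have wr: "w r = 0"
    using u_fin[of r] by (simp add: w_def l_def Nc_indicator_root ennreal_diff_self less_top)
  have "w i = 0" for i
  proof -
    obtain n where n: "0 < (mat_act q ^^ n) (indicator {r}) i" using irreducible by blast
    have "w i * (mat_act q ^^ n) (indicator {r}) i \<le> (\<integral>\<^sup>+i. w i * (mat_act q ^^ n) (indicator {r}) i \<partial>count_space UNIV)"
      by (rule nn_integral_count_space_upper)
    also have "\<dots> = (\<integral>\<^sup>+i. w i * indicator {r} i \<partial>count_space UNIV)" by (rule wpow)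
    also have "\<dots> = 0" by (subst nn_integral_count_space_single[of r]) (auto simp: wr)
    finally have "w i = 0 \<or> (mat_act q ^^ n) (indicator {r}) i = 0" by simp
    then show ?thesis using less_imp_neq[OF n] by (elim disjE) (assumption, metis)
  qed
  then have "u j = l j" for j using lw[of j] by simp
  then show ?thesis unfolding u_Nc by simp
qed

subsection \<open>Iterating sub- and superharmonicity up to the hitting time of \<open>r\<close>\<close>

lemma R_pow_T:
  assumes "meas_fam f"
  shows "(R ^^ n) (T f) i t = (R ^^ n) (H f) i t + (R ^^ Suc n) f i t"
proof -
  have "T f = (\<lambda>i t. H f i t + R f i t)" by (intro ext T_split)
  then have "(R ^^ n) (T f) i t = (R ^^ n) (H f) i t + (R ^^ n) (R f) i t"
    using mop_pow_add[of "H f" "R f" n qR] assms by (simp add: meas_fam_mop)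
  then show ?thesis by (simp add: funpow_swap1)
qed

lemma subharmonic_iterate:
  assumes "meas_fam f" "meas_fam c" "\<And>j t. f j t \<le> T f j t + c j t"
  shows "f i t \<le> (\<Sum>k<n. (R ^^ k) (\<lambda>j t. H f j t + c j t) i t) + (R ^^ n) f i t"
proof (induction n)
  case (Suc n)
  have "(R ^^ n) f i t \<le> (R ^^ n) (\<lambda>j t. T f j t + c j t) i t"
    by (rule mop_pow_mono) (rule assms(3))
  also have "\<dots> = (R ^^ n) (\<lambda>j t. H f j t + c j t) i t + (R ^^ Suc n) f i t"
    using assms(1,2) by (simp add: mop_pow_add meas_fam_mop R_pow_T add_ac)
  finally have "(\<Sum>k<n. (R ^^ k) (\<lambda>j t. H f j t + c j t) i t) + (R ^^ n) f i t
     \<le> (\<Sum>k<n. (R ^^ k) (\<lambda>j t. H f j t + c j t) i t) + ((R ^^ n) (\<lambda>j t. H f j t + c j t) i t + (R ^^ Suc n) f i t)"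
    by (rule add_left_mono)
  with Suc have "f i t \<le> (\<Sum>k<n. (R ^^ k) (\<lambda>j t. H f j t + c j t) i t) + ((R ^^ n) (\<lambda>j t. H f j t + c j t) i t + (R ^^ Suc n) f i t)"
    by (rule order_trans)
  then show ?case by (simp only: sum.lessThan_Suc add.assoc)
qed simp

text \<open>What has not yet entered \<open>r\<close> after \<open>n\<close> steps is at most
  \<open>K\<close> times \<open>(mat_act qR ^^ n) v\<close>, which tends to 0. The source term
  \<open>c\<close> is \<open>mean_neg\<close> in the drift estimate and 0 in the uniqueness
  proof.\<close>

lemma subharmonic_le_Nop:
  assumes "meas_fam f" "meas_fam c" "\<And>j t. f j t \<le> T f j t + c j t"
    and "\<And>j t. f j t \<le> K * v j" "K < \<infinity>"
  shows "f i t \<le> Nop (\<lambda>j t. H f j t + c j t) i t"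
proof -
  let ?g = "\<lambda>j t. H f j t + c j t"
  have "f i t \<le> Nop ?g i t + K * (mat_act qR ^^ n) v i" for n
  proof -
    have "(R ^^ n) f i t \<le> (mat_act qR ^^ n) (\<lambda>j. K * v j) i"
      by (rule mop_pow_bound) (rule assms(4))
    moreover have "(\<Sum>k<n. (R ^^ k) ?g i t) \<le> Nop ?g i t"
      unfolding Vsum_def by (rule sum_le_suminf) auto
    ultimately show ?thesis
      unfolding mat_act_pow_cmult[symmetric]
      by (intro order_trans[OF subharmonic_iterate[OF assms(1-3), of i t n]] add_mono)
  qed
  moreover have "(\<lambda>n. Nop ?g i t + K * (mat_act qR ^^ n) v i) \<longlonglongrightarrow> Nop ?g i t + K * 0"
    using assms(5) by (intro tendsto_add tendsto_const ennreal_tendsto_cmult R_pow_v_tendsto_0) simp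
  ultimately show ?thesis by (intro LIMSEQ_le_const[of _ "Nop ?g i t"]) auto
qed

subsection \<open>Drift of the cycle law\<close>

text \<open>The numbers \<open>q i j * v j / v i\<close> form a stochastic matrix; up to the factor
  \<open>v i\<close> this is the mean of \<open>g\<close> at one increment of the resulting
  chain.\<close>

definition v_avg :: "(real \<Rightarrow> ennreal) \<Rightarrow> 's \<Rightarrow> ennreal" where
  "v_avg g i = (\<integral>\<^sup>+j. q i j * v j * (\<integral>\<^sup>+x. g x \<partial>F i j) \<partial>count_space UNIV)"

lemma v_avg_mono: "(\<And>x. f x \<le> g x) \<Longrightarrow> v_avg f i \<le> v_avg g i"
  unfolding v_avg_def by (intro nn_integral_mono mult_left_mono) auto

lemma v_avg_add:
  assumes [measurable]: "f \<in> borel_measurable borel" "g \<in> borel_measurable borel"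
  shows "v_avg (\<lambda>x. f x + g x) i = v_avg f i + v_avg g i"
  unfolding v_avg_def by (simp add: nn_integral_add distrib_left)

lemma v_avg_const: "v_avg (\<lambda>_. c) i = v i * c"
proof -
  have "v_avg (\<lambda>_. c) i = (\<integral>\<^sup>+j. q i j * v j * c \<partial>count_space UNIV)" by (simp add: v_avg_def)
  also have "\<dots> = v i * c" using v_right[of i] by (simp add: nn_integral_multc mat_act_def)
  finally show ?thesis .
qed

lemma T_v_avg:
  assumes [measurable]: "\<phi> \<in> borel_measurable borel"
  shows "T (\<lambda>j t. v j * \<phi> t) i t = v_avg (\<lambda>x. \<phi> (t - x)) i"
  by (simp add: mop_def v_avg_def conv_fun_def nn_integral_cmult mult.assoc)

definition mean_pos :: "'s \<Rightarrow> ennreal" where "mean_pos = v_avg (\<lambda>x. ennreal x)"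
definition mean_neg :: "'s \<Rightarrow> ennreal" where "mean_neg = v_avg (\<lambda>x. ennreal (- x))"

text \<open>Positive and negative part of the position, weighted by \<open>v\<close>. Positions are
  \<open>t\<close> minus the sum of the increments, so from \<open>t = 0\<close> the function
  \<open>Pf\<close> measures the negative part of that sum and \<open>Mf\<close> the positive part.
  The truncation \<open>MKf\<close> is at most a multiple of \<open>v\<close>, as
  \<open>subharmonic_le_Nop\<close> demands.\<close>

definition Pf :: "'s \<Rightarrow> real \<Rightarrow> ennreal" where "Pf j t = v j * ennreal t"
definition Mf :: "'s \<Rightarrow> real \<Rightarrow> ennreal" where "Mf j t = v j * ennreal (- t)"
definition MKf :: "nat \<Rightarrow> 's \<Rightarrow> real \<Rightarrow> ennreal" where "MKf K j t = v j * min (ennreal (- t)) (of_nat K)"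

lemma meas_fam_Pf: "meas_fam Pf" and meas_fam_Mf: "meas_fam Mf" and meas_fam_MKf: "meas_fam (MKf K)"
  unfolding meas_fam_def Pf_def[abs_def] Mf_def[abs_def] MKf_def[abs_def] by measurable

text \<open>Each of \<open>t - x\<close>, \<open>t\<close> and \<open>x\<close> is the difference of
  its positive and negative part; the relation between the three is arranged as an equality of sums,
  because the means may be infinite.\<close>

lemma drift_step: "T Mf i t + Pf i t + mean_neg i = T Pf i t + Mf i t + mean_pos i"
proof -
  have *: "ennreal (- (t - x)) + ennreal t + ennreal (- x) = ennreal (t - x) + ennreal (- t) + ennreal x" for x
  proof -
    have "max (- (t - x)) 0 + max t 0 + max (- x) 0 = max (t - x) 0 + max (- t) 0 + max x 0"
      by (auto simp: max_def)
    then show ?thesis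
      by (subst (1 2 3 4 5 6) ennreal_max0) (simp only: ennreal_plus[symmetric] max.cobounded2 add_nonneg_nonneg)
  qed
  have "T Mf i t + Pf i t + mean_neg i = v_avg (\<lambda>x. ennreal (- (t - x)) + ennreal t + ennreal (- x)) i"
    unfolding Mf_def[abs_def] Pf_def mean_neg_def by (subst T_v_avg) (simp_all add: v_avg_add v_avg_const)
  also have "\<dots> = v_avg (\<lambda>x. ennreal (t - x) + ennreal (- t) + ennreal x) i" by (simp only: *)
  also have "\<dots> = T Pf i t + Mf i t + mean_pos i"
    unfolding Pf_def[abs_def] Mf_def mean_pos_def by (subst T_v_avg) (simp_all add: v_avg_add v_avg_const)
  finally show ?thesis .
qed

lemma Pf_step: "T Pf i t \<le> Pf i t + mean_neg i"
proof -
  have *: "ennreal (t - x) \<le> ennreal t + ennreal (- x)" for x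
    by (subst (1 2 3) ennreal_max0) (auto simp: ennreal_plus[symmetric] max_def intro!: ennreal_leI simp del: ennreal_plus)
  have "T Pf i t = v_avg (\<lambda>x. ennreal (t - x)) i" unfolding Pf_def[abs_def] by (rule T_v_avg) simp
  also have "\<dots> \<le> v_avg (\<lambda>x. ennreal t + ennreal (- x)) i" by (rule v_avg_mono) (rule *)
  also have "\<dots> = Pf i t + mean_neg i" by (simp add: v_avg_add v_avg_const Pf_def mean_neg_def)
  finally show ?thesis .
qed

text \<open>The negative part is subadditive, and cutting at a common height preserves this
  estimate.\<close>

lemma MKf_step: "MKf K i t \<le> T (MKf K) i t + mean_neg i"
proof -
  have 1: "ennreal (- t) \<le> ennreal (- (t - x)) + ennreal (- x)" for x
    by (subst (1 2 3) ennreal_max0) (auto simp: ennreal_plus[symmetric] max_def intro!: ennreal_leI simp del: ennreal_plus)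
  have *: "min (ennreal (- t)) (of_nat K) \<le> min (ennreal (- (t - x))) (of_nat K) + ennreal (- x)" for x
  proof (cases "ennreal (- (t - x)) \<le> of_nat K")
    case True
    then show ?thesis using 1[of x] by (simp only: min_absorb1) (rule min.coboundedI1)
  next
    case False
    then have "min (ennreal (- (t - x))) (of_nat K) = of_nat K" by (simp add: min_def)
    then show ?thesis by (simp only:) (intro min.coboundedI2, simp)
  qed
  have "MKf K i t = v_avg (\<lambda>x. min (ennreal (- t)) (of_nat K)) i" by (simp add: v_avg_const MKf_def)
  also have "\<dots> \<le> v_avg (\<lambda>x. min (ennreal (- (t - x))) (of_nat K) + ennreal (- x)) i"
    by (rule v_avg_mono) (rule *)
  also have "\<dots> = T (MKf K) i t + mean_neg i"
    unfolding MKf_def[abs_def] mean_neg_def by (subst T_v_avg) (simp_all add: v_avg_add)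
  finally show ?thesis .
qed

text \<open>For the walk stopped at the return to \<open>r\<close> or at time \<open>n\<close>, the
  position has grown at most by the negative parts of the increments made so far.\<close>

lemma Pf_iterate:
  "(\<Sum>k<n. (R ^^ k) (H Pf) i t) + (R ^^ n) Pf i t \<le> Pf i t + (\<Sum>k<n. (mat_act qR ^^ k) mean_neg i)"
proof (induction n)
  case (Suc n)
  have "(R ^^ n) (H Pf) i t + (R ^^ Suc n) Pf i t = (R ^^ n) (T Pf) i t"
    by (rule R_pow_T[symmetric]) (rule meas_fam_Pf)
  also have "\<dots> \<le> (R ^^ n) (\<lambda>j t. Pf j t + mean_neg j) i t" by (rule mop_pow_mono) (rule Pf_step)
  also have "\<dots> = (R ^^ n) Pf i t + (mat_act qR ^^ n) mean_neg i"
    by (simp add: mop_pow_add meas_fam_Pf meas_fam_const mop_pow_const)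
  finally have "(\<Sum>k<n. (R ^^ k) (H Pf) i t) + ((R ^^ n) (H Pf) i t + (R ^^ Suc n) Pf i t)
     \<le> ((\<Sum>k<n. (R ^^ k) (H Pf) i t) + (R ^^ n) Pf i t) + (mat_act qR ^^ n) mean_neg i"
    by (simp only: add.assoc add_left_mono)
  also have "\<dots> \<le> (Pf i t + (\<Sum>k<n. (mat_act qR ^^ k) mean_neg i)) + (mat_act qR ^^ n) mean_neg i"
    by (rule add_right_mono) (rule Suc)
  finally show ?case by (simp only: sum.lessThan_Suc add.assoc)
qed simp

text \<open>For fixed \<open>t\<close> the truncation at \<open>K \<ge> - t\<close> changes nothing
  on the left and only lowers the right side.\<close>

lemma Mf_le_Nop: "Mf i t \<le> Nop (\<lambda>j t. H Mf j t + mean_neg j) i t"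
proof -
  obtain K where "- t \<le> real K" using real_arch_simple by blast
  then have "ennreal (- t) \<le> of_nat K" by (simp add: ennreal_of_nat_eq_real_of_nat ennreal_leI)
  then have "Mf i t = MKf K i t" by (simp add: Mf_def MKf_def)
  also have "\<dots> \<le> Nop (\<lambda>j t. H (MKf K) j t + mean_neg j) i t"
  proof (rule subharmonic_le_Nop[where K = "of_nat K"])
    show "MKf K j t \<le> of_nat K * v j" for j t
      unfolding MKf_def by (subst mult.commute) (intro mult_right_mono, simp_all)
  qed (simp_all add: meas_fam_MKf meas_fam_const MKf_step of_nat_less_top)
  also have "\<dots> \<le> Nop (\<lambda>j t. H Mf j t + mean_neg j) i t"
    by (intro Vsum_mono add_right_mono mop_mono) (auto simp: MKf_def Mf_def intro!: mult_left_mono)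
  finally show ?thesis .
qed

text \<open>Wald's identity for the walk stopped at its return or at time \<open>n\<close>, written
  with sums only. The hypothesis serves to cancel a common term in the induction.\<close>

lemma drift_iterate:
  assumes "\<And>n. (R ^^ n) Pf r 0 < \<infinity>"
  shows "(\<Sum>k<n. (R ^^ k) (H Mf) r 0) + (R ^^ n) Mf r 0 + (\<Sum>k<n. (mat_act qR ^^ k) mean_neg r)
    = (\<Sum>k<n. (R ^^ k) (H Pf) r 0) + (R ^^ n) Pf r 0 + (\<Sum>k<n. (mat_act qR ^^ k) mean_pos r)"
proof (induction n)
  case 0 show ?case by (simp add: Pf_def Mf_def)
next
  case (Suc n)
  let ?A = "\<Sum>k<n. (R ^^ k) (H Mf) r 0" and ?B = "\<Sum>k<n. (R ^^ k) (H Pf) r 0"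
  let ?m = "\<lambda>n. (mat_act qR ^^ n) mean_neg r" and ?p = "\<lambda>n. (mat_act qR ^^ n) mean_pos r"
  have "(R ^^ n) (\<lambda>i t. T Mf i t + Pf i t + mean_neg i) r 0 = (R ^^ n) (\<lambda>i t. T Pf i t + Mf i t + mean_pos i) r 0"
    by (simp only: drift_step)
  then have step: "(R ^^ n) (T Mf) r 0 + (R ^^ n) Pf r 0 + ?m n = (R ^^ n) (T Pf) r 0 + (R ^^ n) Mf r 0 + ?p n"
    by (simp add: mop_pow_add meas_fam_Pf meas_fam_Mf meas_fam_add meas_fam_mop meas_fam_const mop_pow_const)
  \<comment> \<open>The term \<open>(R ^^ n) Pf r 0\<close> is added to both sides, so that the
    one-step identity and the induction hypothesis can be inserted; being finite, it is cancelled at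
    the end.\<close>
  have "(\<Sum>k<Suc n. (R ^^ k) (H Mf) r 0) + (R ^^ Suc n) Mf r 0 + (\<Sum>k<Suc n. ?m k) + (R ^^ n) Pf r 0
     = ?A + (\<Sum>k<n. ?m k) + ((R ^^ n) (T Mf) r 0 + (R ^^ n) Pf r 0 + ?m n)"
    by (simp add: R_pow_T meas_fam_Mf add_ac)
  also have "\<dots> = (?A + (R ^^ n) Mf r 0 + (\<Sum>k<n. ?m k)) + (R ^^ n) (T Pf) r 0 + ?p n"
    unfolding step by (simp add: add_ac)
  also have "\<dots> = (\<Sum>k<Suc n. (R ^^ k) (H Pf) r 0) + (R ^^ Suc n) Pf r 0 + (\<Sum>k<Suc n. ?p k) + (R ^^ n) Pf r 0"
    unfolding Suc by (simp add: R_pow_T meas_fam_Pf add_ac)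
  finally show ?case
    by (rule ennreal_add_right_imp_eq) (rule assms)
qed

text \<open>Passage to the limit in the stopped Wald identity; by \<open>u_Nc_eq\<close> the means
  over a cycle are the means weighted by \<open>u\<close>, up to \<open>u r\<close>. The negative
  part over a cycle has finite mean. If the positive part has infinite mean, this already suffices;
  otherwise the leftover term with \<open>Mf\<close> must be shown to vanish.\<close>

lemma positive_drift_G:
  assumes "(\<integral>\<^sup>+i. u i * mean_neg i \<partial>count_space UNIV) < (\<integral>\<^sup>+i. u i * mean_pos i \<partial>count_space UNIV)"
  shows "(\<integral>\<^sup>+x. ennreal (- x) \<partial>G) < (\<integral>\<^sup>+x. ennreal x \<partial>G)"
proof -
  have lt: "Nc mean_neg r < Nc mean_pos r"
  proof (rule ccontr)
    assume "\<not> Nc mean_neg r < Nc mean_pos r"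
    then have "u r * Nc mean_pos r \<le> u r * Nc mean_neg r" by (intro mult_left_mono) auto
    with assms show False by (simp add: u_Nc_eq)
  qed
  have Nneg: "Nc mean_neg r < \<infinity>" by (rule Nc_finite) (rule less_le_trans[OF assms], simp)
  have sums: "(\<Sum>k<n. (mat_act qR ^^ k) c r) \<le> Nc c r" for n c
    unfolding Nc_def by (rule sum_le_suminf) auto
  have P0: "(\<Sum>k<n. (R ^^ k) (H Pf) r 0) + (R ^^ n) Pf r 0 \<le> Nc mean_neg r" for n
    using order_trans[OF Pf_iterate[where n = n and i = r and t = 0]] sums[of mean_neg n] by (simp add: Pf_def[of r 0])
  have Pfin: "(R ^^ n) Pf r 0 < \<infinity>" for n
    by (rule le_less_trans[OF order_trans[OF _ P0[of n]] Nneg]) simp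
  have NP: "Nop (H Pf) r 0 = v r * (\<integral>\<^sup>+x. ennreal (- x) \<partial>G)"
    by (subst Nop_H) (auto simp: meas_fam_Pf conv_fun_def Pf_def nn_integral_cmult)
  have NM: "Nop (H Mf) r 0 = v r * (\<integral>\<^sup>+x. ennreal x \<partial>G)"
    by (subst Nop_H) (auto simp: meas_fam_Mf conv_fun_def Mf_def nn_integral_cmult)
  have NPle: "Nop (H Pf) r 0 \<le> Nc mean_neg r"
    unfolding Vsum_def
  proof (rule suminf_le_const[OF summableI])
    show "(\<Sum>k<n. (R ^^ k) (H Pf) r 0) \<le> Nc mean_neg r" for n
      by (rule order_trans[OF _ P0[of n]]) simp
  qed
  have "Nop (H Pf) r 0 < Nop (H Mf) r 0"
  proof (cases "Nop (H Mf) r 0 < \<infinity>")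
    case False
    then show ?thesis using le_less_trans[OF NPle Nneg] by (simp add: less_top[symmetric])
  next
    case True
    let ?g = "\<lambda>j t. H Mf j t + mean_neg j"
    have mg: "meas_fam ?g" by (intro meas_fam_intros meas_fam_Mf)
    have "Nop ?g r 0 = Nop (H Mf) r 0 + Nc mean_neg r"
      by (simp add: Vsum_add meas_fam_mop meas_fam_Mf meas_fam_const Nop_const)
    then have fin: "(\<Sum>k. (R ^^ k) ?g r 0) < \<infinity>"
      using True Nneg by (simp add: Vsum_def[symmetric])
    \<comment> \<open>\<open>Mf\<close> is bounded by the potential of \<open>?g\<close>, and
      \<open>R ^^ n\<close> turns a potential into the tail of its series, which converges
      here.\<close>
    have "(R ^^ n) Mf r 0 \<le> (\<Sum>k. (R ^^ (k + n)) ?g r 0)" for n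
      unfolding mop_pow_Vsum[OF mg, symmetric] by (rule mop_pow_mono) (rule Mf_le_Nop)
    then have M0: "(\<lambda>n. (R ^^ n) Mf r 0) \<longlonglongrightarrow> 0"
      by (intro tendsto_sandwich[OF _ _ tendsto_const ennreal_suminf_tail_tendsto_0[OF fin]]) auto
    have "(\<Sum>k<n. (R ^^ k) (H Pf) r 0) + (\<Sum>k<n. (mat_act qR ^^ k) mean_pos r)
       \<le> (\<Sum>k<n. (R ^^ k) (H Mf) r 0) + (R ^^ n) Mf r 0 + (\<Sum>k<n. (mat_act qR ^^ k) mean_neg r)" for n
      unfolding drift_iterate[OF Pfin] by (intro add_right_mono) simp
    moreover have "(\<lambda>n. (\<Sum>k<n. (R ^^ k) (H Pf) r 0) + (\<Sum>k<n. (mat_act qR ^^ k) mean_pos r))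
        \<longlonglongrightarrow> Nop (H Pf) r 0 + Nc mean_pos r"
      unfolding Vsum_def Nc_def by (intro tendsto_add summable_LIMSEQ) auto
    moreover have "(\<lambda>n. (\<Sum>k<n. (R ^^ k) (H Mf) r 0) + (R ^^ n) Mf r 0 + (\<Sum>k<n. (mat_act qR ^^ k) mean_neg r))
        \<longlonglongrightarrow> Nop (H Mf) r 0 + 0 + Nc mean_neg r"
      unfolding Vsum_def Nc_def by (intro tendsto_add summable_LIMSEQ M0) auto
    ultimately have le: "Nop (H Pf) r 0 + Nc mean_pos r \<le> Nop (H Mf) r 0 + 0 + Nc mean_neg r"
      by (intro LIMSEQ_le) auto
    show ?thesis
    proof (rule ccontr)
      assume "\<not> Nop (H Pf) r 0 < Nop (H Mf) r 0"
      then have "Nop (H Pf) r 0 + Nc mean_pos r \<le> Nop (H Pf) r 0 + Nc mean_neg r"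
        using order_trans[OF le add_right_mono[of "Nop (H Mf) r 0 + 0" "Nop (H Pf) r 0" "Nc mean_neg r"]]
        by (simp add: not_less)
      then have "Nc mean_pos r \<le> Nc mean_neg r"
        using le_less_trans[OF NPle Nneg]
        by (simp add: ennreal_add_left_cancel_le less_top[symmetric])
      with lt show False by simp
    qed
  qed
  then show ?thesis unfolding NP NM
    by (rule contrapos_pp) (simp add: not_less mult_left_mono)
qed

end

section \<open>Closure of boundedness and decay at -\<infinity>, and directly Riemann integrable
  functions\<close>

lemma bounded_vanishing_mono:
  assumes "bounded_vanishing g" "\<And>t. f t \<le> g t" shows "bounded_vanishing f"
proof -
  obtain C where C: "C < \<infinity>" "\<And>t. g t \<le> C" and lim: "(g \<longlongrightarrow> 0) at_bot"
    using assms(1) by (auto simp: bounded_vanishing_def)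
  have "f t \<le> C" for t using assms(2) C(2) by (rule order_trans)
  moreover have "(f \<longlongrightarrow> 0) at_bot"
    by (rule tendsto_sandwich[OF _ _ tendsto_const lim]) (auto simp: assms(2))
  ultimately show ?thesis using C(1) by (auto simp: bounded_vanishing_def)
qed

lemma bounded_vanishing_add:
  assumes "bounded_vanishing f" "bounded_vanishing g" shows "bounded_vanishing (\<lambda>t. f t + g t)"
proof -
  obtain C D where C: "C < \<infinity>" "\<And>t. f t \<le> C" and D: "D < \<infinity>" "\<And>t. g t \<le> D"
    and lim: "(f \<longlongrightarrow> 0) at_bot" "(g \<longlongrightarrow> 0) at_bot"
    using assms by (auto simp: bounded_vanishing_def)
  have "((\<lambda>t. f t + g t) \<longlongrightarrow> 0) at_bot" using tendsto_add[OF lim] by simp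
  moreover have "\<forall>t. f t + g t \<le> C + D" using C(2) D(2) by (auto intro: add_mono)
  moreover have "C + D < \<infinity>" using C(1) D(1) by (simp add: less_top[symmetric])
  ultimately show ?thesis unfolding bounded_vanishing_def by blast
qed

lemma bounded_vanishing_0: "bounded_vanishing (\<lambda>t. 0)"
  unfolding bounded_vanishing_def by (auto intro: exI[of _ 0])

lemma bounded_vanishing_sum:
  "(\<And>k. k \<in> A \<Longrightarrow> bounded_vanishing (f k)) \<Longrightarrow> bounded_vanishing (\<lambda>t. \<Sum>k\<in>A. f k t)"
  by (induction A rule: infinite_finite_induct)
     (auto intro!: bounded_vanishing_add bounded_vanishing_0)

lemma bounded_vanishing_conv_fun:
  assumes "sets M = sets borel" "emeasure M UNIV < \<infinity>" "h \<in> borel_measurable borel" "bounded_vanishing h"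
  shows "bounded_vanishing (conv_fun M h)"
proof -
  obtain C where C: "C < \<infinity>" "\<And>t. h t \<le> C" and lim: "(h \<longlongrightarrow> 0) at_bot"
    using assms(4) by (auto simp: bounded_vanishing_def)
  have "C * emeasure M UNIV < \<infinity>" using C(1) assms(2) by (simp add: ennreal_mult_less_top)
  with conv_fun_vanishing[OF assms(1-3) C(2,1) lim] show ?thesis
    unfolding bounded_vanishing_def by blast
qed

lemma conv_fun_pow_count_sum:
  fixes f :: "'k::countable \<Rightarrow> real \<Rightarrow> ennreal"
  assumes M: "sets M = sets borel" "sigma_finite_measure M" and f: "\<And>k. f k \<in> borel_measurable borel"
  shows "(conv_fun M ^^ n) (\<lambda>t. \<integral>\<^sup>+k. f k t \<partial>count_space UNIV) t = (\<integral>\<^sup>+k. (conv_fun M ^^ n) (f k) t \<partial>count_space UNIV)"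
proof (induction n arbitrary: t)
  case (Suc n)
  then have "(conv_fun M ^^ n) (\<lambda>t. \<integral>\<^sup>+k. f k t \<partial>count_space UNIV) = (\<lambda>t. \<integral>\<^sup>+k. (conv_fun M ^^ n) (f k) t \<partial>count_space UNIV)"
    by (intro ext)
  moreover have "conv_fun M (\<lambda>t. \<integral>\<^sup>+k. (conv_fun M ^^ n) (f k) t \<partial>count_space UNIV) t
      = (\<integral>\<^sup>+k. conv_fun M ((conv_fun M ^^ n) (f k)) t \<partial>count_space UNIV)"
    by (rule conv_fun_count_sum[OF M(1) measurable_conv_fun_pow[OF M f]])
  ultimately show ?case by simp
qed simp

lemma conv_fun_pow_cmult:
  assumes M: "sets M = sets borel" "sigma_finite_measure M" and f: "f \<in> borel_measurable borel"
  shows "(conv_fun M ^^ n) (\<lambda>t. c * f t) t = c * (conv_fun M ^^ n) f t"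
proof (induction n arbitrary: t)
  case (Suc n)
  then have "(conv_fun M ^^ n) (\<lambda>t. c * f t) = (\<lambda>t. c * (conv_fun M ^^ n) f t)" by (intro ext)
  then show ?case using conv_fun_cmult[OF M(1) measurable_conv_fun_pow[OF M f]] by simp
qed simp

context positive_drift_walk
begin

lemma renewal_sum_count_sum:
  fixes f :: "'k::countable \<Rightarrow> real \<Rightarrow> ennreal"
  assumes f: "\<And>k. f k \<in> borel_measurable borel"
  shows "renewal_sum (\<lambda>t. \<integral>\<^sup>+k. f k t \<partial>count_space UNIV) t = (\<integral>\<^sup>+k. renewal_sum (f k) t \<partial>count_space UNIV)"
proof -
  have "renewal_sum (\<lambda>t. \<integral>\<^sup>+k. f k t \<partial>count_space UNIV) t
      = (\<Sum>n. \<integral>\<^sup>+k. (conv_fun G ^^ n) (f k) t \<partial>count_space UNIV)"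
    unfolding renewal_sum_def
    by (subst conv_fun_pow_count_sum) (use f sigma_finite_measure_axioms in auto)
  also have "\<dots> = (\<integral>\<^sup>+k. renewal_sum (f k) t \<partial>count_space UNIV)"
    unfolding renewal_sum_def by (subst nn_integral_suminf[symmetric]) auto
  finally show ?thesis .
qed

lemma renewal_sum_cmult:
  assumes "f \<in> borel_measurable borel"
  shows "renewal_sum (\<lambda>t. c * f t) t = c * renewal_sum f t"
  unfolding renewal_sum_def
  by (simp add: conv_fun_pow_cmult[OF _ sigma_finite_measure_axioms assms])

lemma bounded_vanishing_renewal_sum_indicator:
  "bounded_vanishing (renewal_sum (indicator {a<..a + l}))"
  using renewal_sum_bounded[of l] renewal_sum_tendsto_0[of a l] unfolding bounded_vanishing_def by blast

text \<open>Every cell contributes at most its height times the common constant \<open>C\<close>;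
  these products have a finite sum, so the limits of the single cells can be taken under the
  sum.\<close>

lemma renewal_sum_step_function:
  fixes s :: "int \<Rightarrow> ennreal"
  assumes f: "f \<in> borel_measurable borel"
    and le: "\<And>t. f t \<le> (\<integral>\<^sup>+k. s k * indicator {real_of_int k * \<epsilon><..real_of_int k * \<epsilon> + \<epsilon>} t \<partial>count_space UNIV)"
    and fin: "(\<integral>\<^sup>+k. s k \<partial>count_space UNIV) < \<infinity>"
    and C: "\<And>a t. renewal_sum (indicator {a<..a + \<epsilon>}) t \<le> C" "C < \<infinity>"
  shows "renewal_sum f t \<le> C * (\<integral>\<^sup>+k. s k \<partial>count_space UNIV)" "(renewal_sum f \<longlongrightarrow> 0) at_bot"
proof -
  let ?I = "\<lambda>k. indicator {real_of_int k * \<epsilon><..real_of_int k * \<epsilon> + \<epsilon>} :: real \<Rightarrow> ennreal"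
  define g where "g t = (\<integral>\<^sup>+k. s k * renewal_sum (?I k) t \<partial>count_space UNIV)" for t
  have fg: "renewal_sum f t \<le> g t" for t
  proof -
    have "renewal_sum f t \<le> renewal_sum (\<lambda>t. \<integral>\<^sup>+k. s k * ?I k t \<partial>count_space UNIV) t"
      by (rule renewal_sum_mono) (rule le)
    also have "\<dots> = g t" unfolding g_def
      by (subst renewal_sum_count_sum) (auto simp: renewal_sum_cmult)
    finally show ?thesis .
  qed
  have bd: "s k * renewal_sum (?I k) t \<le> s k * C" for k t by (intro mult_left_mono C) auto
  have tot: "(\<integral>\<^sup>+k. s k * C \<partial>count_space UNIV) = C * (\<integral>\<^sup>+k. s k \<partial>count_space UNIV)"
    by (simp add: nn_integral_cmult mult.commute[of _ C])
  have "g t \<le> (\<integral>\<^sup>+k. s k * C \<partial>count_space UNIV)" for t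
    unfolding g_def by (rule nn_integral_mono) (rule bd)
  with fg show "renewal_sum f t \<le> C * (\<integral>\<^sup>+k. s k \<partial>count_space UNIV)"
    unfolding tot by (blast intro: order_trans)
  have "(g \<longlongrightarrow> 0) at_bot" unfolding g_def[abs_def]
  proof (rule nn_integral_tendsto_at_bot[where w = "\<lambda>k. s k * C"])
    show "(\<integral>\<^sup>+k. s k * C \<partial>count_space UNIV) < \<infinity>"
      unfolding tot using C(2) fin by (simp add: ennreal_mult_less_top)
    fix k
    have "s k < \<top>" using le_less_trans[OF nn_integral_count_space_upper fin] by simp
    from ennreal_tendsto_cmult[OF this renewal_sum_tendsto_0]
    show "((\<lambda>t. s k * renewal_sum (?I k) t) \<longlongrightarrow> 0) at_bot" by simp
  qed (auto intro: bd)
  then show "(renewal_sum f \<longlongrightarrow> 0) at_bot"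
    by (rule tendsto_sandwich[OF _ _ tendsto_const, rotated 2]) (auto simp: fg)
qed

end

locale markov_renewal_drift = markov_renewal F q u v r
  for F :: "'s::countable \<Rightarrow> 's \<Rightarrow> real measure" and q u v r +
  assumes drift: "(\<integral>\<^sup>+i. u i * mean_neg i \<partial>count_space UNIV) < (\<integral>\<^sup>+i. u i * mean_pos i \<partial>count_space UNIV)"
begin

sublocale W: positive_drift_walk G
  by (intro positive_drift_walk.intro positive_drift_walk_axioms.intro real_distribution_G positive_drift_G drift)

lemma Vsum_le_renewal: "meas_fam f \<Longrightarrow> Vsum q f r t \<le> Nop (\<lambda>j. W.renewal_sum (f j)) r t"
  using Vsum_le_cycles[OF _ sigma_finite_G, of f t] Nop_conv_fun_sum[OF _ sigma_finite_G, of f r t]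
  by (simp add: W.renewal_sum_def[abs_def])

text \<open>The constant \<open>C\<close> is the same for all cells and all states. Hence
  \<open>U\<close> applied to \<open>f j\<close> is at most \<open>C\<close> times the sum of the
  heights at \<open>j\<close>, and these bounds have a finite sum with weights \<open>u\<close>, as
  needed to apply \<open>N\<close>.\<close>

lemma Vsum_step_functions:
  fixes s :: "'s \<Rightarrow> int \<Rightarrow> ennreal"
  assumes f: "meas_fam f"
    and le: "\<And>j t. f j t \<le> (\<integral>\<^sup>+k. s j k * indicator {real_of_int k * \<epsilon><..real_of_int k * \<epsilon> + \<epsilon>} t \<partial>count_space UNIV)"
    and fin: "(\<integral>\<^sup>+j. u j * (\<integral>\<^sup>+k. s j k \<partial>count_space UNIV) \<partial>count_space UNIV) < \<infinity>"
  shows "bounded_vanishing (Vsum q f r)"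
proof -
  obtain C where C: "C < \<infinity>" "\<And>a t. W.renewal_sum (indicator {a<..a + \<epsilon>}) t \<le> C"
    using W.renewal_sum_bounded[of \<epsilon>] by blast
  have sfin: "(\<integral>\<^sup>+k. s j k \<partial>count_space UNIV) < \<infinity>" for j
    by (rule weighted_finite_imp_finite[OF fin u_pos])
  note ub = W.renewal_sum_step_function[OF meas_famD[OF f] le sfin C(2,1)]
  have "(\<integral>\<^sup>+j. u j * (C * (\<integral>\<^sup>+k. s j k \<partial>count_space UNIV)) \<partial>count_space UNIV)
      = C * (\<integral>\<^sup>+j. u j * (\<integral>\<^sup>+k. s j k \<partial>count_space UNIV) \<partial>count_space UNIV)"
    by (simp add: nn_integral_cmult[symmetric] mult.left_commute)
  also have "\<dots> < \<infinity>" using C(1) fin by (simp add: ennreal_mult_less_top)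
  finally have "bounded_vanishing (Nop (\<lambda>j. W.renewal_sum (f j)) r)"
    using ub f by (intro Nop_bounded_vanishing[where c = "\<lambda>j. C * (\<integral>\<^sup>+k. s j k \<partial>count_space UNIV)"])
      (auto simp: meas_fam_def intro: W.renewal_sum_measurable)
  then show ?thesis by (rule bounded_vanishing_mono) (rule Vsum_le_renewal[OF f])
qed

text \<open>The claim concerns the root only; as any state can be chosen as the root, it yields the
  vanishing of the whole family.\<close>

lemma subharmonic_zero:
  assumes D: "meas_fam D" "\<And>j t. D j t \<le> T D j t" "\<And>j t. D j t \<le> K * v j" "K < \<infinity>"
    and lim: "(D r \<longlongrightarrow> 0) at_bot"
  shows "D r t = 0"
proof -
  have step: "D r t \<le> conv_fun G (D r) t" for t
  proof -
    have "D r t \<le> Nop (\<lambda>j t. H D j t + 0) r t"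
      by (rule subharmonic_le_Nop[OF D(1) meas_fam_const _ D(3,4)]) (simp add: D(2))
    then show ?thesis by (simp add: Nop_H[OF D(1)])
  qed
  have pow: "D r t \<le> (conv_fun G ^^ n) (D r) t" for n t
  proof (induction n arbitrary: t)
    case (Suc n)
    have "D r t \<le> conv_fun G (D r) t" by (rule step)
    also have "\<dots> \<le> conv_fun G ((conv_fun G ^^ n) (D r)) t" by (rule conv_fun_mono) (rule Suc)
    finally show ?case by simp
  qed simp
  have "D r t \<le> 0 + ennreal e" if e: "0 < e" for e :: real
  proof -
    have "eventually (\<lambda>s. D r s < ennreal e) at_bot"
      using lim e by (intro order_tendstoD) auto
    then obtain a where a: "\<And>s. s \<le> a \<Longrightarrow> D r s < ennreal e"
      by (auto simp: eventually_at_bot_linorder)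
    let ?h = "indicator {a..} :: real \<Rightarrow> ennreal" and ?C = "K * v r"
    \<comment> \<open>Left of \<open>a\<close> the value is below \<open>e\<close>; right of
      \<open>a\<close> the bound \<open>K * v r\<close> is crude, but the walk leaves that
      half-line, so its contribution disappears under the iterates.\<close>
    have "D r s \<le> ennreal e + ?C * ?h s" for s
      using a[of s] D(3)[of r s] by (cases "s \<le> a") (auto simp: indicator_def intro: less_imp_le add_increasing2 add_increasing)
    then have 1: "(conv_fun G ^^ n) (D r) t \<le> (conv_fun G ^^ n) (\<lambda>s. ennreal e + ?C * ?h s) t" for n
      by (rule conv_fun_pow_mono)
    have 2: "(conv_fun G ^^ n) (\<lambda>s. ennreal e + ?C * ?h s) t = ennreal e + ?C * (conv_fun G ^^ n) ?h t" for n t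
    proof (induction n arbitrary: t)
      case (Suc n)
      then have "(conv_fun G ^^ n) (\<lambda>s. ennreal e + ?C * ?h s) = (\<lambda>t. ennreal e + ?C * (conv_fun G ^^ n) ?h t)"
        by (intro ext)
      moreover have "conv_fun G (\<lambda>t. ennreal e + ?C * g t) t = ennreal e + ?C * conv_fun G g t"
        if [measurable]: "g \<in> borel_measurable borel" for g t
        unfolding conv_fun_def by (simp add: nn_integral_add nn_integral_cmult emeasure_G)
      ultimately show ?case by simp
    qed simp
    have Cfin: "?C < \<top>" using D(4) v_fin[of r] by (simp add: ennreal_mult_less_top)
    have "(\<lambda>n. ennreal e + ?C * (conv_fun G ^^ n) ?h t) \<longlonglongrightarrow> ennreal e + ?C * 0"
      by (intro tendsto_add tendsto_const ennreal_tendsto_cmult[OF Cfin] W.conv_fun_pow_ray_tendsto_0)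
    moreover have "D r t \<le> ennreal e + ?C * (conv_fun G ^^ n) ?h t" for n
    proof -
      have "D r t \<le> (conv_fun G ^^ n) (D r) t" by (rule pow)
      also have "\<dots> \<le> (conv_fun G ^^ n) (\<lambda>s. ennreal e + ?C * ?h s) t" by (rule 1)
      finally show ?thesis unfolding 2 .
    qed
    ultimately show ?thesis using LIMSEQ_le_const by fastforce
  qed
  then have "D r t \<le> 0" by (rule ennreal_le_epsilon)
  then show ?thesis by simp
qed

end

section \<open>Spread-out walks\<close>

lemma nn_integral_measure_add:
  assumes sets: "sets M = sets borel" "sets A = sets borel" "sets B = sets borel"
    and em: "\<And>E. E \<in> sets borel \<Longrightarrow> emeasure M E = emeasure A E + emeasure B E"
    and f: "f \<in> borel_measurable (borel :: real measure)"
  shows "(\<integral>\<^sup>+x. f x \<partial>M) = (\<integral>\<^sup>+x. f x \<partial>A) + (\<integral>\<^sup>+x. f x \<partial>B)"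
proof -
  note [measurable_cong] = sets
  show ?thesis using f
  proof (induction f rule: borel_measurable_induct)
    case (set E)
    then show ?case using sets em by simp
  next
    case (mult u c)
    from mult have [measurable]: "u \<in> borel_measurable borel" by simp
    show ?case using mult by (simp add: nn_integral_cmult distrib_left)
  next
    case (add u v)
    from add have [measurable]: "u \<in> borel_measurable borel" "v \<in> borel_measurable borel" by auto
    show ?case using add by (simp add: nn_integral_add ac_simps)
  next
    case (seq U)
    from seq have [measurable]: "U n \<in> borel_measurable borel" for n by auto
    have inc: "incseq (\<lambda>n. \<integral>\<^sup>+x. U n x \<partial>N)" for N
      using seq(3) by (auto simp: incseq_def le_fun_def intro!: nn_integral_mono)
    have "(\<integral>\<^sup>+x. (SUP n. U n x) \<partial>M) = (SUP n. (\<integral>\<^sup>+x. U n x \<partial>A) + (\<integral>\<^sup>+x. U n x \<partial>B))"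
      using seq by (simp add: nn_integral_monotone_convergence_SUP)
    also have "\<dots> = (\<integral>\<^sup>+x. (SUP n. U n x) \<partial>A) + (\<integral>\<^sup>+x. (SUP n. U n x) \<partial>B)"
      using seq(3) by (simp add: nn_integral_monotone_convergence_SUP ennreal_SUP_add inc)
    finally show ?case by (simp add: image_comp SUP_apply[abs_def])
  qed (simp add: ext)
qed

text \<open>
  With \<open>f\<close> the density of \<open>\<mu>\<close> with respect to \<open>\<mu> + lborel\<close> one has \<open>\<mu> \<ge> f * lborel\<close>, and \<open>\<mu>\<close> is
  singular if \<open>f = 0\<close> Lebesgue-almost everywhere.
\<close>

lemma nonsingular_density:
  assumes fin: "finite_measure \<mu>" and sets[measurable_cong]: "sets \<mu> = sets borel"
    and ns: "\<not> lebesgue_singular \<mu>"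
  obtains \<beta> :: "real \<Rightarrow> ennreal" and L :: real where "\<beta> \<in> borel_measurable borel"
    "\<And>x. \<beta> x \<le> indicator {-L<..L} x" "(\<integral>\<^sup>+x. \<beta> x \<partial>lborel) > 0"
    "\<And>E. E \<in> sets borel \<Longrightarrow> emeasure (density lborel \<beta>) E \<le> emeasure \<mu> E"
proof -
  interpret finite_measure \<mu> by fact
  have sp: "space \<mu> = UNIV" using sets_eq_imp_space_eq[OF sets] by simp
  obtain \<nu> where s\<nu>[measurable_cong]: "sets \<nu> = sets borel"
    and \<nu>: "\<And>f. f \<in> borel_measurable borel \<Longrightarrow> (\<integral>\<^sup>+x. f x \<partial>\<nu>) = (\<integral>\<^sup>+x. f x \<partial>\<mu>) + (\<integral>\<^sup>+x. f x \<partial>lborel)"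
  proof (rule functional_measure)
    fix f g :: "real \<Rightarrow> ennreal" assume [measurable]: "f \<in> borel_measurable borel" "g \<in> borel_measurable borel"
    show "(\<integral>\<^sup>+x. f x + g x \<partial>\<mu>) + (\<integral>\<^sup>+x. f x + g x \<partial>lborel)
      = ((\<integral>\<^sup>+x. f x \<partial>\<mu>) + (\<integral>\<^sup>+x. f x \<partial>lborel)) + ((\<integral>\<^sup>+x. g x \<partial>\<mu>) + (\<integral>\<^sup>+x. g x \<partial>lborel))"
      by (simp add: nn_integral_add add_ac)
  next
    fix f :: "real \<Rightarrow> ennreal" and c assume [measurable]: "f \<in> borel_measurable borel"
    show "(\<integral>\<^sup>+x. c * f x \<partial>\<mu>) + (\<integral>\<^sup>+x. c * f x \<partial>lborel) = c * ((\<integral>\<^sup>+x. f x \<partial>\<mu>) + (\<integral>\<^sup>+x. f x \<partial>lborel))"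
      by (simp add: nn_integral_cmult distrib_left)
  next
    fix f :: "nat \<Rightarrow> real \<Rightarrow> ennreal" assume [measurable]: "\<And>n. f n \<in> borel_measurable borel" and inc: "incseq f"
    have inc': "incseq (\<lambda>n. \<integral>\<^sup>+x. f n x \<partial>N)" for N
      using inc by (auto simp: incseq_def le_fun_def intro!: nn_integral_mono)
    show "(\<integral>\<^sup>+x. (SUP n. f n x) \<partial>\<mu>) + (\<integral>\<^sup>+x. (SUP n. f n x) \<partial>lborel)
       = (SUP n. (\<integral>\<^sup>+x. f n x \<partial>\<mu>) + (\<integral>\<^sup>+x. f n x \<partial>lborel))"
      using inc by (simp add: nn_integral_monotone_convergence_SUP ennreal_SUP_add inc')
  qed blast
  have em\<nu>: "emeasure \<nu> E = emeasure \<mu> E + emeasure lborel E" if "E \<in> sets borel" for E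
    using \<nu>[of "indicator E"] that by (simp add: s\<nu> sets)
  have sp\<nu>: "space \<nu> = UNIV" using sets_eq_imp_space_eq[OF s\<nu>] by simp
  interpret N: sigma_finite_measure \<nu>
  proof
    show "\<exists>A. countable A \<and> A \<subseteq> sets \<nu> \<and> \<Union> A = space \<nu> \<and> (\<forall>a\<in>A. emeasure \<nu> a \<noteq> \<infinity>)"
    proof (intro exI[of _ "range (\<lambda>n. {- real n<..real n})"] conjI ballI)
      show "\<Union> (range (\<lambda>n. {- real n<..real n})) = space \<nu>"
        using UN_Ioc_eq_UNIV by (simp add: sp\<nu>)
      fix a assume "a \<in> range (\<lambda>n. {- real n<..real n})"
      then obtain n where "a = {- real n<..real n}" by blast
      then show "emeasure \<nu> a \<noteq> \<infinity>"
        by (simp add: em\<nu> emeasure_finite)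
    qed (auto simp: s\<nu>)
  qed
  have "absolutely_continuous \<nu> \<mu>"
    unfolding absolutely_continuous_def null_sets_def by (auto simp: s\<nu> sets em\<nu>)
  then obtain f where f[measurable]: "f \<in> borel_measurable \<nu>" and df: "density \<nu> f = \<mu>"
    using N.Radon_Nikodym[of \<mu>] by (auto simp: s\<nu> sets)
  have f': "f \<in> borel_measurable borel" using f by (simp cong: measurable_cong_sets add: s\<nu>)
  note [measurable] = f'
  \<comment> \<open>Integrating \<open>f\<close> against both summands of \<nu>: the second integral
    alone shows that \<mu> dominates the measure with Lebesgue density \<open>f\<close>.\<close>
  have \<mu>E: "emeasure \<mu> E = (\<integral>\<^sup>+x. f x * indicator E x \<partial>\<mu>) + (\<integral>\<^sup>+x. f x * indicator E x \<partial>lborel)"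
    if [measurable]: "E \<in> sets borel" for E
  proof -
    have "emeasure \<mu> E = (\<integral>\<^sup>+x. f x * indicator E x \<partial>\<nu>)"
      by (subst df[symmetric]) (rule emeasure_density, auto simp: s\<nu>)
    also have "\<dots> = (\<integral>\<^sup>+x. f x * indicator E x \<partial>\<mu>) + (\<integral>\<^sup>+x. f x * indicator E x \<partial>lborel)"
      by (rule \<nu>) measurable
    finally show ?thesis .
  qed
  \<comment> \<open>Cutting \<open>f\<close> at height 1 and to a window yields a bounded density
    with compact support. If every window gave mass 0, \<open>f\<close> would vanish almost
    everywhere.\<close>
  have "\<exists>n::nat. (\<integral>\<^sup>+x. min (f x) 1 * indicator {- real n<..real n} x \<partial>lborel) > 0"
  proof (rule ccontr)
    assume "\<not> ?thesis"
    then have "(\<integral>\<^sup>+x. min (f x) 1 * indicator {- real n<..real n} x \<partial>lborel) = 0" for n :: nat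
      by (metis not_gr_zero)
    then have "AE x in lborel. min (f x) 1 * indicator {- real n<..real n} x = 0" for n :: nat
      by (subst (asm) nn_integral_0_iff_AE) auto
    then have "AE x in lborel. \<forall>n::nat. min (f x) 1 * indicator {- real n<..real n} x = 0"
      by (subst AE_all_countable) auto
    then have AE0: "AE x in lborel. f x = 0"
    proof eventually_elim
      case (elim x)
      obtain n where "x \<in> {- real n<..real n}" using UN_Ioc_eq_UNIV by blast
      with elim[rule_format, of n] show ?case by (auto simp: min_def split: if_splits)
    qed
    define E where "E = {x. f x \<noteq> 0}"
    have [measurable]: "E \<in> sets borel" unfolding E_def by measurable
    have "emeasure lborel E = 0"
      using AE0 by (subst (asm) AE_iff_measurable[of E]) (auto simp: E_def)
    moreover have "emeasure \<mu> (UNIV - E) = 0"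
    proof -
      have z: "f x * indicator (UNIV - E) x = 0" for x by (auto simp: E_def indicator_def)
      have "UNIV - E \<in> sets borel" by measurable
      then show ?thesis by (subst \<mu>E) (simp_all add: z)
    qed
    moreover have "E \<in> sets borel" by measurable
    ultimately have "lebesgue_singular \<mu>" unfolding lebesgue_singular_def by blast
    with ns show False by simp
  qed
  then obtain n :: nat where n: "(\<integral>\<^sup>+x. min (f x) 1 * indicator {- real n<..real n} x \<partial>lborel) > 0" by blast
  show thesis
  proof (rule that[of "\<lambda>x. min (f x) 1 * indicator {- real n<..real n} x" "real n"])
    fix E :: "real set" assume [measurable]: "E \<in> sets borel"
    have "emeasure (density lborel (\<lambda>x. min (f x) 1 * indicator {- real n<..real n} x)) E
        = (\<integral>\<^sup>+x. min (f x) 1 * indicator {- real n<..real n} x * indicator E x \<partial>lborel)"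
      by (rule emeasure_density) auto
    also have "\<dots> \<le> (\<integral>\<^sup>+x. f x * indicator E x \<partial>lborel)"
      by (intro nn_integral_mono) (auto simp: indicator_def)
    also have "\<dots> \<le> emeasure \<mu> E" by (subst \<mu>E) (auto simp: add_increasing)
    finally show "emeasure (density lborel (\<lambda>x. min (f x) 1 * indicator {- real n<..real n} x)) E \<le> emeasure \<mu> E" .
  qed (use n in \<open>auto simp: indicator_def\<close>)
qed

lemma conv_fun_sum:
  assumes [measurable_cong]: "sets M = sets borel" and [measurable]: "\<And>n. f n \<in> borel_measurable borel"
  shows "conv_fun M (\<lambda>t. \<Sum>n\<in>A. f n t) t = (\<Sum>n\<in>A. conv_fun M (f n) t)"
  unfolding conv_fun_def by (rule nn_integral_sum) measurable

lemma conv_fun_pow_commute: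
  assumes "sets M = sets borel" "sets N = sets borel"
    and "sigma_finite_measure M" "sigma_finite_measure N"
    and "h \<in> borel_measurable borel"
  shows "conv_fun M ((conv_fun N ^^ n) h) = (conv_fun N ^^ n) (conv_fun M h)"
proof (induction n)
  case (Suc n)
  have "conv_fun M (conv_fun N ((conv_fun N ^^ n) h)) = conv_fun N (conv_fun M ((conv_fun N ^^ n) h))"
    by (rule conv_fun_commute[OF assms(1-4) measurable_conv_fun_pow[OF assms(2,4,5)]])
  then show ?case using Suc by simp
qed simp

text \<open>Symmetry of the convolution of two densities, by the substitution
  \<open>x \<mapsto> t - x\<close>. It moves the renewal sum from a merely integrable function to
  one with compact support.\<close>

lemma conv_fun_density:
  assumes [measurable]: "\<beta> \<in> borel_measurable borel" "h \<in> borel_measurable borel"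
  shows "conv_fun (density lborel \<beta>) h = conv_fun (density lborel h) \<beta>"
proof
  fix t
  have "conv_fun (density lborel \<beta>) h t = (\<integral>\<^sup>+x. \<beta> x * h (t - x) \<partial>lborel)"
    unfolding conv_fun_def by (rule nn_integral_density) auto
  also have "\<dots> = \<bar>- 1 :: real\<bar> * (\<integral>\<^sup>+x. \<beta> (t + - 1 * x) * h (t - (t + - 1 * x)) \<partial>lborel)"
    by (rule nn_integral_real_affine) auto
  also have "\<dots> = (\<integral>\<^sup>+x. h x * \<beta> (t - x) \<partial>lborel)" by (simp add: mult.commute)
  also have "\<dots> = conv_fun (density lborel h) \<beta> t"
    unfolding conv_fun_def by (rule nn_integral_density[symmetric]) auto
  finally show "conv_fun (density lborel \<beta>) h t = conv_fun (density lborel h) \<beta> t" .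
qed

context positive_drift_walk
begin

text \<open>
  Stone's argument: write \<open>G\<^sup>*\<^sup>m = A + B\<close> with \<open>B\<close> having a bounded compactly supported density and
  \<open>A\<close> of mass less than 1.  Then \<open>U * b \<le> \<Sum>\<^sub>k A\<^sup>*\<^sup>k * e\<close> with \<open>e = \<Sum>\<^sub>k\<^sub><\<^sub>m G\<^sup>*\<^sup>k * b + B * U * b\<close>, and \<open>B * U\<close>
  has a bounded density vanishing at \<open>-\<infinity>\<close>.
\<close>

lemma bounded_vanishing_renewal_sum:
  assumes sets\<mu>: "sets \<mu> = sets borel" and fin: "finite_measure \<mu>" and ns: "\<not> lebesgue_singular \<mu>"
    and \<mu>: "\<And>h t. h \<in> borel_measurable borel \<Longrightarrow> (conv_fun G ^^ m) h t = conv_fun \<mu> h t" and m: "m > 0"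
    and b[measurable]: "b \<in> borel_measurable borel" and bv: "bounded_vanishing b"
    and int: "(\<integral>\<^sup>+x. b x \<partial>lborel) < \<infinity>"
  shows "bounded_vanishing (renewal_sum b)"
proof -
  obtain \<beta> L where \<beta>[measurable]: "\<beta> \<in> borel_measurable borel"
    and \<beta>le: "\<And>x. \<beta> x \<le> indicator {-L<..L} x" and \<beta>pos: "(\<integral>\<^sup>+x. \<beta> x \<partial>lborel) > 0"
    and B_le: "\<And>E. E \<in> sets borel \<Longrightarrow> emeasure (density lborel \<beta>) E \<le> emeasure \<mu> E"
    using nonsingular_density[OF fin sets\<mu> ns] by blast
  define B where "B = density lborel \<beta>"
  define A where "A = diff_measure \<mu> B"
  have sB: "sets B = sets borel" and sA: "sets A = sets borel" by (simp_all add: A_def B_def sets\<mu>)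
  have sp: "space \<mu> = UNIV" "space A = UNIV" "space B = UNIV"
    using sets_eq_imp_space_eq[OF sets\<mu>] sets_eq_imp_space_eq[OF sA] sets_eq_imp_space_eq[OF sB] by auto
  have "conv_fun \<mu> (\<lambda>_. 1) 0 = 1"
  proof -
    have "(conv_fun G ^^ n) (\<lambda>_. 1) = (\<lambda>_. 1)" for n
    proof (induction n)
      case (Suc n)
      have "conv_fun G (\<lambda>_. 1) = (\<lambda>_. 1)"
        using emeasure_space_1 by (simp add: conv_fun_def fun_eq_iff)
      then show ?case using Suc by simp
    qed simp
    then show ?thesis by (subst \<mu>[symmetric]) auto
  qed
  then have \<mu>1: "emeasure \<mu> UNIV = 1" by (simp add: conv_fun_def sp)
  have Bfin: "emeasure B UNIV \<le> 1" using B_le[of UNIV] \<mu>1 by (simp add: B_def)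
  have fB: "finite_measure B"
    by standard (use Bfin sp in \<open>auto simp: top_unique\<close>)
  have Aem: "emeasure A E = emeasure \<mu> E - emeasure B E" if "E \<in> sets borel" for E
    unfolding A_def by (rule emeasure_diff_measure[OF fin fB]) (use that B_le sB sets\<mu> in \<open>auto simp: B_def\<close>)
  have add: "emeasure \<mu> E = emeasure A E + emeasure B E" if "E \<in> sets borel" for E
    using Aem[OF that] B_le[OF that] by (simp add: B_def[symmetric] diff_add_cancel_ennreal)
  have Bpos: "emeasure B UNIV > 0"
    using \<beta>pos by (simp add: B_def emeasure_density)
  have A1: "emeasure A UNIV < 1"
  proof -
    obtain c where c: "emeasure B UNIV = ennreal c" "0 < c" "c \<le> 1"
      using Bpos Bfin by (cases "emeasure B UNIV") (auto simp: top_unique)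
    have "emeasure A UNIV = ennreal 1 - ennreal c" by (simp add: Aem \<mu>1 c)
    also have "\<dots> = ennreal (1 - c)" using c by (intro ennreal_minus) simp
    also have "\<dots> < 1" using c by (simp add: ennreal_less_one_iff)
    finally show ?thesis .
  qed
  have fA: "finite_measure A"
    by standard (use A1 sp in auto)
  note sfA = finite_measure.axioms(1)[OF fA] and sfB = finite_measure.axioms(1)[OF fB]
  have conv_AB: "conv_fun \<mu> h t = conv_fun A h t + conv_fun B h t"
    if [measurable]: "h \<in> borel_measurable borel" for h t
    unfolding conv_fun_def by (rule nn_integral_measure_add[OF sets\<mu> sA sB add]) auto
  let ?U = "renewal_sum"
  \<comment> \<open>\<open>b\<close> has no step function bound, so \<open>?U b\<close> cannot be
    estimated directly. After convolution with \<open>B\<close> the roles of \<open>b\<close> and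
    \<beta> can be exchanged: \<open>?U \<beta>\<close> is controlled by an interval, and
    \<open>b\<close> becomes the density of a finite measure.\<close>
  have BU: "conv_fun B (?U b) = conv_fun (density lborel b) (?U \<beta>)"
  proof
    fix t
    have fb: "finite_measure (density lborel b)"
      by standard (use int in \<open>simp add: emeasure_density\<close>)
    note sfb = finite_measure.axioms(1)[OF fb]
    have "conv_fun B (?U b) t = (\<Sum>k. conv_fun B ((conv_fun G ^^ k) b) t)"
      unfolding renewal_sum_def[abs_def] by (rule conv_fun_suminf[OF sB]) measurable
    also have "\<dots> = (\<Sum>k. (conv_fun G ^^ k) (conv_fun B b) t)"
      by (subst conv_fun_pow_commute[OF sB _ sfB sigma_finite_measure_axioms b]) auto
    also have "\<dots> = (\<Sum>k. (conv_fun G ^^ k) (conv_fun (density lborel b) \<beta>) t)"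
      by (simp only: B_def conv_fun_density[OF \<beta> b])
    also have "\<dots> = (\<Sum>k. conv_fun (density lborel b) ((conv_fun G ^^ k) \<beta>) t)"
      by (subst conv_fun_pow_commute[OF _ _ sfb sigma_finite_measure_axioms \<beta>]) auto
    also have "\<dots> = conv_fun (density lborel b) (?U \<beta>) t"
      unfolding renewal_sum_def[abs_def] by (rule conv_fun_suminf[symmetric]) (simp, measurable)
    finally show "conv_fun B (?U b) t = conv_fun (density lborel b) (?U \<beta>) t" .
  qed
  have "bounded_vanishing (?U \<beta>)"
  proof (rule bounded_vanishing_mono)
    show "bounded_vanishing (?U (indicator {-L<..-L + 2 * L}))" by (rule bounded_vanishing_renewal_sum_indicator)
    show "?U \<beta> t \<le> ?U (indicator {-L<..-L + 2 * L}) t" for t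
      by (rule renewal_sum_mono) (use \<beta>le in simp)
  qed
  then have bvBU: "bounded_vanishing (conv_fun B (?U b))"
    unfolding BU by (intro bounded_vanishing_conv_fun) (use int in \<open>simp_all add: emeasure_density\<close>)
  define e where "e t = (\<Sum>k<m. (conv_fun G ^^ k) b t) + conv_fun B (?U b) t" for t
  have G1: "emeasure G UNIV < \<infinity>" using emeasure_space_1 by simp
  have "bounded_vanishing ((conv_fun G ^^ k) b)" for k
  proof (induction k)
    case (Suc k)
    then show ?case unfolding funpow.simps comp_apply
      by (intro bounded_vanishing_conv_fun G1 conv_fun_pow_measurable b) auto
  qed (simp add: bv)
  then have bve: "bounded_vanishing e"
    unfolding e_def[abs_def] by (intro bounded_vanishing_add bounded_vanishing_sum bvBU)
  have em[measurable]: "e \<in> borel_measurable borel"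
    unfolding e_def[abs_def]
    by (intro borel_measurable_add borel_measurable_sum measurable_conv_fun[OF sB sfB]) auto
  have Am[measurable]: "(conv_fun A ^^ k) e \<in> borel_measurable borel" for k
    by (rule measurable_conv_fun_pow[OF sA sfA em])
  define w where "w t = (\<Sum>k. (conv_fun A ^^ k) e t)" for t
  have w: "w t = e t + conv_fun A w t" for t
  proof -
    have "conv_fun A w t = (\<Sum>k. (conv_fun A ^^ (k + 1)) e t)"
      unfolding w_def[abs_def] by (subst conv_fun_suminf[OF sA]) auto
    moreover have "w t = (\<Sum>k. (conv_fun A ^^ (k + 1)) e t) + (\<Sum>k<1. (conv_fun A ^^ k) e t)"
      unfolding w_def by (rule suminf_offset) simp
    ultimately show ?thesis by (simp add: add.commute)
  qed
  define S where "S n t = (\<Sum>k<n. (conv_fun G ^^ k) b t)" for n t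
  have Sm[measurable]: "S n \<in> borel_measurable borel" for n unfolding S_def[abs_def] by measurable
  have conv_S: "(conv_fun G ^^ n) (S l) t = (\<Sum>k<l. (conv_fun G ^^ (n + k)) b t)" for n l t
  proof (induction n arbitrary: t)
    case (Suc n)
    have "(conv_fun G ^^ n) (S l) = (\<lambda>t. \<Sum>k<l. (conv_fun G ^^ (n + k)) b t)" using Suc by (intro ext)
    then have "(conv_fun G ^^ Suc n) (S l) t = conv_fun G (\<lambda>t. \<Sum>k<l. (conv_fun G ^^ (n + k)) b t) t"
      by simp
    also have "\<dots> = (\<Sum>k<l. conv_fun G ((conv_fun G ^^ (n + k)) b) t)"
      by (rule conv_fun_sum) auto
    finally show ?case by simp
  qed (simp add: S_def)
  \<comment> \<open>Only partial sums are compared, since \<open>?U b\<close> could still be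
    infinite. Going forward in blocks of \<open>m\<close> steps reproduces the recursion that
    \<open>w\<close> satisfies with equality.\<close>
  have step: "S (m + n) t \<le> e t + conv_fun A (S n) t" for n t
  proof -
    have "S (m + n) t = S m t + (conv_fun G ^^ m) (S n) t"
      unfolding conv_S unfolding S_def by (induction n) (simp_all add: add.assoc)
    also have "\<dots> = S m t + (conv_fun A (S n) t + conv_fun B (S n) t)"
      by (simp only: \<mu>[OF Sm] conv_AB[OF Sm])
    also have "conv_fun B (S n) t \<le> conv_fun B (?U b) t"
      unfolding S_def renewal_sum_def by (intro conv_fun_mono sum_le_suminf) auto
    finally have "S (m + n) t \<le> S m t + (conv_fun A (S n) t + conv_fun B (?U b) t)"
      by (simp add: add_left_mono)
    also have "\<dots> = (S m t + conv_fun B (?U b) t) + conv_fun A (S n) t" by (simp only: add_ac)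
    also have "S m t + conv_fun B (?U b) t = e t" by (simp only: e_def S_def)
    finally show ?thesis .
  qed
  have "S (n * m) t \<le> w t" for n t
  proof (induction n arbitrary: t)
    case (Suc n)
    have "S (Suc n * m) t \<le> e t + conv_fun A (S (n * m)) t" using step[of "n * m" t] by simp
    also have "\<dots> \<le> e t + conv_fun A w t" by (intro add_left_mono conv_fun_mono Suc)
    finally show ?case by (simp only: w[symmetric])
  qed (simp add: S_def)
  moreover have "S n t \<le> S (n * m) t" for n t
    unfolding S_def using m by (intro sum_mono2) auto
  ultimately have Sw: "S n t \<le> w t" for n t by (blast intro: order_trans)
  have Uw: "?U b t \<le> w t" for t
    unfolding renewal_sum_def by (rule suminf_le_const[OF summableI]) (rule Sw[unfolded S_def])
  obtain E where E: "E < \<infinity>" "\<And>t. e t \<le> E" using bve by (auto simp: bounded_vanishing_def)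
  obtain \<alpha> where \<alpha>: "emeasure A UNIV = ennreal \<alpha>" "0 \<le> \<alpha>" "\<alpha> < 1"
    using A1 by (cases "emeasure A UNIV") auto
  have Ak: "(conv_fun A ^^ k) e t \<le> E * ennreal (\<alpha> ^ k)" for k t
  proof (induction k arbitrary: t)
    case (Suc k)
    have "(conv_fun A ^^ Suc k) e t \<le> conv_fun A (\<lambda>_. E * ennreal (\<alpha> ^ k)) t"
      unfolding funpow.simps comp_apply by (rule conv_fun_mono) (rule Suc)
    also have "\<dots> = E * ennreal (\<alpha> ^ Suc k)"
      using \<alpha> by (simp add: conv_fun_const sA ennreal_mult mult_ac)
    finally show ?case .
  qed (use E in simp)
  have bvA: "bounded_vanishing ((conv_fun A ^^ k) e)" for k
  proof (induction k)
    case (Suc k)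
    then show ?case unfolding funpow.simps comp_apply
      by (intro bounded_vanishing_conv_fun sA Am) (use less_trans[OF A1 ennreal_one_less_top] in auto)
  qed (simp add: bve)
  have sumE: "(\<Sum>k. E * ennreal (\<alpha> ^ k)) < \<infinity>"
  proof -
    have "(\<Sum>k. ennreal (\<alpha> ^ k)) = ennreal (\<Sum>k. \<alpha> ^ k)"
      using \<alpha> by (intro suminf_ennreal2) (auto intro: summable_geometric)
    then show ?thesis using E(1) by (simp add: ennreal_mult_less_top)
  qed
  have "bounded_vanishing w"
    unfolding bounded_vanishing_def
  proof
    have "w t \<le> (\<Sum>k. E * ennreal (\<alpha> ^ k))" for t
      unfolding w_def by (intro suminf_le Ak) auto
    then show "\<exists>C<\<infinity>. \<forall>t. w t \<le> C" using sumE by blast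
    have "((\<lambda>t. \<integral>\<^sup>+k. (conv_fun A ^^ k) e t \<partial>count_space UNIV) \<longlongrightarrow> 0) at_bot"
    proof (rule nn_integral_tendsto_at_bot[where w = "\<lambda>k. E * ennreal (\<alpha> ^ k)"])
      show "(\<integral>\<^sup>+k. E * ennreal (\<alpha> ^ k) \<partial>count_space UNIV) < \<infinity>"
        using sumE by (simp only: nn_integral_count_space_nat)
      show "((\<lambda>t. (conv_fun A ^^ k) e t) \<longlongrightarrow> 0) at_bot" for k
        using bvA[of k] by (simp add: bounded_vanishing_def)
    qed (auto intro: Ak)
    then show "(w \<longlongrightarrow> 0) at_bot" by (simp add: w_def[abs_def] nn_integral_count_space_nat)
  qed
  then show ?thesis by (rule bounded_vanishing_mono) (rule Uw)
qed

end

section \<open>From a nonsingular entry of a matrix power to a nonsingular power of the cycle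
  law\<close>

lemma conv_fun_eq_0:
  assumes [measurable_cong]: "sets M = sets borel" and [measurable]: "\<phi> \<in> borel_measurable borel"
    and 0: "conv_fun M \<phi> t = 0" and pos: "0 < emeasure M UNIV"
  shows "\<exists>s. \<phi> s = 0"
proof (rule ccontr)
  assume ne: "\<nexists>s. \<phi> s = 0"
  have sp: "space M = UNIV" using sets_eq_imp_space_eq[OF assms(1)] by simp
  have "AE x in M. \<phi> (t - x) = 0"
    using 0 unfolding conv_fun_def by (subst (asm) nn_integral_0_iff_AE) auto
  then have "AE x in M. False" by eventually_elim (use ne in auto)
  then have "emeasure M (space M) = 0" by (simp add: AE_iff_null null_sets_def)
  with pos show False by (simp add: sp)
qed

lemma (in positive_drift_walk) conv_fun_pow_walk_law:
  assumes [measurable]: "h \<in> borel_measurable borel"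
  shows "(conv_fun G ^^ m) h t = conv_fun (distr paths borel (\<lambda>\<omega>. walk \<omega> m)) h t"
proof -
  have "(conv_fun G ^^ m) h t = (\<integral>\<^sup>+\<omega>. h (t - walk \<omega> m) * indicator (space paths) (sdrop m \<omega>) \<partial>paths)"
    by (subst nn_integral_walk_future) (simp_all add: P.emeasure_space_1)
  also have "\<dots> = (\<integral>\<^sup>+\<omega>. h (t - walk \<omega> m) \<partial>paths)"
    by (intro nn_integral_cong) (auto simp: indicator_def dest: measurable_space[OF measurable_sdrop])
  also have "\<dots> = conv_fun (distr paths borel (\<lambda>\<omega>. walk \<omega> m)) h t"
    unfolding conv_fun_def by (subst nn_integral_distr) auto
  finally show ?thesis .
qed

text \<open>Picks out column \<open>j\<close>: applying a power of the operator to this family and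
  evaluating at \<open>i\<close> gives the action of a single matrix entry on
  \<open>h\<close>.\<close>

definition unit_fam :: "'s \<Rightarrow> (real \<Rightarrow> ennreal) \<Rightarrow> 's \<Rightarrow> real \<Rightarrow> ennreal" where
  "unit_fam j h = (\<lambda>k t. indicator {j} k * h t)"

context conv_matrix
begin

lemma meas_fam_unit_fam: "h \<in> borel_measurable borel \<Longrightarrow> meas_fam (unit_fam j h)"
  unfolding meas_fam_def unit_fam_def by measurable

text \<open>Supplies the entry \<open>(i, j)\<close> of the \<open>n\<close>-th convolution power as
  a measure, by the same reflection as for the cycle law.\<close>

lemma ex_pow_law:
  "\<exists>K. sets K = sets borel \<and> (\<forall>h\<in>borel_measurable borel. \<forall>t. conv_fun K h t = (mop q ^^ n) (unit_fam j h) i t)"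
proof -
  define \<Lambda> where "\<Lambda> f = (mop q ^^ n) (unit_fam j (\<lambda>s. f (- s))) i 0" for f
  have m: "meas_fam (unit_fam j (\<lambda>s. f (- s)))" if [measurable]: "f \<in> borel_measurable borel"
    for f :: "real \<Rightarrow> ennreal"
    by (rule meas_fam_unit_fam) measurable
  obtain K where K: "sets K = sets borel"
    "\<And>f. f \<in> borel_measurable borel \<Longrightarrow> (\<integral>\<^sup>+x. f x \<partial>K) = \<Lambda> f"
  proof (rule functional_measure)
    show "\<Lambda> (\<lambda>x. f x + g x) = \<Lambda> f + \<Lambda> g"
      if "f \<in> borel_measurable borel" "g \<in> borel_measurable borel" for f g
    proof -
      have "unit_fam j (\<lambda>s. f (- s) + g (- s)) = (\<lambda>k t. unit_fam j (\<lambda>s. f (- s)) k t + unit_fam j (\<lambda>s. g (- s)) k t)"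
        by (simp add: unit_fam_def distrib_left)
      then show ?thesis unfolding \<Lambda>_def by (simp only: mop_pow_add[OF m[OF that(1)] m[OF that(2)]])
    qed
    show "\<Lambda> (\<lambda>x. c * f x) = c * \<Lambda> f" if "f \<in> borel_measurable borel" for f c
    proof -
      have "unit_fam j (\<lambda>s. c * f (- s)) = (\<lambda>k t. c * unit_fam j (\<lambda>s. f (- s)) k t)"
        by (simp add: unit_fam_def mult.left_commute)
      then show ?thesis unfolding \<Lambda>_def by (simp only: mop_pow_cmult[OF m[OF that]])
    qed
    show "\<Lambda> (\<lambda>x. SUP n. f n x) = (SUP n. \<Lambda> (f n))"
      if "\<And>n::nat. f n \<in> borel_measurable borel" "incseq f" for f
    proof -
      have inc: "incseq (\<lambda>n. unit_fam j (\<lambda>s. f n (- s)) k t)" for k t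
        using that(2) by (auto simp: incseq_def le_fun_def unit_fam_def intro!: mult_left_mono)
      have "unit_fam j (\<lambda>s. SUP n. f n (- s)) = (\<lambda>k t. SUP n. unit_fam j (\<lambda>s. f n (- s)) k t)"
        by (simp add: unit_fam_def SUP_mult_left_ennreal)
      then show ?thesis unfolding \<Lambda>_def by (simp only: mop_pow_SUP[OF m[OF that(1)] inc])
    qed
  qed blast
  have "conv_fun K h t = (mop q ^^ n) (unit_fam j h) i t" if [measurable]: "h \<in> borel_measurable borel" for h t
  proof -
    have "conv_fun K h t = \<Lambda> (\<lambda>x. h (t - x))" unfolding conv_fun_def by (rule K) simp
    also have "\<dots> = (mop q ^^ n) (\<lambda>k s. unit_fam j h k (s + t)) i 0"
      by (simp add: \<Lambda>_def unit_fam_def add.commute)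
    also have "\<dots> = (mop q ^^ n) (unit_fam j h) i t" by (subst mop_pow_shift) simp
    finally show ?thesis .
  qed
  with K show ?thesis by blast
qed

definition pow_law :: "('s \<Rightarrow> 's \<Rightarrow> ennreal) \<Rightarrow> nat \<Rightarrow> 's \<Rightarrow> 's \<Rightarrow> real measure" where
  "pow_law q n i j = (SOME K. sets K = sets borel \<and>
     (\<forall>h\<in>borel_measurable borel. \<forall>t. conv_fun K h t = (mop q ^^ n) (unit_fam j h) i t))"

lemma sets_pow_law[simp, measurable_cong]: "sets (pow_law q n i j) = sets borel"
  and conv_fun_pow_law:
    "h \<in> borel_measurable borel \<Longrightarrow> conv_fun (pow_law q n i j) h t = (mop q ^^ n) (unit_fam j h) i t"
  using someI_ex[OF ex_pow_law[where q = q and n = n and i = i and j = j]] unfolding pow_law_def[symmetric] by auto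

lemma space_pow_law[simp]: "space (pow_law q n i j) = UNIV"
  using sets_eq_imp_space_eq[OF sets_pow_law] by simp

lemma emeasure_pow_law: "emeasure (pow_law q n i j) UNIV = (mat_act q ^^ n) (indicator {j}) i"
proof -
  have "emeasure (pow_law q n i j) UNIV = conv_fun (pow_law q n i j) (\<lambda>_. 1) 0"
    by (simp add: conv_fun_def)
  also have "\<dots> = (mop q ^^ n) (\<lambda>k _. indicator {j} k) i 0"
    by (subst conv_fun_pow_law) (simp_all add: unit_fam_def)
  finally show ?thesis by (simp add: mop_pow_const)
qed

end

context markov_renewal
begin

lemma emeasure_pow_law_finite: "emeasure (pow_law q n i j) UNIV < \<infinity>"
proof (rule ccontr)
  assume "\<not> ?thesis"
  then have "v j * (mat_act q ^^ n) (indicator {j}) i = \<infinity>"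
    using v_pos[of j] by (simp add: emeasure_pow_law less_top[symmetric] ennreal_mult_eq_top_iff)
  moreover have "v j * (mat_act q ^^ n) (indicator {j}) i \<le> (mat_act q ^^ n) v i"
    unfolding mat_act_pow_cmult[symmetric] by (rule mat_act_pow_mono) (auto simp: indicator_def)
  moreover have "(mat_act q ^^ n) v = v" for n
  proof (induction n)
    case (Suc n)
    have "mat_act q v = v" by (intro ext v_right)
    then show ?case using Suc by simp
  qed simp
  ultimately show False using v_fin[of i] by (simp add: top_unique)
qed

lemma finite_pow_law: "finite_measure (pow_law q n i j)"
  by standard (use emeasure_pow_law_finite in \<open>simp add: less_top[symmetric]\<close>)

lemma sigma_finite_pow_law: "sigma_finite_measure (pow_law q n i j)"
  using finite_pow_law by (rule finite_measure.axioms)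

end

context markov_renewal_drift
begin

text \<open>If all positive powers of \<open>G\<close> are singular, one Lebesgue null set carries
  every power, hence every return law at \<open>r\<close>. A passage from \<open>a\<close> to
  \<open>b\<close> can be completed to a loop at \<open>r\<close>; removing the two completing
  factors leaves a translate of the null set that carries the law of the passage.\<close>

lemma lebesgue_singular_pow_law:
  assumes sing: "\<And>m. m > 0 \<Longrightarrow> lebesgue_singular (distr W.paths borel (\<lambda>\<omega>. walk \<omega> m))"
  shows "lebesgue_singular (pow_law q n a b)"
proof -
  let ?\<mu> = "\<lambda>m. distr W.paths borel (\<lambda>\<omega>. walk \<omega> m)"
  have "\<exists>A\<in>sets borel. emeasure lborel A = 0 \<and> emeasure (?\<mu> m) (UNIV - A) = 0" for m
  \<comment> \<open>The zeroth power is the point mass at 0, to which the hypothesis does not apply;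
    the null set is \<open>{0}\<close>.\<close>
  proof (cases "m = 0")
    case True
    have "emeasure (?\<mu> 0) (UNIV - {0}) = 0" by (subst emeasure_distr) auto
    then show ?thesis unfolding True by (intro bexI[of _ "{0}"]) auto
  next
    case False
    then show ?thesis using sing[of m] by (simp add: lebesgue_singular_def)
  qed
  then obtain A where A: "\<And>m. A m \<in> sets borel" "\<And>m. emeasure lborel (A m) = 0"
    "\<And>m. emeasure (?\<mu> m) (UNIV - A m) = 0" by metis
  define N where "N = (\<Union>m. A m)"
  have Nm[measurable]: "N \<in> sets borel" unfolding N_def using A(1) by auto
  have N0: "emeasure lborel N = 0"
    unfolding N_def by (rule emeasure_UN_eq_0) (use A in auto)
  have N\<mu>: "emeasure (?\<mu> m) (UNIV - N) = 0" for m
    by (rule emeasure_eq_0[of "UNIV - A m"]) (use A in \<open>auto simp: N_def\<close>)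
  define h :: "real \<Rightarrow> ennreal" where "h s = indicator (UNIV - N) (- s)" for s
  \<comment> \<open>The reflection in \<open>h\<close> makes convolution at 0 equal to the mass of
    the complement of \<open>N\<close>.\<close>
  have hm[measurable]: "h \<in> borel_measurable borel" unfolding h_def[abs_def] by measurable
  have pow0: "(conv_fun G ^^ m) h 0 = 0" for m
  proof -
    have "(conv_fun G ^^ m) h 0 = (\<integral>\<^sup>+x. indicator (UNIV - N) x \<partial>?\<mu> m)"
      by (simp add: W.conv_fun_pow_walk_law conv_fun_def h_def)
    also have "\<dots> = 0" by (subst nn_integral_indicator) (simp_all add: N\<mu>)
    finally show ?thesis .
  qed
  let ?f = "unit_fam r h"
  have mf: "meas_fam ?f" by (rule meas_fam_unit_fam) measurable
  have "Nop ?f r = h"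
  proof
    fix t
    have "R ?f = (\<lambda>i t. 0)" by (intro ext R_eq_0) (auto simp: unit_fam_def)
    then have "Nop ?f r t = ?f r t + Nop (\<lambda>i t. 0) r t" by (subst Vsum_unfold_right) simp
    also have "Nop (\<lambda>i t. 0) r t = 0" by (rule Vsum_zero)
    finally show "Nop ?f r t = h t" by (simp add: unit_fam_def)
  qed
  then have "Vsum q ?f r 0 \<le> 0"
    using Vsum_le_cycles[OF mf sigma_finite_G, of 0] by (simp add: pow0)
  then have T0: "(T ^^ k) ?f r 0 = 0" for k
    using sum_le_suminf[of "\<lambda>k. (T ^^ k) ?f r 0" "{k}"] by (simp add: Vsum_def)
  obtain k where k: "0 < (mat_act q ^^ k) (indicator {a}) r" using irreducible by blast
  obtain l where l: "0 < (mat_act q ^^ l) (indicator {r}) b" using irreducible by blast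
  let ?K = "pow_law q"
  have cm: "conv_fun (?K n i j) g \<in> borel_measurable borel" if "g \<in> borel_measurable borel" for n i j g
    by (rule measurable_conv_fun[OF sets_pow_law sigma_finite_pow_law that])
  have "conv_fun (?K k r a) (conv_fun (?K n a b) (conv_fun (?K l b r) h)) 0 \<le> (T ^^ (k + (n + l))) ?f r 0"
  proof -
    \<comment> \<open>Confining the intermediate state to \<open>j\<close> only loses weight. An
      inequality is enough because the right side of the whole chain is 0.\<close>
    have 1: "unit_fam j (conv_fun (?K m j j') g) i t \<le> (T ^^ m) (unit_fam j' g) i t"
      if "g \<in> borel_measurable borel" for j j' m g i t
      using that by (simp add: unit_fam_def[of j] conv_fun_pow_law indicator_def)
    have "conv_fun (?K k r a) (conv_fun (?K n a b) (conv_fun (?K l b r) h)) 0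
        = (T ^^ k) (unit_fam a (conv_fun (?K n a b) (conv_fun (?K l b r) h))) r 0"
      by (rule conv_fun_pow_law) (intro cm hm)
    also have "\<dots> \<le> (T ^^ k) ((T ^^ n) (unit_fam b (conv_fun (?K l b r) h))) r 0"
      by (rule mop_pow_mono) (intro 1 cm hm)
    also have "\<dots> \<le> (T ^^ k) ((T ^^ n) ((T ^^ l) ?f)) r 0"
      by (intro mop_pow_mono 1 hm)
    finally show ?thesis by (simp add: funpow_add)
  qed
  \<comment> \<open>The law in question is moved next to \<open>h\<close>, so that the two outer
    factors, both of positive mass, can be peeled off. Each peeling only provides some point
    \<open>s\<close> at which the rest vanishes, whence the translate \<open>N'\<close>
    below.\<close>
  then have "conv_fun (?K k r a) (conv_fun (?K l b r) (conv_fun (?K n a b) h)) 0 = 0"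
    unfolding T0
    by (subst conv_fun_commute[OF _ _ sigma_finite_pow_law sigma_finite_pow_law hm]) auto
  then obtain s where "conv_fun (?K l b r) (conv_fun (?K n a b) h) s = 0"
    using conv_fun_eq_0[OF sets_pow_law cm[OF cm[OF hm]]] k by (metis emeasure_pow_law)
  then obtain s where s: "conv_fun (?K n a b) h s = 0"
    using conv_fun_eq_0[OF sets_pow_law cm[OF hm]] l by (metis emeasure_pow_law)
  define N' where "N' = (\<lambda>x. x - s) -` N"
  have [measurable]: "N' \<in> sets borel"
    unfolding N'_def using measurable_sets[of "\<lambda>x. x - s" borel borel N] by simp
  have "emeasure lborel N' = 0"
  proof -
    have "emeasure lborel N = emeasure (distr lborel borel ((+) (- s))) N" by (simp add: lborel_distr_plus)
    also have "\<dots> = emeasure lborel N'" by (subst emeasure_distr) (auto simp: N'_def vimage_def)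
    finally show ?thesis using N0 by simp
  qed
  moreover have "emeasure (?K n a b) (UNIV - N') = 0"
  proof -
    have "conv_fun (?K n a b) h s = (\<integral>\<^sup>+x. indicator (UNIV - N') x \<partial>?K n a b)"
      unfolding conv_fun_def by (intro nn_integral_cong) (auto simp: h_def N'_def indicator_def)
    also have "\<dots> = emeasure (?K n a b) (UNIV - N')"
      by (rule nn_integral_indicator) simp
    finally show ?thesis using s by simp
  qed
  moreover have "N' \<in> sets borel" by measurable
  ultimately show ?thesis unfolding lebesgue_singular_def by blast
qed

text \<open>Here \<open>N\<close> acts before \<open>U\<close>: the single function
  \<open>Nop f r\<close> is bounded, vanishes at -\<infinity> and is Lebesgue integrable, all by
  means of the weights \<open>u\<close>, and Stone's argument applies to it. The constant that
  argument yields depends on the function, so it could not be used state by state.\<close>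

lemma Vsum_spread_out:
  assumes ns: "\<not> lebesgue_singular (pow_law q n a b)"
    and f: "meas_fam f" "\<And>j t. f j t \<le> c j" "(\<integral>\<^sup>+i. u i * c i \<partial>count_space UNIV) < \<infinity>"
      "\<And>j. (f j \<longlongrightarrow> 0) at_bot"
    and int: "(\<integral>\<^sup>+i. u i * (\<integral>\<^sup>+t. f i t \<partial>lborel) \<partial>count_space UNIV) < \<infinity>"
  shows "bounded_vanishing (Vsum q f r)"
proof -
  obtain m where m: "m > 0" "\<not> lebesgue_singular (distr W.paths borel (\<lambda>\<omega>. walk \<omega> m))"
    using lebesgue_singular_pow_law ns by blast
  have b: "Nop f r \<in> borel_measurable borel" by (intro meas_famD meas_fam_Vsum f)
  have bint: "(\<integral>\<^sup>+t. Nop f r t \<partial>lborel) < \<infinity>"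
  proof (rule ccontr)
    assume "\<not> ?thesis"
    then have "u r * (\<integral>\<^sup>+t. Nop f r t \<partial>lborel) = \<infinity>"
      using u_pos[of r] by (simp add: less_top[symmetric] ennreal_mult_eq_top_iff)
    then show False using le_less_trans[OF u_Nop_lborel_le[OF f(1)] int] by simp
  qed
  have "bounded_vanishing (W.renewal_sum (Nop f r))"
  proof (rule W.bounded_vanishing_renewal_sum[OF _ _ m(2) _ m(1) b Nop_bounded_vanishing[OF f] bint])
    show "finite_measure (distr W.paths borel (\<lambda>\<omega>. walk \<omega> m))"
      by (intro prob_space.finite_measure W.P.prob_space_distr) measurable
  qed (simp_all add: W.conv_fun_pow_walk_law)
  then show ?thesis
    by (rule bounded_vanishing_mono)
       (use Vsum_le_cycles[OF f(1) sigma_finite_G] in \<open>simp add: W.renewal_sum_def\<close>)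
qed

end

section \<open>Real-valued sums and integrals\<close>

lemma infsum_ennreal_count_space:
  fixes f :: "'k::countable \<Rightarrow> ennreal"
  shows "(\<Sum>\<^sub>\<infinity>x\<in>UNIV. f x) = (\<integral>\<^sup>+x. f x \<partial>count_space UNIV)"
proof -
  let ?S = "SUP A\<in>{A. finite A \<and> A \<subseteq> UNIV}. sum f A"
  have sum_eq: "sum f A = (\<integral>\<^sup>+x. f x * indicator A x \<partial>count_space UNIV)" if "finite A" for A
    using that by (subst nn_integral_count_space'[of A]) (auto simp: indicator_def)
  have "?S = (\<integral>\<^sup>+x. f x \<partial>count_space UNIV)"
  proof (rule antisym)
    show "?S \<le> (\<integral>\<^sup>+x. f x \<partial>count_space UNIV)"
    proof (rule SUP_least)
      fix A :: "'k set" assume "A \<in> {A. finite A \<and> A \<subseteq> UNIV}"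
      then have "sum f A = (\<integral>\<^sup>+x. f x * indicator A x \<partial>count_space UNIV)" using sum_eq by simp
      also have "\<dots> \<le> (\<integral>\<^sup>+x. f x \<partial>count_space UNIV)" by (intro nn_integral_mono) (auto simp: indicator_def)
      finally show "sum f A \<le> (\<integral>\<^sup>+x. f x \<partial>count_space UNIV)" .
    qed
    define A :: "nat \<Rightarrow> 'k set" where "A n = {x. to_nat x < n}" for n
    have "A n \<subseteq> from_nat ` {..<n}" for n
    proof
      fix x assume "x \<in> A n"
      then show "x \<in> from_nat ` {..<n}" by (intro image_eqI[of _ _ "to_nat x"]) (auto simp: A_def)
    qed
    then have fin: "finite (A n)" for n by (rule finite_subset) simp
    have "f x = (SUP n. f x * indicator (A n) x)" for x
    proof (rule antisym)
      have "f x = f x * indicator (A (Suc (to_nat x))) x" by (simp add: A_def)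
      also have "\<dots> \<le> (SUP n. f x * indicator (A n) x)" by (rule SUP_upper) simp
      finally show "f x \<le> (SUP n. f x * indicator (A n) x)" .
      show "(SUP n. f x * indicator (A n) x) \<le> f x" by (intro SUP_least) (auto simp: indicator_def)
    qed
    then have "(\<integral>\<^sup>+x. f x \<partial>count_space UNIV) = (\<integral>\<^sup>+x. (SUP n. f x * indicator (A n) x) \<partial>count_space UNIV)"
      by simp
    also have "\<dots> = (SUP n. \<integral>\<^sup>+x. f x * indicator (A n) x \<partial>count_space UNIV)"
      by (intro nn_integral_monotone_convergence_SUP)
         (auto simp: incseq_def le_fun_def A_def indicator_def)
    also have "\<dots> = (SUP n. sum f (A n))" using fin by (simp add: sum_eq)
    also have "\<dots> \<le> ?S" by (intro SUP_least SUP_upper) (use fin in auto)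
    finally show "(\<integral>\<^sup>+x. f x \<partial>count_space UNIV) \<le> ?S" .
  qed
  then show ?thesis by (subst nonneg_infsum_complete) auto
qed

lemma nn_integral_count_space_infsum:
  fixes f :: "'k \<Rightarrow> real"
  assumes nn: "\<And>x. 0 \<le> f x" and s: "f summable_on UNIV"
  shows "(\<integral>\<^sup>+x. ennreal (f x) \<partial>count_space UNIV) = ennreal (infsum f UNIV)"
proof -
  have abs: "Infinite_Set_Sum.abs_summable_on f UNIV"
    using s nn by (simp flip: abs_summable_equivalent)
  then have "integrable (count_space UNIV) f" by (simp add: Infinite_Set_Sum.abs_summable_on_def)
  then have "(\<integral>\<^sup>+x. ennreal (f x) \<partial>count_space UNIV) = ennreal (\<integral>x. f x \<partial>count_space UNIV)"
    by (rule nn_integral_eq_integral) (simp add: nn)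
  also have "(\<integral>x. f x \<partial>count_space UNIV) = infsum f UNIV"
    using infsetsum_infsum[OF abs] by (simp add: infsetsum_def)
  finally show ?thesis .
qed

lemma has_sum_enn2real:
  fixes A :: "'k \<Rightarrow> ennreal"
  assumes fin: "(\<integral>\<^sup>+x. A x \<partial>count_space UNIV) < \<infinity>"
  shows "((\<lambda>x. enn2real (A x)) has_sum enn2real (\<integral>\<^sup>+x. A x \<partial>count_space UNIV)) UNIV"
proof -
  have Afin: "A x < \<top>" for x using le_less_trans[OF nn_integral_count_space_upper fin] by simp
  have eq: "(\<integral>\<^sup>+x. ennreal (enn2real (A x)) \<partial>count_space UNIV) = (\<integral>\<^sup>+x. A x \<partial>count_space UNIV)"
    using Afin by simp
  have "integrable (count_space UNIV) (\<lambda>x. enn2real (A x))"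
    by (rule integrableI_bounded) (use fin eq in auto)
  then have "Infinite_Set_Sum.abs_summable_on (\<lambda>x. enn2real (A x)) UNIV"
    by (simp add: Infinite_Set_Sum.abs_summable_on_def)
  then have s: "(\<lambda>x. enn2real (A x)) summable_on UNIV"
    by (simp flip: abs_summable_equivalent)
  have "ennreal (infsum (\<lambda>x. enn2real (A x)) UNIV) = (\<integral>\<^sup>+x. A x \<partial>count_space UNIV)"
    using nn_integral_count_space_infsum[OF _ s] eq by simp
  then have "infsum (\<lambda>x. enn2real (A x)) UNIV = enn2real (\<integral>\<^sup>+x. A x \<partial>count_space UNIV)"
    by (metis enn2real_ennreal enn2real_nonneg infsum_nonneg)
  with s show ?thesis by (metis has_sum_infsum)
qed

text \<open>The bridge from signed sums of Bochner integrals to \<open>ennreal\<close>: absolute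
  convergence of both parts ensures that no default value of a sum or integral affects the
  result.\<close>

lemma weighted_integral_diff:
  fixes c :: "'k::countable \<Rightarrow> real" and M :: "'k \<Rightarrow> real measure"
  assumes c: "\<And>j. 0 \<le> c j" and sets: "\<And>j. sets (M j) = sets borel"
    and A: "\<And>j. A j \<in> borel_measurable borel" "\<And>j x. A j x < \<infinity>"
      "(\<integral>\<^sup>+j. ennreal (c j) * (\<integral>\<^sup>+x. A j x \<partial>M j) \<partial>count_space UNIV) < \<infinity>"
    and B: "\<And>j. B j \<in> borel_measurable borel" "\<And>j x. B j x < \<infinity>"
      "(\<integral>\<^sup>+j. ennreal (c j) * (\<integral>\<^sup>+x. B j x \<partial>M j) \<partial>count_space UNIV) < \<infinity>"
  shows "(\<Sum>\<^sub>\<infinity>j\<in>UNIV. c j * (\<integral>x. enn2real (A j x) - enn2real (B j x) \<partial>M j)) =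
    enn2real (\<integral>\<^sup>+j. ennreal (c j) * (\<integral>\<^sup>+x. A j x \<partial>M j) \<partial>count_space UNIV)
    - enn2real (\<integral>\<^sup>+j. ennreal (c j) * (\<integral>\<^sup>+x. B j x \<partial>M j) \<partial>count_space UNIV)"
proof -
  have one: "integrable (M j) (\<lambda>x. enn2real (A j x)) \<and> (\<integral>x. enn2real (A j x) \<partial>M j) = enn2real (\<integral>\<^sup>+x. A j x \<partial>M j)"
    if A: "\<And>j. A j \<in> borel_measurable borel" "\<And>j x. A j x < \<infinity>"
      "(\<integral>\<^sup>+j. ennreal (c j) * (\<integral>\<^sup>+x. A j x \<partial>M j) \<partial>count_space UNIV) < \<infinity>" and j: "c j \<noteq> 0"
    for A :: "'k \<Rightarrow> real \<Rightarrow> ennreal" and j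
  proof -
    note [measurable_cong] = sets and [measurable] = A(1)
    have "ennreal (c j) * (\<integral>\<^sup>+x. A j x \<partial>M j) < \<infinity>"
      by (rule le_less_trans[OF nn_integral_count_space_upper A(3)])
    moreover have "0 < c j" using j c[of j] by simp
    ultimately have fin: "(\<integral>\<^sup>+x. A j x \<partial>M j) < \<infinity>"
      by (auto simp: less_top[symmetric] ennreal_mult_eq_top_iff)
    have eq: "(\<integral>\<^sup>+x. ennreal (enn2real (A j x)) \<partial>M j) = (\<integral>\<^sup>+x. A j x \<partial>M j)"
      using A(2) by simp
    have "integrable (M j) (\<lambda>x. enn2real (A j x))"
      by (rule integrableI_bounded) (use fin eq in auto)
    moreover have "(\<integral>x. enn2real (A j x) \<partial>M j) = enn2real (\<integral>\<^sup>+x. A j x \<partial>M j)"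
      by (subst integral_eq_nn_integral) (auto simp: eq)
    ultimately show ?thesis by blast
  qed
  have term_eq: "c j * (\<integral>x. enn2real (A j x) - enn2real (B j x) \<partial>M j)
     = enn2real (ennreal (c j) * (\<integral>\<^sup>+x. A j x \<partial>M j)) - enn2real (ennreal (c j) * (\<integral>\<^sup>+x. B j x \<partial>M j))" for j
  \<comment> \<open>For weight 0 the inner integrals may diverge and take default values; the factor
    0 makes this harmless.\<close>
  proof (cases "c j = 0")
    case False
    show ?thesis
      using one[OF A False] one[OF B False] c[of j]
      by (simp add: enn2real_mult right_diff_distrib)
  qed simp
  let ?a = "\<lambda>j. ennreal (c j) * (\<integral>\<^sup>+x. A j x \<partial>M j)" and ?b = "\<lambda>j. ennreal (c j) * (\<integral>\<^sup>+x. B j x \<partial>M j)"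
  have "((\<lambda>j. - enn2real (?b j)) has_sum - enn2real (\<integral>\<^sup>+j. ?b j \<partial>count_space UNIV)) UNIV"
    using has_sum_enn2real[OF B(3)] by (simp add: has_sum_uminus)
  from has_sum_add[OF has_sum_enn2real[OF A(3)] this]
  have "((\<lambda>j. enn2real (?a j) - enn2real (?b j)) has_sum
    enn2real (\<integral>\<^sup>+j. ?a j \<partial>count_space UNIV) - enn2real (\<integral>\<^sup>+j. ?b j \<partial>count_space UNIV)) UNIV"
    by simp
  then show ?thesis unfolding term_eq by (rule infsumI)
qed

lemma nn_integral_measure_suminf:
  assumes sets: "sets M = sets borel" "\<And>n. sets (N n) = sets borel"
    and em: "\<And>E. E \<in> sets borel \<Longrightarrow> emeasure M E = (\<Sum>n. emeasure (N n) E)"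
    and f: "f \<in> borel_measurable (borel :: real measure)"
  shows "(\<integral>\<^sup>+x. f x \<partial>M) = (\<Sum>n. \<integral>\<^sup>+x. f x \<partial>N n)"
proof -
  note [measurable_cong] = sets
  show ?thesis using f
  proof (induction f rule: borel_measurable_induct)
    case (set E)
    then show ?case using sets em by simp
  next
    case (mult u c)
    from mult have [measurable]: "u \<in> borel_measurable borel" by simp
    show ?case using mult by (simp add: nn_integral_cmult)
  next
    case (add u v)
    from add have [measurable]: "u \<in> borel_measurable borel" "v \<in> borel_measurable borel" by auto
    show ?case using add by (simp add: nn_integral_add suminf_add)
  next
    case (seq U)
    from seq have [measurable]: "U n \<in> borel_measurable borel" for n by auto
    have inc: "incseq (\<lambda>n. \<integral>\<^sup>+x. U n x \<partial>K)" for K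
      using seq(3) by (auto simp: incseq_def le_fun_def intro!: nn_integral_mono)
    have "(\<integral>\<^sup>+x. (SUP n. U n x) \<partial>M) = (SUP n. \<Sum>k. \<integral>\<^sup>+x. U n x \<partial>N k)"
      using seq by (simp add: nn_integral_monotone_convergence_SUP)
    also have "\<dots> = (\<Sum>k. SUP n. \<integral>\<^sup>+x. U n x \<partial>N k)"
      by (rule ennreal_suminf_SUP_eq[symmetric]) (rule inc)
    also have "\<dots> = (\<Sum>k. \<integral>\<^sup>+x. (SUP n. U n x) \<partial>N k)"
      using seq(3) by (simp add: nn_integral_monotone_convergence_SUP)
    finally show ?case by (simp add: image_comp SUP_apply[abs_def])
  qed (simp add: ext)
qed

lemma interval_measure_cdf:
  assumes "finite_borel_measure M" shows "interval_measure (cdf M) = M"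
proof -
  interpret finite_borel_measure M by fact
  show ?thesis
  proof (rule cdf_unique')
    show "finite_borel_measure (interval_measure (cdf M))"
      by (rule finite_borel_measure_interval_measure[OF cdf_nondecreasing cdf_is_right_cont cdf_lim_at_bot cdf_lim_at_top])
         simp_all
    show "cdf (interval_measure (cdf M)) = cdf M"
      by (rule cdf_interval_measure[OF cdf_nondecreasing cdf_is_right_cont cdf_lim_at_bot])
  qed (rule assms)
qed

section \<open>Correspondence with the renewal measure\<close>

locale renewal_data = conv_matrix F
  for F :: "'s::countable \<Rightarrow> 's \<Rightarrow> real measure" +
  fixes Q :: "'s \<Rightarrow> 's \<Rightarrow> real" and v :: "'s \<Rightarrow> real"
  assumes Q_nonneg: "Q i j \<ge> 0"
    and right: "positive_right_eigenvector Q v"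
begin

definition q :: "'s \<Rightarrow> 's \<Rightarrow> ennreal" where "q i j = ennreal (Q i j)"

lemma v_gt: "v i > 0"
  using right by (simp add: positive_right_eigenvector_def)

lemma mat_pow_facts':
  "0 \<le> mat_pow Q n i j" "mat_pow Q n i j \<le> v i / v j"
  "(\<lambda>k. Q i k * mat_pow Q n k j) summable_on UNIV"
  using mat_pow_facts[where Q = Q and v = v and F = F and n = n and i = i and j = j]
    Q_nonneg right real_distribution_F by auto

lemma conv_pow_facts':
  "0 \<le> conv_pow Q F n i j t" "conv_pow Q F n i j t \<le> mat_pow Q n i j"
  "mono (conv_pow Q F n i j)"
  using conv_pow_facts[where Q = Q and v = v and F = F and n = n and i = i and j = j]
    Q_nonneg right real_distribution_F by auto

lemma mat_act_pow_eq: "(mat_act q ^^ n) (indicator {j}) i = ennreal (mat_pow Q n i j)"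
proof (induction n arbitrary: i)
  case (Suc n)
  have "(mat_act q ^^ Suc n) (indicator {j}) i = (\<integral>\<^sup>+k. ennreal (Q i k * mat_pow Q n k j) \<partial>count_space UNIV)"
    using mat_pow_facts' Q_nonneg by (simp add: mat_act_def Suc q_def ennreal_mult)
  also have "\<dots> = ennreal (mat_pow Q (Suc n) i j)"
    using mat_pow_facts' Q_nonneg by (subst nn_integral_count_space_infsum) auto
  finally show ?case .
qed (simp add: indicator_def)

text \<open>Convolution with the indicator of \<open>{0..}\<close> gives the distribution function,
  and for \<open>n = 0\<close> the unit step. This ties the operator iterates to the real-valued
  powers of the definitions.\<close>

lemma mop_pow_conv_pow:
  "(mop q ^^ n) (unit_fam j (indicator {0..})) i t = ennreal (conv_pow Q F n i j t)"
proof (induction n arbitrary: i t)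
  case 0
  show ?case by (simp add: unit_fam_def indicator_def)
next
  case (Suc n)
  have nn: "0 \<le> conv_pow Q F n k j t" and le: "conv_pow Q F n k j t \<le> mat_pow Q n k j" for k t
    by (rule conv_pow_facts')+
  have m[measurable]: "conv_pow Q F n k j \<in> borel_measurable borel" for k
    by (intro borel_measurable_mono conv_pow_facts')
  have int: "integrable (F i k) (\<lambda>x. conv_pow Q F n k j (t - x))" for k
  proof -
    interpret prob_space "F i k" by (rule prob_F)
    show ?thesis by (rule integrable_const_bound[where B = "mat_pow Q n k j"]) (use nn le in auto)
  qed
  have I0: "0 \<le> (\<integral>x. conv_pow Q F n k j (t - x) \<partial>F i k)" for k by (simp add: nn)
  have IM: "(\<integral>x. conv_pow Q F n k j (t - x) \<partial>F i k) \<le> mat_pow Q n k j" for k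
  proof -
    interpret prob_space "F i k" by (rule prob_F)
    show ?thesis using integral_le_const[OF int] le by auto
  qed
  have s: "(\<lambda>k. Q i k * (\<integral>x. conv_pow Q F n k j (t - x) \<partial>F i k)) summable_on UNIV"
    by (rule summable_on_comparison_test[of "\<lambda>k. Q i k * mat_pow Q n k j"])
       (use mat_pow_facts'(3)[of i n j] Q_nonneg I0 IM in \<open>auto intro: mult_left_mono\<close>)
  have "(mop q ^^ n) (unit_fam j (indicator {0..})) = (\<lambda>k t. ennreal (conv_pow Q F n k j t))"
    using Suc by (intro ext)
  then have "(mop q ^^ Suc n) (unit_fam j (indicator {0..})) i t
      = (\<integral>\<^sup>+k. q i k * (\<integral>\<^sup>+x. ennreal (conv_pow Q F n k j (t - x)) \<partial>F i k) \<partial>count_space UNIV)"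
    by (simp add: mop_def conv_fun_def)
  also have "\<dots> = (\<integral>\<^sup>+k. ennreal (Q i k * (\<integral>x. conv_pow Q F n k j (t - x) \<partial>F i k)) \<partial>count_space UNIV)"
    using nn_integral_eq_integral[OF int] nn I0 Q_nonneg by (simp add: q_def ennreal_mult)
  also have "\<dots> = ennreal (conv_pow Q F (Suc n) i j t)"
    using I0 Q_nonneg s by (subst nn_integral_count_space_infsum) auto
  finally show ?case .
qed

lemma finite_borel_pow_law: "finite_borel_measure (pow_law q n i j)"
proof (intro finite_borel_measure.intro finite_borel_measure_axioms.intro sets_pow_law)
  show "finite_measure (pow_law q n i j)"
    by standard (simp add: emeasure_pow_law mat_act_pow_eq)
qed

lemma cdf_pow_law: "cdf (pow_law q n i j) = conv_pow Q F n i j"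
proof
  fix t
  have "emeasure (pow_law q n i j) {..t} = conv_fun (pow_law q n i j) (indicator {0..}) t"
  proof -
    have "emeasure (pow_law q n i j) {..t} = (\<integral>\<^sup>+x. indicator {..t} x \<partial>pow_law q n i j)" by simp
    also have "\<dots> = conv_fun (pow_law q n i j) (indicator {0..}) t"
      unfolding conv_fun_def by (intro nn_integral_cong) (auto simp: indicator_def)
    finally show ?thesis .
  qed
  also have "\<dots> = ennreal (conv_pow Q F n i j t)"
    by (subst conv_fun_pow_law) (simp_all add: mop_pow_conv_pow)
  finally show "cdf (pow_law q n i j) t = conv_pow Q F n i j t"
    by (simp add: cdf_def measure_def conv_pow_facts'(1))
qed

lemma interval_measure_conv_pow: "interval_measure (conv_pow Q F n i j) = pow_law q n i j"
  using interval_measure_cdf[OF finite_borel_pow_law] by (simp add: cdf_pow_law)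

text \<open>\<open>conv_law\<close> differs from \<open>pow_law\<close> by a positive constant
  factor, which leaves null sets unchanged.\<close>

lemma lebesgue_singular_conv_law:
  assumes "lebesgue_singular (pow_law q n i j)" "mat_pow Q n i j > 0"
  shows "lebesgue_singular (conv_law Q F n i j)"
proof -
  define c where "c = mat_pow Q n i j"
  have c: "c > 0" using assms(2) by (simp add: c_def)
  let ?M = "scale_measure (ennreal (1 / c)) (pow_law q n i j)"
  interpret K: finite_borel_measure "pow_law q n i j" by (rule finite_borel_pow_law)
  have "finite_borel_measure ?M"
  proof (intro finite_borel_measure.intro finite_borel_measure_axioms.intro)
    show "finite_measure ?M"
      by standard (simp add: space_scale_measure ennreal_mult_eq_top_iff)
  qed simp
  moreover have "cdf ?M = (\<lambda>t. conv_pow Q F n i j t / c)"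
  proof
    fix t
    show "cdf ?M t = conv_pow Q F n i j t / c"
      using c cdf_pow_law[of n i j, THEN fun_cong, of t]
      by (simp add: cdf_def measure_def enn2real_mult)
  qed
  ultimately have "conv_law Q F n i j = ?M"
    using interval_measure_cdf[of ?M] by (simp add: conv_law_def c_def)
  then show ?thesis using assms(1) by (auto simp: lebesgue_singular_def)
qed

lemma sets_renewal_measure[simp, measurable_cong]: "sets (renewal_measure Q F i j) = sets borel"
  by (simp add: renewal_measure_def sets.sigma_sets_eq[of borel, simplified])

lemma nn_integral_renewal_measure:
  assumes "h \<in> borel_measurable borel"
  shows "(\<integral>\<^sup>+x. h (t - x) \<partial>renewal_measure Q F i j) = (\<Sum>n. (mop q ^^ n) (unit_fam j h) i t)"
proof -
  have "(\<integral>\<^sup>+x. h (t - x) \<partial>renewal_measure Q F i j) = (\<Sum>n. \<integral>\<^sup>+x. h (t - x) \<partial>pow_law q n i j)"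
  proof (rule nn_integral_measure_suminf)
    show "emeasure (renewal_measure Q F i j) E = (\<Sum>n. emeasure (pow_law q n i j) E)"
      if "E \<in> sets borel" for E
      by (simp add: emeasure_renewal_measure[OF Q_nonneg right real_distribution_F that] interval_measure_conv_pow)
    note [measurable] = assms
    show "(\<lambda>x. h (t - x)) \<in> borel_measurable borel" by measurable
  qed simp_all
  also have "\<dots> = (\<Sum>n. (mop q ^^ n) (unit_fam j h) i t)"
    using conv_fun_pow_law[OF assms] by (simp add: conv_fun_def)
  finally show ?thesis .
qed

lemma sum_renewal_measure:
  assumes f: "meas_fam f"
  shows "(\<integral>\<^sup>+j. \<integral>\<^sup>+x. f j (t - x) \<partial>renewal_measure Q F i j \<partial>count_space UNIV) = (\<Sum>n. (mop q ^^ n) f i t)"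
proof -
  have "(\<integral>\<^sup>+j. unit_fam j (f j) k t \<partial>count_space UNIV) = f k t" for k t
    by (subst nn_integral_count_space_single[of k]) (auto simp: unit_fam_def)
  then have fe: "f = (\<lambda>k t. \<integral>\<^sup>+j. unit_fam j (f j) k t \<partial>count_space UNIV)" by simp
  have "(\<integral>\<^sup>+j. \<integral>\<^sup>+x. f j (t - x) \<partial>renewal_measure Q F i j \<partial>count_space UNIV)
      = (\<integral>\<^sup>+j. (\<Sum>n. (mop q ^^ n) (unit_fam j (f j)) i t) \<partial>count_space UNIV)"
    by (simp add: nn_integral_renewal_measure meas_famD[OF f])
  also have "\<dots> = (\<Sum>n. \<integral>\<^sup>+j. (mop q ^^ n) (unit_fam j (f j)) i t \<partial>count_space UNIV)"
    by (rule nn_integral_suminf) simp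
  also have "\<dots> = (\<Sum>n. (mop q ^^ n) f i t)"
    by (subst (2) fe) (simp add: mop_pow_count_sum meas_fam_unit_fam meas_famD[OF f])
  finally show ?thesis .
qed

end

section \<open>Function classes and the renewal equation\<close>

lemma sup_norm_upper: "ennreal \<bar>h t\<bar> \<le> sup_norm h"
  unfolding sup_norm_def by (rule SUP_upper) simp

lemma sup_norm_least: "(\<And>t. ennreal \<bar>h t\<bar> \<le> C) \<Longrightarrow> sup_norm h \<le> C"
  unfolding sup_norm_def by (rule SUP_least)

lemma sup_norm_diff: "sup_norm (\<lambda>t. f t - g t) \<le> sup_norm f + sup_norm g"
proof (rule sup_norm_least)
  fix t
  have "ennreal \<bar>f t - g t\<bar> \<le> ennreal (\<bar>f t\<bar> + \<bar>g t\<bar>)" by (intro ennreal_leI) simp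
  also have "\<dots> \<le> sup_norm f + sup_norm g"
    by (simp add: ennreal_plus add_mono sup_norm_upper)
  finally show "ennreal \<bar>f t - g t\<bar> \<le> sup_norm f + sup_norm g" .
qed

lemma tendsto_ennreal_abs_iff: "((\<lambda>t. ennreal \<bar>h t\<bar>) \<longlongrightarrow> 0) F \<longleftrightarrow> (h \<longlongrightarrow> 0) F"
  using tendsto_ennreal_iff[of "\<lambda>t. \<bar>h t\<bar>" F 0] by (simp add: tendsto_rabs_zero_iff)

lemma measurable_family_diff:
  assumes "measurable_family Y" "measurable_family Z"
  shows "measurable_family (\<lambda>i t. Y i t - Z i t)"
proof -
  have [measurable]: "Y i \<in> borel_measurable borel" "Z i \<in> borel_measurable borel" for i
    using assms by (simp_all add: measurable_family_def)
  show ?thesis unfolding measurable_family_def by measurable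
qed

lemma class_L0_diff:
  assumes "Y \<in> class_L0 v" "Z \<in> class_L0 v"
  shows "(\<lambda>i t. Y i t - Z i t) \<in> class_L0 v"
proof -
  let ?n = "\<lambda>X i. sup_norm (\<lambda>t. X i t / v i)"
  have le: "?n (\<lambda>i t. Y i t - Z i t) i \<le> ?n Y i + ?n Z i" for i
    unfolding diff_divide_distrib by (rule sup_norm_diff)
  have "?n Y i + ?n Z i < \<infinity>" for i
    using assms by (auto simp: class_L0_def class_L_def)
  then have fin: "?n (\<lambda>i t. Y i t - Z i t) i < \<infinity>" for i by (rule le_less_trans[OF le])
  have "(SUP i. ?n (\<lambda>i t. Y i t - Z i t) i) \<le> (SUP i. ?n Y i) + (SUP i. ?n Z i)"
    by (intro SUP_least order_trans[OF le] add_mono SUP_upper) simp_all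
  also have "\<dots> < \<infinity>" using assms by (auto simp: class_L0_def)
  finally have "(SUP i. ?n (\<lambda>i t. Y i t - Z i t) i) < \<infinity>" .
  moreover have "measurable_family (\<lambda>i t. Y i t - Z i t)"
    using assms by (intro measurable_family_diff) (auto simp: class_L0_def class_L_def)
  moreover have "((\<lambda>t. (Y i t - Z i t) / v i) \<longlongrightarrow> 0) at_bot" for i
    unfolding diff_divide_distrib
    using assms tendsto_diff[of "\<lambda>t. Y i t / v i" 0 at_bot "\<lambda>t. Z i t / v i" 0]
    by (simp add: class_L0_def class_L_def)
  ultimately show ?thesis using fin by (simp add: class_L0_def class_L_def)
qed

lemma class_L_finite:
  fixes Z :: "'s \<Rightarrow> real \<Rightarrow> real"
  assumes "finite (UNIV :: 's set)" "Z \<in> class_L v" shows "Z \<in> class_L0 v"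
proof -
  let ?n = "\<lambda>i. sup_norm (\<lambda>t. Z i t / v i)"
  have "(SUP i. ?n i) \<le> (\<Sum>i\<in>UNIV. ?n i)"
    by (intro SUP_least member_le_sum) (use assms(1) in auto)
  also have "\<dots> < \<infinity>" using assms by (auto simp: class_L_def less_top[symmetric])
  finally show ?thesis using assms(2) by (simp add: class_L0_def)
qed

lemma enn2real_pos_neg: "enn2real (ennreal x) - enn2real (ennreal (- x)) = x"
  by (cases "0 \<le> x") (auto simp: ennreal_neg)

lemma ennreal_abs_pos_neg: "ennreal \<bar>x\<bar> = ennreal x + ennreal (- x)"
  by (cases "0 \<le> x") (auto simp: ennreal_neg)

lemma ennreal_le_if_le_enn2real:
  assumes "x \<le> enn2real r" "r < \<infinity>" shows "ennreal x \<le> r"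
  using ennreal_leI[OF assms(1)] ennreal_enn2real[of r] assms(2) by (simp only: infinity_ennreal_def)

lemma enn2real_add:
  "a < \<infinity> \<Longrightarrow> b < \<infinity> \<Longrightarrow> enn2real (a + b) = enn2real a + enn2real b"
  by (rule enn2real_plus) auto

context renewal_data
begin

lemma meas_fam_ennreal:
  assumes "measurable_family Y"
  shows "meas_fam (\<lambda>j t. ennreal (Y j t))" "meas_fam (\<lambda>j t. ennreal (- Y j t))"
    "meas_fam (\<lambda>j t. ennreal \<bar>Y j t\<bar>)"
proof -
  have [measurable]: "Y j \<in> borel_measurable borel" for j using assms by (simp add: measurable_family_def)
  show "meas_fam (\<lambda>j t. ennreal (Y j t))" "meas_fam (\<lambda>j t. ennreal (- Y j t))"
    "meas_fam (\<lambda>j t. ennreal \<bar>Y j t\<bar>)"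
    unfolding meas_fam_def by measurable
qed

lemma mop_abs:
  assumes "measurable_family Y"
  shows "mop q (\<lambda>j t. ennreal \<bar>Y j t\<bar>) i t
    = mop q (\<lambda>j t. ennreal (Y j t)) i t + mop q (\<lambda>j t. ennreal (- Y j t)) i t"
  unfolding ennreal_abs_pos_neg by (rule mop_add) (rule meas_fam_ennreal[OF assms])+

text \<open>Absolute existence makes the positive and the negative part finite, so the sum in the
  equation is a true difference of two \<open>ennreal\<close> values.\<close>

lemma solves_renewal_equation_iff:
  assumes Y: "measurable_family Y"
  shows "solves_renewal_equation Q F z Y \<longleftrightarrow>
    (\<forall>i t. mop q (\<lambda>j t. ennreal \<bar>Y j t\<bar>) i t < \<infinity> \<and>
      Y i t = z i t + (enn2real (mop q (\<lambda>j t. ennreal (Y j t)) i t) - enn2real (mop q (\<lambda>j t. ennreal (- Y j t)) i t)))"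
proof -
  have 1: "(\<Sum>\<^sub>\<infinity>j\<in>UNIV. ennreal (Q i j) * (\<integral>\<^sup>+x. ennreal \<bar>Y j (t - x)\<bar> \<partial>F i j))
     = mop q (\<lambda>j t. ennreal \<bar>Y j t\<bar>) i t" for i t
    by (simp add: infsum_ennreal_count_space mop_def conv_fun_def q_def)
  have 2: "(\<Sum>\<^sub>\<infinity>j\<in>UNIV. Q i j * (\<integral>x. Y j (t - x) \<partial>F i j))
     = enn2real (mop q (\<lambda>j t. ennreal (Y j t)) i t) - enn2real (mop q (\<lambda>j t. ennreal (- Y j t)) i t)"
    if fin: "mop q (\<lambda>j t. ennreal \<bar>Y j t\<bar>) i t < \<infinity>" for i t
  proof -
    have [measurable]: "Y j \<in> borel_measurable borel" for j using Y by (simp add: measurable_family_def)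
    have fin': "mop q (\<lambda>j t. ennreal (Y j t)) i t < \<infinity>" "mop q (\<lambda>j t. ennreal (- Y j t)) i t < \<infinity>"
      using fin by (auto simp: mop_abs[OF Y])
    have "(\<Sum>\<^sub>\<infinity>j\<in>UNIV. Q i j * (\<integral>x. enn2real (ennreal (Y j (t - x))) - enn2real (ennreal (- Y j (t - x))) \<partial>F i j))
      = enn2real (\<integral>\<^sup>+j. ennreal (Q i j) * (\<integral>\<^sup>+x. ennreal (Y j (t - x)) \<partial>F i j) \<partial>count_space UNIV)
      - enn2real (\<integral>\<^sup>+j. ennreal (Q i j) * (\<integral>\<^sup>+x. ennreal (- Y j (t - x)) \<partial>F i j) \<partial>count_space UNIV)"
      by (rule weighted_integral_diff) (use fin' in \<open>simp_all add: Q_nonneg mop_def conv_fun_def q_def\<close>)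
    then show ?thesis by (simp only: enn2real_pos_neg mop_def conv_fun_def q_def)
  qed
  show ?thesis unfolding solves_renewal_equation_def 1 using 2 by (metis (no_types, lifting))
qed

text \<open>Subtracting the two equations cancels \<open>z\<close>. If the right side is infinite
  nothing is claimed; otherwise the one-sided estimate is applied to both orders of the
  solutions.\<close>

lemma difference_subharmonic:
  assumes Y: "measurable_family Y" "solves_renewal_equation Q F z Y"
    and Z: "measurable_family Z" "solves_renewal_equation Q F z Z"
  shows "ennreal \<bar>Y i t - Z i t\<bar> \<le> mop q (\<lambda>j t. ennreal \<bar>Y j t - Z j t\<bar>) i t"
proof -
  have main: "X i t - W i t \<le> enn2real (mop q (\<lambda>j t. ennreal \<bar>X j t - W j t\<bar>) i t)"
    if X: "measurable_family X" "solves_renewal_equation Q F z X"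
      and W: "measurable_family W" "solves_renewal_equation Q F z W"
      and fin: "mop q (\<lambda>j t. ennreal \<bar>X j t - W j t\<bar>) i t < \<infinity>" for X W
  proof -
    let ?p = "\<lambda>X. mop q (\<lambda>j t. ennreal (X j t)) i t" and ?m = "\<lambda>X. mop q (\<lambda>j t. ennreal (- X j t)) i t"
    let ?d = "mop q (\<lambda>j t. ennreal \<bar>X j t - W j t\<bar>) i t"
    have XWm: "measurable_family (\<lambda>j t. X j t - W j t)" by (rule measurable_family_diff[OF X(1) W(1)])
    note m = meas_fam_ennreal[OF X(1)] meas_fam_ennreal[OF W(1)] meas_fam_ennreal[OF XWm]
    note X_eq = X(2)[unfolded solves_renewal_equation_iff[OF X(1)], THEN spec[of _ i], THEN spec[of _ t]]
    have X': "mop q (\<lambda>j t. ennreal \<bar>X j t\<bar>) i t < \<infinity>" "X i t = z i t + (enn2real (?p X) - enn2real (?m X))"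
      by (rule X_eq[THEN conjunct1], rule X_eq[THEN conjunct2])
    note W_eq = W(2)[unfolded solves_renewal_equation_iff[OF W(1)], THEN spec[of _ i], THEN spec[of _ t]]
    have W': "mop q (\<lambda>j t. ennreal \<bar>W j t\<bar>) i t < \<infinity>" "W i t = z i t + (enn2real (?p W) - enn2real (?m W))"
      by (rule W_eq[THEN conjunct1], rule W_eq[THEN conjunct2])
    have fins: "?p X < \<infinity>" "?m X < \<infinity>" "?p W < \<infinity>" "?m W < \<infinity>"
      using X'(1) W'(1) by (auto simp: mop_abs[OF X(1)] mop_abs[OF W(1)])
    \<comment> \<open>This is \<open>x - w \<le> \<bar>x - w\<bar>\<close> with all terms moved so
      that no subtraction occurs in \<open>ennreal\<close>.\<close>
    have pt: "ennreal x + ennreal (- w) \<le> (ennreal (- x) + ennreal w) + ennreal \<bar>x - w\<bar>" for x w :: real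
    proof -
      have "max x 0 + max (- w) 0 \<le> max (- x) 0 + max w 0 + max \<bar>x - w\<bar> 0" by auto
      then show ?thesis
        by (subst (1 2 3 4 5) ennreal_max0) (simp only: ennreal_plus[symmetric] max.cobounded2 add_nonneg_nonneg ennreal_leI)
    qed
    have "?p X + ?m W = mop q (\<lambda>j t. ennreal (X j t) + ennreal (- W j t)) i t"
      by (rule mop_add[symmetric]) (rule m)+
    also have "\<dots> \<le> mop q (\<lambda>j t. (ennreal (- X j t) + ennreal (W j t)) + ennreal \<bar>X j t - W j t\<bar>) i t"
      by (rule mop_mono) (rule pt)
    also have "\<dots> = mop q (\<lambda>j t. ennreal (- X j t) + ennreal (W j t)) i t + ?d"
      by (rule mop_add) (intro m meas_fam_add)+
    also have "mop q (\<lambda>j t. ennreal (- X j t) + ennreal (W j t)) i t = ?m X + ?p W"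
      by (rule mop_add) (rule m)+
    finally have "enn2real (?p X + ?m W) \<le> enn2real (?m X + ?p W + ?d)"
      by (rule enn2real_mono) (use fins fin in simp)
    then show ?thesis using fins fin X'(2) W'(2) by (simp add: enn2real_add)
  qed
  show ?thesis
  proof (cases "mop q (\<lambda>j t. ennreal \<bar>Y j t - Z j t\<bar>) i t < \<infinity>")
    case True
    then have T': "mop q (\<lambda>j t. ennreal \<bar>Z j t - Y j t\<bar>) i t < \<infinity>" by (simp add: abs_minus_commute)
    have "\<bar>Y i t - Z i t\<bar> \<le> enn2real (mop q (\<lambda>j t. ennreal \<bar>Y j t - Z j t\<bar>) i t)"
      using main[OF Y Z True] main[OF Z Y T'] by (simp add: abs_minus_commute abs_le_iff)
    then show ?thesis using True by (rule ennreal_le_if_le_enn2real)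
  qed (simp add: less_top[symmetric])
qed

text \<open>Separates the algebra of the equation from the probabilistic input, which enters only
  through \<open>bv\<close> and \<open>zero\<close>.\<close>

lemma renewal_theorem_from_bounds:
  assumes z: "measurable_family z"
    and bv: "\<And>i. bounded_vanishing (Vsum q (\<lambda>j t. ennreal \<bar>z j t\<bar>) i)"
    and zero: "\<And>D K i t. meas_fam D \<Longrightarrow> (\<And>j t. D j t \<le> mop q D j t) \<Longrightarrow>
      (\<And>j t. D j t \<le> K * ennreal (v j)) \<Longrightarrow> K < \<infinity> \<Longrightarrow> (\<And>j. (D j \<longlongrightarrow> 0) at_bot) \<Longrightarrow> D i t = 0"
  defines "Z \<equiv> renewal_conv Q F z"
  shows "renewal_conv_exists Q F z \<and> Z \<in> class_L v \<and>
    unique_solution_in (class_L0_at v Z) Q F z Z \<and>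
    (finite (UNIV :: 's set) \<or> Z \<in> class_L0 v \<longrightarrow> unique_solution_in (class_L0 v) Q F z Z)"
proof -
  let ?fp = "\<lambda>j t. ennreal (z j t)" and ?fm = "\<lambda>j t. ennreal (- z j t)" and ?f = "\<lambda>j t. ennreal \<bar>z j t\<bar>"
  note m = meas_fam_ennreal[OF z]
  have zm[measurable]: "z j \<in> borel_measurable borel" for j using z by (simp add: measurable_family_def)
  define a where "a = Vsum q ?fp"
  define b where "b = Vsum q ?fm"
  have ab: "Vsum q ?f i t = a i t + b i t" for i t
    unfolding a_def b_def ennreal_abs_pos_neg by (rule Vsum_add) (rule m)+
  have Vfin: "Vsum q ?f i t < \<infinity>" for i t
    using bv[of i] by (auto simp: bounded_vanishing_def intro: le_less_trans)
  have fin: "a i t < \<infinity>" "b i t < \<infinity>" for i t using Vfin[of i t] by (auto simp: ab)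
  have mab: "meas_fam a" "meas_fam b" unfolding a_def b_def by (intro meas_fam_Vsum m)+
  have ex: "renewal_conv_exists Q F z"
    unfolding renewal_conv_exists_def
    using Vfin by (simp add: infsum_ennreal_count_space sum_renewal_measure[OF m(3)] Vsum_def)
  have Zeq: "Z i t = enn2real (a i t) - enn2real (b i t)" for i t
  proof -
    have s: "(\<integral>\<^sup>+j. ennreal 1 * (\<integral>\<^sup>+x. ?fp j (t - x) \<partial>renewal_measure Q F i j) \<partial>count_space UNIV) = a i t"
      "(\<integral>\<^sup>+j. ennreal 1 * (\<integral>\<^sup>+x. ?fm j (t - x) \<partial>renewal_measure Q F i j) \<partial>count_space UNIV) = b i t"
      using sum_renewal_measure[OF m(1), where i = i and t = t] sum_renewal_measure[OF m(2), where i = i and t = t]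
      by (simp_all add: a_def b_def Vsum_def)
    have "(\<Sum>\<^sub>\<infinity>j\<in>UNIV. 1 * (\<integral>x. enn2real (?fp j (t - x)) - enn2real (?fm j (t - x)) \<partial>renewal_measure Q F i j))
      = enn2real (\<integral>\<^sup>+j. ennreal 1 * (\<integral>\<^sup>+x. ?fp j (t - x) \<partial>renewal_measure Q F i j) \<partial>count_space UNIV)
      - enn2real (\<integral>\<^sup>+j. ennreal 1 * (\<integral>\<^sup>+x. ?fm j (t - x) \<partial>renewal_measure Q F i j) \<partial>count_space UNIV)"
      by (rule weighted_integral_diff) (unfold s, simp_all add: fin[unfolded infinity_ennreal_def])
    then show ?thesis unfolding s by (simp add: Z_def renewal_conv_def enn2real_pos_neg)
  qed
  have absZ: "ennreal \<bar>Z i t\<bar> \<le> Vsum q ?f i t" for i t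
  proof -
    have "\<bar>Z i t\<bar> \<le> enn2real (Vsum q ?f i t)"
      using fin by (simp add: Zeq ab enn2real_add abs_le_iff)
    then show ?thesis using Vfin by (rule ennreal_le_if_le_enn2real)
  qed
  have Zm: "measurable_family Z"
  proof -
    have "Z i = (\<lambda>t. enn2real (a i t) - enn2real (b i t))" for i by (intro ext Zeq)
    moreover have "(\<lambda>t. enn2real (a i t) - enn2real (b i t)) \<in> borel_measurable borel" for i
      using mab[THEN meas_famD, of i] by measurable
    ultimately show ?thesis by (simp add: measurable_family_def)
  qed
  have ZL: "Z \<in> class_L v"
  proof -
    have "sup_norm (\<lambda>t. Z i t / v i) < \<infinity>" for i
    proof -
      obtain C where C: "C < \<infinity>" "\<And>t. Vsum q ?f i t \<le> C" using bv[of i] by (auto simp: bounded_vanishing_def)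
      have "sup_norm (\<lambda>t. Z i t / v i) \<le> C * ennreal (1 / v i)"
      proof (rule sup_norm_least)
        fix t
        have "ennreal \<bar>Z i t / v i\<bar> = ennreal \<bar>Z i t\<bar> * ennreal (1 / v i)"
          using v_gt[of i] by (simp add: ennreal_mult[symmetric] abs_mult)
        also have "\<dots> \<le> C * ennreal (1 / v i)"
          by (intro mult_right_mono order_trans[OF absZ C(2)]) simp
        finally show "ennreal \<bar>Z i t / v i\<bar> \<le> C * ennreal (1 / v i)" .
      qed
      also have "\<dots> < \<infinity>" using C(1) by (simp add: ennreal_mult_less_top)
      finally show ?thesis .
    qed
    moreover have "((\<lambda>t. Z i t / v i) \<longlongrightarrow> 0) at_bot" for i
    proof -
      have "((\<lambda>t. ennreal \<bar>Z i t\<bar>) \<longlongrightarrow> 0) at_bot"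
        by (rule tendsto_sandwich[OF _ _ tendsto_const, of _ _ _ "Vsum q ?f i"])
           (use bv[of i] absZ in \<open>auto simp: bounded_vanishing_def\<close>)
      then have "(Z i \<longlongrightarrow> 0) at_bot" by (simp add: tendsto_ennreal_abs_iff)
      from tendsto_divide[OF this tendsto_const[of "v i"]] v_gt[of i] show ?thesis by simp
    qed
    ultimately show ?thesis using Zm by (simp add: class_L_def)
  qed
  have solves: "solves_renewal_equation Q F z Z"
    unfolding solves_renewal_equation_iff[OF Zm]
  proof (intro allI conjI)
    fix i t
    have "mop q (\<lambda>j t. ennreal \<bar>Z j t\<bar>) i t \<le> mop q (Vsum q ?f) i t" by (rule mop_mono) (rule absZ)
    also have "\<dots> \<le> Vsum q ?f i t" using Vsum_unfold[OF m(3), where i = i and t = t] by simp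
    finally show fZ: "mop q (\<lambda>j t. ennreal \<bar>Z j t\<bar>) i t < \<infinity>" using Vfin by (rule le_less_trans)
    have au: "a i t = ?fp i t + mop q a i t" and bu: "b i t = ?fm i t + mop q b i t"
      unfolding a_def b_def by (rule Vsum_unfold, rule m)+
    have fin2: "mop q a i t < \<infinity>" "mop q b i t < \<infinity>" using fin[of i t] by (simp_all add: au bu)
    let ?p = "mop q (\<lambda>j t. ennreal (Z j t)) i t" and ?m = "mop q (\<lambda>j t. ennreal (- Z j t)) i t"
    note mZ = meas_fam_ennreal[OF Zm]
    have fin3: "?p < \<infinity>" "?m < \<infinity>" using fZ by (auto simp: mop_abs[OF Zm])
    \<comment> \<open>\<open>Z\<close> is the difference of \<open>a\<close> and \<open>b\<close>,
      but these need not be its positive and negative part; the balanced form carries the operator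
      from one decomposition to the other.\<close>
    have "ennreal (Z j t) + b j t = ennreal (- Z j t) + a j t" for j t
    proof -
      obtain x y where xy: "a j t = ennreal x" "0 \<le> x" "b j t = ennreal y" "0 \<le> y"
        using fin[of j t] by (cases "a j t"; cases "b j t") auto
      have "Z j t = x - y" using xy by (simp add: Zeq)
      then show ?thesis using xy
        by (cases "y \<le> x") (simp_all add: ennreal_neg ennreal_plus[symmetric] del: ennreal_plus)
    qed
    then have "?p + mop q b i t = ?m + mop q a i t"
      using mop_add[OF mZ(1) mab(2), of q i t] mop_add[OF mZ(2) mab(1), of q i t] by simp
    then have "enn2real (?p + mop q b i t) = enn2real (?m + mop q a i t)" by simp
    then have eq: "enn2real ?p - enn2real ?m = enn2real (mop q a i t) - enn2real (mop q b i t)"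
      using fin2 fin3 by (simp add: enn2real_add)
    have "Z i t = (enn2real (?fp i t) + enn2real (mop q a i t)) - (enn2real (?fm i t) + enn2real (mop q b i t))"
      unfolding Zeq au bu using fin2 by (simp add: enn2real_add)
    then show "Z i t = z i t + (enn2real ?p - enn2real ?m)"
      unfolding eq using enn2real_pos_neg[of "z i t"] by simp
  qed
  have uniq: "Y = Z" if Y: "Y \<in> class_L0_at v Z" "solves_renewal_equation Q F z Y" for Y
  proof -
    have Ym: "measurable_family Y" and D: "(\<lambda>i t. Y i t - Z i t) \<in> class_L0 v"
      using Y(1) by (auto simp: class_L0_at_def)
    let ?D = "\<lambda>j t. ennreal \<bar>Y j t - Z j t\<bar>"
    have YZm: "measurable_family (\<lambda>j t. Y j t - Z j t)" using D by (simp add: class_L0_def class_L_def)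
    define K where "K = (SUP i. sup_norm (\<lambda>t. (Y i t - Z i t) / v i))"
    have "?D i t = 0" for i t
    proof (rule zero[of ?D K])
      show "meas_fam ?D" by (rule meas_fam_ennreal[OF YZm])
      show "?D j t \<le> mop q ?D j t" for j t
        by (rule difference_subharmonic[OF Ym Y(2) Zm solves])
      show "K < \<infinity>" using D by (simp add: K_def class_L0_def)
      show "?D j t \<le> K * ennreal (v j)" for j t
      proof -
        have "?D j t = ennreal \<bar>(Y j t - Z j t) / v j\<bar> * ennreal (v j)"
          using v_gt[of j] by (simp add: ennreal_mult[symmetric])
        also have "ennreal \<bar>(Y j t - Z j t) / v j\<bar> \<le> sup_norm (\<lambda>t. (Y j t - Z j t) / v j)"
          by (rule sup_norm_upper)
        also have "\<dots> \<le> K" unfolding K_def by (rule SUP_upper) simp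
        finally show ?thesis by (simp add: mult_right_mono)
      qed
      show "(?D j \<longlongrightarrow> 0) at_bot" for j
      proof -
        have "((\<lambda>t. (Y j t - Z j t) / v j) \<longlongrightarrow> 0) at_bot"
          using D by (simp add: class_L0_def class_L_def)
        from tendsto_mult[OF this tendsto_const[of "v j"]] v_gt[of j]
        have "((\<lambda>t. Y j t - Z j t) \<longlongrightarrow> 0) at_bot" by simp
        then show ?thesis by (simp only: tendsto_ennreal_abs_iff)
      qed
    qed
    then show ?thesis by (auto simp: fun_eq_iff)
  qed
  have Zat: "Z \<in> class_L0_at v Z"
    using Zm by (simp add: class_L0_at_def class_L0_def class_L_def sup_norm_def measurable_family_def)
  have "unique_solution_in (class_L0 v) Q F z Z" if "finite (UNIV :: 's set) \<or> Z \<in> class_L0 v"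
  proof -
    have Z0: "Z \<in> class_L0 v" using that class_L_finite[OF _ ZL] by blast
    have "Y \<in> class_L0_at v Z" if "Y \<in> class_L0 v" for Y
      using class_L0_diff[OF that Z0] that by (auto simp: class_L0_at_def class_L0_def class_L_def)
    then show ?thesis unfolding unique_solution_in_def using Z0 solves uniq by blast
  qed
  moreover have "unique_solution_in (class_L0_at v Z) Q F z Z"
    unfolding unique_solution_in_def using Zat solves uniq by blast
  ultimately show ?thesis using ex ZL by blast
qed

end

section \<open>Recurrence and drift at an arbitrary root, and the resulting renewal theorem\<close>

lemma mat_act_pow_add_ge:
  "(mat_act q ^^ m) (indicator {j}) i * (mat_act q ^^ n) (indicator {k}) j
    \<le> (mat_act q ^^ (m + n)) (indicator {k}) i"
proof -
  have "(mat_act q ^^ n) (indicator {k}) j * (mat_act q ^^ m) (indicator {j}) i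
      \<le> (mat_act q ^^ m) ((mat_act q ^^ n) (indicator {k})) i"
    unfolding mat_act_pow_cmult[symmetric] by (rule mat_act_pow_mono) (auto simp: indicator_def)
  then show ?thesis by (simp add: funpow_add mult.commute)
qed

lemma drift_nn_integral:
  fixes Q :: "'s::countable \<Rightarrow> 's \<Rightarrow> real"
  assumes "\<And>i j. 0 \<le> Q i j" "\<And>i. 0 \<le> u i" "\<And>i. 0 \<le> v i"
  shows "(\<Sum>\<^sub>\<infinity>(i, j)\<in>UNIV. ennreal (u i * Q i j * v j) * g i j)
    = (\<integral>\<^sup>+i. ennreal (u i) * (\<integral>\<^sup>+j. ennreal (Q i j) * ennreal (v j) * g i j \<partial>count_space UNIV) \<partial>count_space UNIV)"
proof -
  have "(\<Sum>\<^sub>\<infinity>(i, j)\<in>UNIV. ennreal (u i * Q i j * v j) * g i j)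
     = (\<integral>\<^sup>+p. (case p of (i, j) \<Rightarrow> ennreal (u i * Q i j * v j) * g i j) \<partial>count_space UNIV)"
    by (rule infsum_ennreal_count_space)
  also have "\<dots> = (\<integral>\<^sup>+i. \<integral>\<^sup>+j. ennreal (u i * Q i j * v j) * g i j \<partial>count_space UNIV \<partial>count_space UNIV)"
    by (subst nn_integral_fst_count_space[symmetric]) simp
  also have "\<dots> = (\<integral>\<^sup>+i. ennreal (u i) * (\<integral>\<^sup>+j. ennreal (Q i j) * ennreal (v j) * g i j \<partial>count_space UNIV) \<partial>count_space UNIV)"
    using assms by (simp add: nn_integral_cmult[symmetric] ennreal_mult mult.assoc)
  finally show ?thesis .
qed

lemma nn_integral_has_sum:
  fixes f :: "'k \<Rightarrow> real"
  assumes "\<And>x. 0 \<le> f x" "(f has_sum s) UNIV"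
  shows "(\<integral>\<^sup>+x. ennreal (f x) \<partial>count_space UNIV) = ennreal s"
  using nn_integral_count_space_infsum[OF assms(1) has_sum_imp_summable[OF assms(2)]] infsumI[OF assms(2)]
  by simp

theorem theorem1p4:
  fixes Q :: "'s::countable \<Rightarrow> 's \<Rightarrow> real"
    and F :: "'s \<Rightarrow> 's \<Rightarrow> real measure"
    and u v :: "'s \<Rightarrow> real"
    and z :: "'s \<Rightarrow> real \<Rightarrow> real"
  defines "Zstar \<equiv> renewal_conv Q F z"
  assumes "quasi_stochastic Q"
    and "positive_left_eigenvector Q u"
    and "positive_right_eigenvector Q v"
    and "\<And>i j. real_distribution (F i j)"
    and "\<exists>i. (\<Sum>n. ennreal (mat_pow Q (Suc n) i i)) = \<infinity>"
    and "drift_well_defined Q F u v"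
    and "drift Q F u v > 0"
    and "nonarithmetic Q F u v"
    and "directly_Riemann_integrable u z \<or>
         (spread_out Q F u v \<and> measurable_family z \<and>
          (\<forall>i. sup_norm (z i) < \<infinity> \<and> (z i \<longlongrightarrow> 0) at_infinity) \<and>
          (\<Sum>\<^sub>\<infinity>i\<in>UNIV. ennreal (u i) * sup_norm (z i)) < \<infinity> \<and>
          (\<Sum>\<^sub>\<infinity>i\<in>UNIV. ennreal (u i) * L1_norm (z i)) < \<infinity>)"
  shows "renewal_conv_exists Q F z \<and>
         Zstar \<in> class_L v \<and>
         unique_solution_in (class_L0_at v Zstar) Q F z Zstar \<and>
         (finite (UNIV :: 's set) \<or> Zstar \<in> class_L0 v \<longrightarrow>
            unique_solution_in (class_L0 v) Q F z Zstar)"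
proof -
  have Qnn: "0 \<le> Q i j" for i j using assms(2) by (simp add: quasi_stochastic_def)
  interpret renewal_data F Q v
    by (intro renewal_data.intro conv_matrix.intro renewal_data_axioms.intro assms(4,5) Qnn)
  let ?u = "\<lambda>i. ennreal (u i)" and ?v = "\<lambda>i. ennreal (v i)"
  have u0: "0 < u i" for i using assms(3) by (simp add: positive_left_eigenvector_def)
  have left: "(\<integral>\<^sup>+i. ?u i * q i j \<partial>count_space UNIV) = ?u j" for j
  proof -
    have "(\<integral>\<^sup>+i. ennreal (u i * Q i j) \<partial>count_space UNIV) = ?u j"
      by (rule nn_integral_has_sum)
         (use assms(3) Qnn u0 in \<open>auto simp: positive_left_eigenvector_def less_imp_le\<close>)
    then show ?thesis using u0 Qnn by (simp add: q_def ennreal_mult less_imp_le)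
  qed
  have right': "mat_act q ?v i = ?v i" for i
  proof -
    have "(\<integral>\<^sup>+j. ennreal (Q i j * v j) \<partial>count_space UNIV) = ?v i"
      by (rule nn_integral_has_sum)
         (use assms(4) Qnn v_gt in \<open>auto simp: positive_right_eigenvector_def less_imp_le\<close>)
    then show ?thesis using v_gt Qnn by (simp add: mat_act_def q_def ennreal_mult less_imp_le)
  qed
  have irr: "\<exists>n. 0 < (mat_act q ^^ n) (indicator {j}) i" for i j
    using assms(2) unfolding mat_act_pow_eq quasi_stochastic_def irreducible_mat_def
    by (metis ennreal_less_zero_iff)
  \<comment> \<open>Recurrence passes from \<open>i\<close> to \<open>r\<close>: a loop at
    \<open>i\<close> of length \<open>Suc n\<close>, preceded by a path from \<open>r\<close> and
    followed by one back to \<open>r\<close>, is a loop at \<open>r\<close>. This accounts for the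
    shift by \<open>k + Suc l\<close>.\<close>
  have rec: "(\<Sum>n. (mat_act q ^^ n) (indicator {r}) r) = \<infinity>" for r
  proof -
    let ?p = "\<lambda>n i j. (mat_act q ^^ n) (indicator {j}) i"
    obtain i where "(\<Sum>n. ennreal (mat_pow Q (Suc n) i i)) = \<infinity>" using assms(6) by blast
    then have i: "(\<Sum>n. ?p (Suc n) i i) = \<infinity>" by (simp only: mat_act_pow_eq)
    obtain k where k: "0 < ?p k r i" using irr by blast
    obtain l where l: "0 < ?p l i r" using irr by blast
    have le: "?p k r i * ?p l i r * ?p (Suc n) i i \<le> ?p (n + (k + Suc l)) r r" for n
    proof -
      have "?p k r i * ?p l i r * ?p (Suc n) i i = ?p k r i * (?p (Suc n) i i * ?p l i r)"
        by (simp only: mult_ac)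
      also have "\<dots> \<le> ?p k r i * ?p (Suc n + l) i r"
        by (intro mult_left_mono mat_act_pow_add_ge) simp
      also have "\<dots> \<le> ?p (k + (Suc n + l)) r r" by (rule mat_act_pow_add_ge)
      also have "k + (Suc n + l) = n + (k + Suc l)" by simp
      finally show ?thesis .
    qed
    have "?p k r i * ?p l i r \<noteq> 0" using k l by (simp add: zero_less_iff_neq_zero)
    then have "\<infinity> = ?p k r i * ?p l i r * (\<Sum>n. ?p (Suc n) i i)"
      unfolding i by (simp add: ennreal_mult_top)
    also have "\<dots> = (\<Sum>n. ?p k r i * ?p l i r * ?p (Suc n) i i)" by simp
    also have "\<dots> \<le> (\<Sum>n. ?p (n + (k + Suc l)) r r)" by (rule suminf_le[OF le summableI summableI])
    also have "\<dots> \<le> (\<Sum>n. ?p n r r)"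
      by (subst (2) suminf_offset[of _ "k + Suc l"]) auto
    finally show ?thesis by (simp add: top_unique)
  qed
  have MR: "markov_renewal F q ?u ?v r" for r
    by (intro markov_renewal.intro markov_renewal_axioms.intro conv_matrix_axioms left right' irr rec)
       (simp_all add: u0 v_gt)
  have drift_eq: "drift_pos Q F u v = (\<integral>\<^sup>+i. ?u i * markov_renewal.mean_pos F q ?v i \<partial>count_space UNIV)"
    "drift_neg Q F u v = (\<integral>\<^sup>+i. ?u i * markov_renewal.mean_neg F q ?v i \<partial>count_space UNIV)"
    unfolding markov_renewal.mean_pos_def[OF MR] markov_renewal.mean_neg_def[OF MR] markov_renewal.v_avg_def[OF MR]
      drift_pos_def drift_neg_def q_def ennreal_max0[symmetric]
    using Qnn u0 v_gt by (simp_all add: drift_nn_integral less_imp_le)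
  have drift_less: "drift_neg Q F u v < drift_pos Q F u v"
  proof -
    obtain a b where ab: "drift_pos Q F u v = a" "drift_neg Q F u v = b" by blast
    \<comment> \<open>In \<open>ereal\<close>, \<infinity> - \<infinity> equals \<infinity>, so
      positivity of the difference gives \<open>b < a\<close> only together with the finiteness of
      one part.\<close>
    have "b < \<infinity> \<or> a < \<infinity>" "0 < enn2ereal a - enn2ereal b"
      using assms(7,8) by (auto simp: drift_well_defined_def drift_def ab)
    then have "b < a"
      by (cases a; cases b) (auto simp: ennreal_less_iff)
    then show ?thesis by (simp add: ab)
  qed
  have MRD: "markov_renewal_drift F q ?u ?v r" for r
    by (intro markov_renewal_drift.intro MR markov_renewal_drift_axioms.intro)
       (use drift_less drift_eq in simp)
  let ?f = "\<lambda>j t. ennreal \<bar>z j t\<bar>"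
  have zm: "measurable_family z" using assms(10) by (auto simp: directly_Riemann_integrable_def)
  note mf = meas_fam_ennreal(3)[OF zm]
  \<comment> \<open>The estimates hold at the root, so each state is taken as the root in
    turn.\<close>
  have bv: "bounded_vanishing (Vsum q ?f r)" for r
  proof -
    interpret M: markov_renewal_drift F q ?u ?v r by (rule MRD)
    from assms(10) show ?thesis
    proof
      assume "directly_Riemann_integrable u z"
      then obtain \<epsilon> where \<epsilon>: "\<epsilon> > 0" and fin: "(\<Sum>\<^sub>\<infinity>i\<in>UNIV. ennreal (u i) *
        (\<Sum>\<^sub>\<infinity>n\<in>(UNIV :: int set). SUP x\<in>{of_int n * \<epsilon><..(of_int n + 1) * \<epsilon>}. ennreal \<bar>z i x\<bar>)) < \<infinity>"
        by (auto simp: directly_Riemann_integrable_def)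
      define s where "s i n = (SUP x\<in>{of_int n * \<epsilon><..(of_int n + 1) * \<epsilon>}. ennreal \<bar>z i x\<bar>)" for i and n :: int
      show ?thesis
      proof (rule M.Vsum_step_functions[OF mf])
        show "?f j t \<le> (\<integral>\<^sup>+k. s j k * indicator {real_of_int k * \<epsilon><..real_of_int k * \<epsilon> + \<epsilon>} t \<partial>count_space UNIV)" for j t
        proof -
          \<comment> \<open>The cells are open on the left and closed on the right, hence the
            ceiling minus 1 instead of the floor.\<close>
          define k where "k = \<lceil>t / \<epsilon>\<rceil> - 1"
          have "real_of_int k < t / \<epsilon>" "t / \<epsilon> \<le> real_of_int k + 1"
            unfolding k_def by linarith+
          then have t: "t \<in> {real_of_int k * \<epsilon><..(real_of_int k + 1) * \<epsilon>}"
            using \<epsilon> by (simp add: pos_less_divide_eq pos_divide_le_eq)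
          have "?f j t \<le> s j k" unfolding s_def by (rule SUP_upper) (rule t)
          also have "\<dots> = s j k * indicator {real_of_int k * \<epsilon><..real_of_int k * \<epsilon> + \<epsilon>} t"
            using t by (simp add: distrib_right)
          also have "\<dots> \<le> (\<integral>\<^sup>+k. s j k * indicator {real_of_int k * \<epsilon><..real_of_int k * \<epsilon> + \<epsilon>} t \<partial>count_space UNIV)"
            by (rule nn_integral_count_space_upper)
          finally show ?thesis .
        qed
        show "(\<integral>\<^sup>+j. ?u j * (\<integral>\<^sup>+k. s j k \<partial>count_space UNIV) \<partial>count_space UNIV) < \<infinity>"
          using fin by (simp add: s_def infsum_ennreal_count_space)
      qed
    next
      assume A: "spread_out Q F u v \<and> measurable_family z \<and>
          (\<forall>i. sup_norm (z i) < \<infinity> \<and> (z i \<longlongrightarrow> 0) at_infinity) \<and>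
          (\<Sum>\<^sub>\<infinity>i\<in>UNIV. ennreal (u i) * sup_norm (z i)) < \<infinity> \<and>
          (\<Sum>\<^sub>\<infinity>i\<in>UNIV. ennreal (u i) * L1_norm (z i)) < \<infinity>"
      then obtain n i j where nij: "u i * mat_pow Q n i j * v j > 0" "\<not> lebesgue_singular (conv_law Q F n i j)"
        by (auto simp: spread_out_def)
      then have "mat_pow Q n i j \<noteq> 0" by auto
      then have "mat_pow Q n i j > 0" using mat_pow_facts'(1)[of n i j] by simp
      then have ns: "\<not> lebesgue_singular (pow_law q n i j)"
        using lebesgue_singular_conv_law nij(2) by blast
      show ?thesis
      proof (rule M.Vsum_spread_out[OF ns mf, where c = "\<lambda>j. sup_norm (z j)"])
        show "?f j t \<le> sup_norm (z j)" for j t by (rule sup_norm_upper)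
        show "(\<integral>\<^sup>+i. ?u i * sup_norm (z i) \<partial>count_space UNIV) < \<infinity>"
          using A by (simp add: infsum_ennreal_count_space)
        show "(\<integral>\<^sup>+i. ?u i * (\<integral>\<^sup>+t. ?f i t \<partial>lborel) \<partial>count_space UNIV) < \<infinity>"
          using A by (simp add: infsum_ennreal_count_space L1_norm_def)
        show "(?f j \<longlongrightarrow> 0) at_bot" for j
          unfolding tendsto_ennreal_abs_iff
          using A by (auto intro: tendsto_mono[OF at_bot_le_at_infinity])
      qed
    qed
  qed
  show ?thesis unfolding Zstar_def
  proof (rule renewal_theorem_from_bounds[OF zm bv])
    fix D K i t
    assume D: "meas_fam D" "\<And>j t. D j t \<le> mop q D j t" "\<And>j t. D j t \<le> K * ?v j" "K < \<infinity>"
      "\<And>j. (D j \<longlongrightarrow> 0) at_bot"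
    show "D i t = 0"
      by (rule markov_renewal_drift.subharmonic_zero[OF MRD D(1-4) D(5)])
  qed
qed

end
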